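(* Let $V$ be a triholomorphic Killing vector field on a connected hyper-Kähler manifold $(M,g,J_1,J_2,J_3)$ with zero first Betti number. For $j=1,2,3$, let $f_j$ be the Hamiltonian of $V$ with respect to the Kähler form of $J_j$. Then $(f_1,f_2,f_3)$ is a harmonic morphism from $(M,g)$ to $\mathbb R^3$ (with its canonical Euclidean metric).
   Context: $(g,J_1,J_2,J_3)$ hyper-Kähler means that $g$ is Kähler with respect to each $J_j$ and $J_1J_2=J_3=-J_2J_1$. A Killing field is triholomorphic if its local flow preserves $J_1,J_2,J_3$. The Kähler form of $J_j$ is $\omega_j(X,Y)=g(J_jX,Y)$, and the Hamiltonian of $V$ with respect to $\omega_j$ is a function $f_j$ with $df_j=\omega_j(V,\cdot)$ (same sign convention for all $j$; defined up to an additive constant). A harmonic morphism is a smooth map $\phi:(M,g)\to(N,h)$ between Riemannian manifolds such that $f\circ\phi$ is harmonic on $\phi^{-1}(U)$ for every harmonic function $f$ on an open set $U\subseteq N$ with $\phi^{-1}(U)\neq\emptyset$. Equivalently, $\phi$ is a harmonic map which is horizontally weakly conformal, i.e. at each point $x$ either $d\phi_x=0$ or $d\phi_x$ restricted to $(\ker d\phi_x)^\perp$ is a conformal linear isomorphism onto $T_{\phi(x)}N$. *)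

theory Defs
  imports "HOL-Analysis.Analysis" "HOL-Homology.Homology" "HOL-Library.Extended_Nat"
begin

section \<open>Smooth functions on open subsets of Euclidean spaces\<close>

text \<open>For an open set \<open>S\<close>, \<open>Ck_on k f S\<close> says that \<open>f\<close> is of class \<open>C\<^sup>k\<close> on \<open>S\<close>.\<close>

primrec Ck_on :: "nat \<Rightarrow> ('a::euclidean_space \<Rightarrow> 'b::real_normed_vector) \<Rightarrow> 'a set \<Rightarrow> bool" where
  "Ck_on 0 f S \<longleftrightarrow> continuous_on S f"
| "Ck_on (Suc k) f S \<longleftrightarrow> (\<forall>x\<in>S. f differentiable (at x)) \<and>
      (\<forall>v. Ck_on k (\<lambda>x. frechet_derivative f (at x) v) S)"

definition smooth_on :: "'a set \<Rightarrow> ('a::euclidean_space \<Rightarrow> 'b::real_normed_vector) \<Rightarrow> bool" where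
  "smooth_on S f \<longleftrightarrow> (\<forall>k. Ck_on k f S)"


section \<open>Smooth manifolds\<close>

text \<open>
  A manifold is a Hausdorff second countable type \<open>'m\<close> with a smooth atlas. A chart is its domain
  together with a map into the model space \<open>'e\<close>; the map is irrelevant outside the domain.
\<close>

type_synonym ('m, 'e) chart = "'m set \<times> ('m \<Rightarrow> 'e)"

definition chart_inv :: "('m, 'e) chart \<Rightarrow> 'e \<Rightarrow> 'm" where
  "chart_inv c = inv_into (fst c) (snd c)"

definition chart_image :: "('m, 'e) chart \<Rightarrow> 'e set" where
  "chart_image c = snd c ` fst c"

definition smooth_atlas :: "('m::topological_space, 'e::euclidean_space) chart set \<Rightarrow> bool" where
  "smooth_atlas A \<longleftrightarrow>
     (\<Union>c\<in>A. fst c) = UNIV \<and>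
     (\<forall>c\<in>A. open (fst c) \<and> open (chart_image c) \<and>
            homeomorphism (fst c) (chart_image c) (snd c) (chart_inv c)) \<and>
     (\<forall>c\<in>A. \<forall>d\<in>A. smooth_on (snd c ` (fst c \<inter> fst d)) (snd d \<circ> chart_inv c))"

text \<open>
  The tangent space at \<open>x\<close> is modelled on \<open>'e\<close> by means of one chart around \<open>x\<close>, chosen once and
  for all: an element of \<open>'e\<close>, regarded as a tangent vector at \<open>x\<close>, is the coordinate vector with
  respect to \<open>chart_at A x\<close>. Hence tensor fields are plain functions of the point, but their
  smoothness and their derivatives have to be expressed in the charts of the atlas, see below.
\<close>

definition chart_at :: "('m, 'e) chart set \<Rightarrow> 'm \<Rightarrow> ('m, 'e) chart" where
  "chart_at A x = (SOME c. c \<in> A \<and> x \<in> fst c)"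

definition smooth_map_on ::
  "('m::topological_space, 'e::euclidean_space) chart set \<Rightarrow>
   ('n::topological_space, 'f::euclidean_space) chart set \<Rightarrow> 'm set \<Rightarrow> ('m \<Rightarrow> 'n) \<Rightarrow> bool" where
  "smooth_map_on A B W F \<longleftrightarrow>
     (\<forall>x\<in>W. \<forall>c\<in>A. \<forall>d\<in>B. x \<in> fst c \<longrightarrow> F x \<in> fst d \<longrightarrow>
        (\<exists>N. open N \<and> snd c x \<in> N \<and> N \<subseteq> snd c ` (fst c \<inter> W) \<and>
             (F \<circ> chart_inv c) ` N \<subseteq> fst d \<and> smooth_on N (snd d \<circ> F \<circ> chart_inv c)))"

text \<open>The differential \<open>dF\<^sub>x\<close> from the tangent space at \<open>x\<close> to the tangent space at \<open>F x\<close>.\<close>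

definition differential ::
  "('m, 'e::euclidean_space) chart set \<Rightarrow> ('n, 'f::euclidean_space) chart set \<Rightarrow>
   ('m \<Rightarrow> 'n) \<Rightarrow> 'm \<Rightarrow> 'e \<Rightarrow> 'f" where
  "differential A B F x v =
     frechet_derivative (snd (chart_at B (F x)) \<circ> F \<circ> chart_inv (chart_at A x))
       (at (snd (chart_at A x) x)) v"

definition euclid_atlas :: "('e, 'e) chart set" where
  "euclid_atlas = {(UNIV, id)}"

definition cylinder_atlas :: "('m, 'e) chart set \<Rightarrow> (real \<times> 'm, real \<times> 'e) chart set" where
  "cylinder_atlas A = (\<lambda>(U, \<phi>). (UNIV \<times> U, map_prod id \<phi>)) ` A"


section \<open>Local expressions of tensor fields\<close>

text \<open>
  In the following, \<open>y\<close> is a point of the image of the chart \<open>c\<close>, and \<open>coord_vec A c y u\<close> is the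
  tangent vector at \<open>chart_inv c y\<close> whose coordinate vector with respect to \<open>c\<close> is \<open>u\<close>.
\<close>

definition coord_vec ::
  "('m, 'e::euclidean_space) chart set \<Rightarrow> ('m, 'e) chart \<Rightarrow> 'e \<Rightarrow> 'e \<Rightarrow> 'e" where
  "coord_vec A c y u = differential euclid_atlas A (chart_inv c) y u"

definition metric_in ::
  "('m, 'e::euclidean_space) chart set \<Rightarrow> ('m \<Rightarrow> 'e \<Rightarrow> 'e \<Rightarrow> real) \<Rightarrow> ('m, 'e) chart \<Rightarrow>
   'e \<Rightarrow> 'e \<Rightarrow> 'e \<Rightarrow> real" where
  "metric_in A g c y u w = g (chart_inv c y) (coord_vec A c y u) (coord_vec A c y w)"

definition field_in ::
  "('m, 'e::euclidean_space) chart set \<Rightarrow> ('m \<Rightarrow> 'e) \<Rightarrow> ('m, 'e) chart \<Rightarrow> 'e \<Rightarrow> 'e" where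
  "field_in A V c y = differential A euclid_atlas (snd c) (chart_inv c y) (V (chart_inv c y))"

definition endo_in ::
  "('m, 'e::euclidean_space) chart set \<Rightarrow> ('m \<Rightarrow> 'e \<Rightarrow> 'e) \<Rightarrow> ('m, 'e) chart \<Rightarrow> 'e \<Rightarrow> 'e \<Rightarrow> 'e" where
  "endo_in A J c y u =
     differential A euclid_atlas (snd c) (chart_inv c y) (J (chart_inv c y) (coord_vec A c y u))"

definition vector_field ::
  "('m, 'e::euclidean_space) chart set \<Rightarrow> ('m \<Rightarrow> 'e) \<Rightarrow> bool" where
  "vector_field A V \<longleftrightarrow> (\<forall>c\<in>A. smooth_on (chart_image c) (field_in A V c))"

definition endo_field ::
  "('m, 'e::euclidean_space) chart set \<Rightarrow> ('m \<Rightarrow> 'e \<Rightarrow> 'e) \<Rightarrow> bool" where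
  "endo_field A J \<longleftrightarrow>
     (\<forall>x. linear (J x)) \<and> (\<forall>c\<in>A. \<forall>u. smooth_on (chart_image c) (\<lambda>y. endo_in A J c y u))"


section \<open>Riemannian manifolds\<close>

definition riemannian_metric ::
  "('m, 'e::euclidean_space) chart set \<Rightarrow> ('m \<Rightarrow> 'e \<Rightarrow> 'e \<Rightarrow> real) \<Rightarrow> bool" where
  "riemannian_metric A g \<longleftrightarrow>
     (\<forall>x. bilinear (g x)) \<and> (\<forall>x u w. g x u w = g x w u) \<and> (\<forall>x u. u \<noteq> 0 \<longrightarrow> 0 < g x u u) \<and>
     (\<forall>c\<in>A. \<forall>u w. smooth_on (chart_image c) (\<lambda>y. metric_in A g c y u w))"

definition riemannian_manifold ::
  "('m::{t2_space,second_countable_topology}, 'e::euclidean_space) chart set \<Rightarrow>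
   ('m \<Rightarrow> 'e \<Rightarrow> 'e \<Rightarrow> real) \<Rightarrow> bool" where
  "riemannian_manifold A g \<longleftrightarrow> smooth_atlas A \<and> riemannian_metric A g"

definition euclid_metric :: "'e::euclidean_space \<Rightarrow> 'e \<Rightarrow> 'e \<Rightarrow> real" where
  "euclid_metric x u w = u \<bullet> w"

text \<open>The vector dual to the linear form \<open>\<alpha>\<close> with respect to the inner product \<open>G\<close>.\<close>

definition sharp :: "('e \<Rightarrow> 'e \<Rightarrow> real) \<Rightarrow> ('e \<Rightarrow> real) \<Rightarrow> 'e" where
  "sharp G \<alpha> = (THE v. \<forall>w. G v w = \<alpha> w)"

text \<open>
  The Levi-Civita connection in the chart \<open>c\<close>: \<open>christoffel A g c y u w\<close> is \<open>\<nabla>\<^sub>u w\<close> for the fields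
  with constant coordinate vectors \<open>u\<close> and \<open>w\<close>, as given by the Koszul formula.
\<close>

definition christoffel ::
  "('m, 'e::euclidean_space) chart set \<Rightarrow> ('m \<Rightarrow> 'e \<Rightarrow> 'e \<Rightarrow> real) \<Rightarrow> ('m, 'e) chart \<Rightarrow>
   'e \<Rightarrow> 'e \<Rightarrow> 'e \<Rightarrow> 'e" where
  "christoffel A g c y u w =
     sharp (metric_in A g c y)
       (\<lambda>z. (frechet_derivative (\<lambda>y'. metric_in A g c y' w z) (at y) u
           + frechet_derivative (\<lambda>y'. metric_in A g c y' u z) (at y) w
           - frechet_derivative (\<lambda>y'. metric_in A g c y' u w) (at y) z) / 2)"

text \<open>\<open>\<nabla>J = 0\<close>, where \<open>(\<nabla>\<^sub>u J) w = \<nabla>\<^sub>u (J w) - J (\<nabla>\<^sub>u w)\<close>.\<close>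

definition parallel_endo ::
  "('m, 'e::euclidean_space) chart set \<Rightarrow> ('m \<Rightarrow> 'e \<Rightarrow> 'e \<Rightarrow> real) \<Rightarrow> ('m \<Rightarrow> 'e \<Rightarrow> 'e) \<Rightarrow> bool" where
  "parallel_endo A g J \<longleftrightarrow>
     (\<forall>c\<in>A. \<forall>y\<in>chart_image c. \<forall>u w.
        frechet_derivative (\<lambda>y'. endo_in A J c y' w) (at y) u
        + christoffel A g c y u (endo_in A J c y w)
        - endo_in A J c y (christoffel A g c y u w) = 0)"

text \<open>The Hessian \<open>\<nabla>df\<close> in a chart, and its trace with respect to the metric.\<close>

definition hessian_in ::
  "('m, 'e::euclidean_space) chart set \<Rightarrow> ('m \<Rightarrow> 'e \<Rightarrow> 'e \<Rightarrow> real) \<Rightarrow> ('m, 'e) chart \<Rightarrow>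
   ('m \<Rightarrow> real) \<Rightarrow> 'e \<Rightarrow> 'e \<Rightarrow> 'e \<Rightarrow> real" where
  "hessian_in A g c f y u w =
     frechet_derivative (\<lambda>y'. frechet_derivative (f \<circ> chart_inv c) (at y') w) (at y) u
     - frechet_derivative (f \<circ> chart_inv c) (at y) (christoffel A g c y u w)"

definition laplacian_in ::
  "('m, 'e::euclidean_space) chart set \<Rightarrow> ('m \<Rightarrow> 'e \<Rightarrow> 'e \<Rightarrow> real) \<Rightarrow> ('m, 'e) chart \<Rightarrow>
   ('m \<Rightarrow> real) \<Rightarrow> 'e \<Rightarrow> real" where
  "laplacian_in A g c f y =
     (\<Sum>b\<in>Basis. sharp (metric_in A g c y) (hessian_in A g c f y b) \<bullet> b)"

definition harmonic_on ::
  "('m::topological_space, 'e::euclidean_space) chart set \<Rightarrow> ('m \<Rightarrow> 'e \<Rightarrow> 'e \<Rightarrow> real) \<Rightarrow>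
   'm set \<Rightarrow> ('m \<Rightarrow> real) \<Rightarrow> bool" where
  "harmonic_on A g W f \<longleftrightarrow>
     smooth_map_on A euclid_atlas W f \<and>
     (\<forall>c\<in>A. \<forall>x\<in>fst c \<inter> W. laplacian_in A g c f (snd c x) = 0)"

definition harmonic_morphism ::
  "('m::topological_space, 'e::euclidean_space) chart set \<Rightarrow> ('m \<Rightarrow> 'e \<Rightarrow> 'e \<Rightarrow> real) \<Rightarrow>
   ('n::topological_space, 'f::euclidean_space) chart set \<Rightarrow> ('n \<Rightarrow> 'f \<Rightarrow> 'f \<Rightarrow> real) \<Rightarrow>
   ('m \<Rightarrow> 'n) \<Rightarrow> bool" where
  "harmonic_morphism A g B h \<phi> \<longleftrightarrow>
     smooth_map_on A B UNIV \<phi> \<and>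
     (\<forall>U f. open U \<longrightarrow> \<phi> -` U \<noteq> {} \<longrightarrow> harmonic_on B h U f \<longrightarrow>
        harmonic_on A g (\<phi> -` U) (f \<circ> \<phi>))"


section \<open>Hyper-Kaehler manifolds\<close>

definition kaehler ::
  "('m::{t2_space,second_countable_topology}, 'e::euclidean_space) chart set \<Rightarrow>
   ('m \<Rightarrow> 'e \<Rightarrow> 'e \<Rightarrow> real) \<Rightarrow> ('m \<Rightarrow> 'e \<Rightarrow> 'e) \<Rightarrow> bool" where
  "kaehler A g J \<longleftrightarrow>
     riemannian_manifold A g \<and> endo_field A J \<and>
     (\<forall>x u. J x (J x u) = - u) \<and> (\<forall>x u w. g x (J x u) (J x w) = g x u w) \<and>
     parallel_endo A g J"

definition hyperkaehler ::
  "('m::{t2_space,second_countable_topology}, 'e::euclidean_space) chart set \<Rightarrow>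
   ('m \<Rightarrow> 'e \<Rightarrow> 'e \<Rightarrow> real) \<Rightarrow> ('m \<Rightarrow> 'e \<Rightarrow> 'e) \<Rightarrow> ('m \<Rightarrow> 'e \<Rightarrow> 'e) \<Rightarrow> ('m \<Rightarrow> 'e \<Rightarrow> 'e) \<Rightarrow> bool" where
  "hyperkaehler A g J\<^sub>1 J\<^sub>2 J\<^sub>3 \<longleftrightarrow>
     kaehler A g J\<^sub>1 \<and> kaehler A g J\<^sub>2 \<and> kaehler A g J\<^sub>3 \<and>
     (\<forall>x u. J\<^sub>1 x (J\<^sub>2 x u) = J\<^sub>3 x u \<and> J\<^sub>3 x u = - J\<^sub>2 x (J\<^sub>1 x u))"

definition kaehler_form ::
  "('m \<Rightarrow> 'e \<Rightarrow> 'e \<Rightarrow> real) \<Rightarrow> ('m \<Rightarrow> 'e \<Rightarrow> 'e) \<Rightarrow> 'm \<Rightarrow> 'e \<Rightarrow> 'e \<Rightarrow> real" where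
  "kaehler_form g J x u w = g x (J x u) w"

definition hamiltonian ::
  "('m::topological_space, 'e::euclidean_space) chart set \<Rightarrow> ('m \<Rightarrow> 'e \<Rightarrow> 'e \<Rightarrow> real) \<Rightarrow>
   ('m \<Rightarrow> 'e) \<Rightarrow> ('m \<Rightarrow> real) \<Rightarrow> bool" where
  "hamiltonian A \<omega> V f \<longleftrightarrow>
     smooth_map_on A euclid_atlas UNIV f \<and>
     (\<forall>x w. differential A euclid_atlas f x w = \<omega> x (V x) w)"


section \<open>Local flows\<close>

definition local_flow ::
  "('m::topological_space, 'e::euclidean_space) chart set \<Rightarrow> ('m \<Rightarrow> 'e) \<Rightarrow>
   real \<Rightarrow> 'm set \<Rightarrow> (real \<Rightarrow> 'm \<Rightarrow> 'm) \<Rightarrow> bool" where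
  "local_flow A V \<epsilon> W \<theta> \<longleftrightarrow>
     0 < \<epsilon> \<and> open W \<and>
     smooth_map_on (cylinder_atlas A) A ({-\<epsilon><..<\<epsilon>} \<times> W) (\<lambda>(t, x). \<theta> t x) \<and>
     (\<forall>x\<in>W. \<theta> 0 x = x) \<and>
     (\<forall>t\<in>{-\<epsilon><..<\<epsilon>}. \<forall>x\<in>W.
        ((\<lambda>s. snd (chart_at A (\<theta> t x)) (\<theta> s x)) has_vector_derivative V (\<theta> t x)) (at t))"

text \<open>
  A smooth vector field has a local flow near every point, and two such flows agree where both are
  defined, for small times. Thus it does not matter that the local flow is quantified existentially.
\<close>

definition flow_preserves_metric ::
  "('m::topological_space, 'e::euclidean_space) chart set \<Rightarrow> ('m \<Rightarrow> 'e) \<Rightarrow>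
   ('m \<Rightarrow> 'e \<Rightarrow> 'e \<Rightarrow> real) \<Rightarrow> bool" where
  "flow_preserves_metric A V g \<longleftrightarrow>
     (\<forall>p. \<exists>\<epsilon> W \<theta>. p \<in> W \<and> local_flow A V \<epsilon> W \<theta> \<and>
        (\<forall>t\<in>{-\<epsilon><..<\<epsilon>}. \<forall>x\<in>W. \<forall>u w.
           g (\<theta> t x) (differential A A (\<theta> t) x u) (differential A A (\<theta> t) x w) = g x u w))"

definition flow_preserves_endo ::
  "('m::topological_space, 'e::euclidean_space) chart set \<Rightarrow> ('m \<Rightarrow> 'e) \<Rightarrow>
   ('m \<Rightarrow> 'e \<Rightarrow> 'e) \<Rightarrow> bool" where
  "flow_preserves_endo A V J \<longleftrightarrow>
     (\<forall>p. \<exists>\<epsilon> W \<theta>. p \<in> W \<and> local_flow A V \<epsilon> W \<theta> \<and>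
        (\<forall>t\<in>{-\<epsilon><..<\<epsilon>}. \<forall>x\<in>W. \<forall>u.
           differential A A (\<theta> t) x (J x u) = J (\<theta> t x) (differential A A (\<theta> t) x u)))"

definition killing_field ::
  "('m::topological_space, 'e::euclidean_space) chart set \<Rightarrow> ('m \<Rightarrow> 'e \<Rightarrow> 'e \<Rightarrow> real) \<Rightarrow>
   ('m \<Rightarrow> 'e) \<Rightarrow> bool" where
  "killing_field A g V \<longleftrightarrow> vector_field A V \<and> flow_preserves_metric A V g"

definition triholomorphic ::
  "('m::topological_space, 'e::euclidean_space) chart set \<Rightarrow> ('m \<Rightarrow> 'e \<Rightarrow> 'e) \<Rightarrow>
   ('m \<Rightarrow> 'e \<Rightarrow> 'e) \<Rightarrow> ('m \<Rightarrow> 'e \<Rightarrow> 'e) \<Rightarrow> ('m \<Rightarrow> 'e) \<Rightarrow> bool" where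
  "triholomorphic A J\<^sub>1 J\<^sub>2 J\<^sub>3 V \<longleftrightarrow>
     flow_preserves_endo A V J\<^sub>1 \<and> flow_preserves_endo A V J\<^sub>2 \<and> flow_preserves_endo A V J\<^sub>3"


section \<open>Betti numbers\<close>

text \<open>
  The rank of an abelian group is the supremum of the sizes of its \<open>\<int>\<close>-linearly independent finite
  subsets. It is an extended natural number, so that infinite rank does not collapse to \<open>0\<close>.
\<close>

definition int_independent :: "('a, 'b) monoid_scheme \<Rightarrow> 'a set \<Rightarrow> bool" where
  "int_independent G S \<longleftrightarrow>
     finite S \<and> S \<subseteq> carrier G \<and>
     (\<forall>n :: 'a \<Rightarrow> int. finprod G (\<lambda>s. s [^]\<^bsub>G\<^esub> n s) S = \<one>\<^bsub>G\<^esub> \<longrightarrow> (\<forall>s\<in>S. n s = 0))"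

definition abelian_rank :: "('a, 'b) monoid_scheme \<Rightarrow> enat" where
  "abelian_rank G = (SUP S\<in>{S. int_independent G S}. enat (card S))"

definition betti_number :: "nat \<Rightarrow> 'a topology \<Rightarrow> enat" where
  "betti_number p X = abelian_rank (homology_group (int p) X)"

end

theory Submission
  imports Defs
begin

text \<open>
  In a chart put \<open>S u = \<nabla>\<^sub>u V\<close>. Since \<open>V\<close> is Killing, \<open>S\<close> is skew; since \<open>V\<close> preserves \<open>J\<close> and
  \<open>\<nabla>J = 0\<close>, \<open>S\<close> commutes with \<open>J\<close>. Hence the form \<open>\<omega>(V, \<cdot>) = g(J V, \<cdot>)\<close> has the symmetric covariant derivative
  \<open>g(J S \<cdot>, \<cdot>)\<close>, so it is closed and has local primitives. These give every singular 1-simplex a period, which is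
  additive and vanishes on boundaries of 2-simplices; if the first Betti number is zero, every cycle is
  torsion, so its period vanishes and the local primitives glue to a Hamiltonian.

  The gradients of the three Hamiltonians are \<open>J\<^sub>1 V, J\<^sub>2 V, J\<^sub>3 V\<close>, which are orthogonal and of the same length,
  and their Hessians are \<open>g(J\<^sub>i S \<cdot>, \<cdot>)\<close>. Here \<open>tr (J\<^sub>1 S) = 0\<close>, because conjugation by \<open>J\<^sub>2\<close> changes the sign
  of \<open>J\<^sub>1 S\<close>. By the chain rule \<open>\<Delta>(h \<circ> f) = |V|\<^sup>2 (\<Delta>h) \<circ> f\<close>.
\<close>

section \<open>Smooth functions\<close>

text \<open>Tangent vectors are coordinate vectors in one chosen chart per point, and this choice
  need not vary continuously, so a tensor field cannot be differentiated as a plain function of the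
  point. All differential geometry is therefore done for coordinate expressions on an open set of
  the model space; \<open>coord_vec\<close> carries the results to the manifold.

  The flows given for \<open>g\<close> and for each \<open>J\<close> are unrelated to each other.
  Only their derivatives at time zero are used: each invariance condition becomes a pointwise
  equation for the same field \<open>V\<close>, and these equations can be combined.

  Singular simplices are merely continuous, so the closed form cannot be integrated over them. Its
  integral is replaced by the increment of a function that locally equals a potential along the
  simplex; on a square such a function is glued together over connected overlaps. This part is
  purely topological.

  The trace of a Hessian is taken of the endomorphism dual to it, so the standard basis of the model
  space serves and no orthonormal frame appears.\<close>

lemma differentiable_imp_has_frechet:
  "f differentiable (at x) \<Longrightarrow> (f has_derivative frechet_derivative f (at x)) (at x)"
  by (simp add: frechet_derivative_works)

lemma Ck_on_Suc_derivative:
  "Ck_on (Suc k) f S \<Longrightarrow> x \<in> S \<Longrightarrow> (f has_derivative frechet_derivative f (at x)) (at x)"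
  by (simp add: differentiable_imp_has_frechet)

lemma Ck_on_Suc_frechet: "Ck_on (Suc k) f S \<Longrightarrow> Ck_on k (\<lambda>x. frechet_derivative f (at x) v) S"
  by simp

lemma frechet_derivative_eqI:
  "(f has_derivative f') (at x) \<Longrightarrow> frechet_derivative f (at x) = f'"
  by (metis frechet_derivative_at)

lemma frechet_derivative_cong_open:
  assumes "open S" "x \<in> S" "\<And>y. y \<in> S \<Longrightarrow> f y = g y"
  shows "frechet_derivative f (at x) = frechet_derivative g (at x)"
proof -
  have "(f has_derivative D) (at x) \<longleftrightarrow> (g has_derivative D) (at x)" for D
    using assms by (metis has_derivative_transform_within_open)
  then show ?thesis unfolding frechet_derivative_def by simp
qed

lemma Ck_on_cong:
  "open S \<Longrightarrow> (\<And>x. x \<in> S \<Longrightarrow> f x = g x) \<Longrightarrow> Ck_on k f S \<longleftrightarrow> Ck_on k g S"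
proof (induction k arbitrary: f g)
  case 0
  then show ?case by (simp cong: continuous_on_cong)
next
  case (Suc k)
  have "f differentiable (at x) \<longleftrightarrow> g differentiable (at x)" if "x \<in> S" for x
    using Suc.prems that unfolding differentiable_def by (metis has_derivative_transform_within_open)
  moreover have "Ck_on k (\<lambda>x. frechet_derivative f (at x) v) S \<longleftrightarrow>
      Ck_on k (\<lambda>x. frechet_derivative g (at x) v) S" for v
    using Suc.IH[OF Suc.prems(1)] frechet_derivative_cong_open[OF Suc.prems(1)] Suc.prems(2)
    by (smt (verit, ccfv_SIG))
  ultimately show ?case by simp
qed

lemma Ck_on_subset: "Ck_on k f S \<Longrightarrow> T \<subseteq> S \<Longrightarrow> Ck_on k f T"
  by (induction k arbitrary: f) (auto intro: continuous_on_subset)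

text \<open>\<open>frechet_derivative\<close> is a choice operator; by uniqueness of derivatives any
  explicit derivative \<open>f'\<close> may take its place on an open set, which is what the
  inductions on \<open>k\<close> below rest on.\<close>

lemma Ck_on_SucI:
  assumes "open S" "\<And>x. x \<in> S \<Longrightarrow> (f has_derivative f' x) (at x)"
    "\<And>v. Ck_on k (\<lambda>x. f' x v) S"
  shows "Ck_on (Suc k) f S"
proof -
  have "Ck_on k (\<lambda>x. frechet_derivative f (at x) v) S" for v
    using Ck_on_cong[OF assms(1), of "\<lambda>x. frechet_derivative f (at x) v" "\<lambda>x. f' x v" k]
      frechet_derivative_eqI[OF assms(2)] assms(3) by simp
  then show ?thesis using assms(2) by (auto simp: differentiable_def)
qed

lemma Ck_on_SucD: "Ck_on (Suc k) f S \<Longrightarrow> Ck_on k f S"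
proof (induction k arbitrary: f)
  case 0
  then show ?case
    by (auto intro!: continuous_at_imp_continuous_on differentiable_imp_continuous_within)
next
  case (Suc k)
  then show ?case unfolding Ck_on.simps(2)[of "Suc k"] Ck_on.simps(2)[of k f] by blast
qed

declare Ck_on.simps(2) [simp del]

lemma Ck_on_const: "open S \<Longrightarrow> Ck_on k (\<lambda>x. c) S"
  by (induction k arbitrary: c) (auto intro!: Ck_on_SucI[OF _ has_derivative_const])

lemma Ck_on_linear_compose:
  "open S \<Longrightarrow> bounded_linear L \<Longrightarrow> Ck_on k f S \<Longrightarrow> Ck_on k (\<lambda>x. L (f x)) S"
proof (induction k arbitrary: f)
  case 0
  then show ?case by (auto intro: bounded_linear.continuous_on)
next
  case (Suc k)
  show ?case
    by (rule Ck_on_SucI[where f' = "\<lambda>x v. L (frechet_derivative f (at x) v)"])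
      (use Suc in \<open>auto intro: bounded_linear.has_derivative Ck_on_Suc_derivative Ck_on_Suc_frechet\<close>)
qed

lemma Ck_on_add:
  "open S \<Longrightarrow> Ck_on k f S \<Longrightarrow> Ck_on k g S \<Longrightarrow> Ck_on k (\<lambda>x. f x + g x) S"
proof (induction k arbitrary: f g)
  case 0
  then show ?case by (auto intro: continuous_intros)
next
  case (Suc k)
  show ?case
    by (rule Ck_on_SucI[where f' = "\<lambda>x v. frechet_derivative f (at x) v + frechet_derivative g (at x) v"])
      (use Suc in \<open>auto intro: has_derivative_add Ck_on_Suc_derivative Ck_on_Suc_frechet\<close>)
qed

lemma Ck_on_sum:
  "open S \<Longrightarrow> (\<And>i. i \<in> I \<Longrightarrow> Ck_on k (f i) S) \<Longrightarrow> Ck_on k (\<lambda>x. \<Sum>i\<in>I. f i x) S"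
  by (induction I rule: infinite_finite_induct) (auto intro: Ck_on_const Ck_on_add)

lemma Ck_on_bilinear:
  assumes B: "bounded_bilinear B"
  shows "open S \<Longrightarrow> Ck_on k f S \<Longrightarrow> Ck_on k g S \<Longrightarrow> Ck_on k (\<lambda>x. B (f x) (g x)) S"
proof (induction k arbitrary: f g)
  case 0
  then show ?case by (auto intro: bounded_bilinear.continuous_on[OF B])
next
  case (Suc k)
  show ?case
    by (rule Ck_on_SucI[where f' = "\<lambda>x v. B (f x) (frechet_derivative g (at x) v)
          + B (frechet_derivative f (at x) v) (g x)"])
      (use Suc in \<open>auto intro!: bounded_bilinear.FDERIV[OF B] Ck_on_add Suc.IH
          intro: Ck_on_Suc_derivative Ck_on_Suc_frechet Ck_on_SucD\<close>)
qed

lemma linear_eq_sum_Basis: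
  fixes L :: "'a::euclidean_space \<Rightarrow> 'b::real_vector"
  assumes "linear L" shows "L v = (\<Sum>b\<in>Basis. (v \<bullet> b) *\<^sub>R L b)"
proof -
  have "L v = L (\<Sum>b\<in>Basis. (v \<bullet> b) *\<^sub>R b)" by (simp add: euclidean_representation)
  also have "\<dots> = (\<Sum>b\<in>Basis. (v \<bullet> b) *\<^sub>R L b)" by (simp add: linear_sum[OF assms] linear_cmul[OF assms])
  finally show ?thesis .
qed

text \<open>In the chain rule the direction \<open>frechet_derivative g (at x) v\<close> moves with
  \<open>x\<close>, whereas \<open>Ck_on\<close> speaks of fixed directions only. Expanded in the
  basis, the derivative is a sum of products of a component of the derivative of \<open>g\<close>
  and a composite covered by the induction hypothesis.\<close>

lemma Ck_on_compose:
  fixes g :: "'a::euclidean_space \<Rightarrow> 'b::euclidean_space" and f :: "'b \<Rightarrow> 'c::real_normed_vector"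
  shows "open S \<Longrightarrow> Ck_on k f T \<Longrightarrow> Ck_on k g S \<Longrightarrow> g ` S \<subseteq> T \<Longrightarrow> Ck_on k (\<lambda>x. f (g x)) S"
proof (induction k arbitrary: f)
  case 0
  then show ?case by (auto intro: continuous_on_compose2)
next
  case (Suc k)
  let ?f' = "\<lambda>x v. \<Sum>b\<in>Basis. (frechet_derivative g (at x) v \<bullet> b) *\<^sub>R frechet_derivative f (at (g x)) b"
  show ?case
  proof (rule Ck_on_SucI[where f' = ?f'])
    fix x assume x: "x \<in> S"
    have f: "(f has_derivative frechet_derivative f (at (g x))) (at (g x))"
      using Suc.prems x by (auto intro: Ck_on_Suc_derivative)
    have g: "(g has_derivative frechet_derivative g (at x)) (at x)"
      using Suc.prems x by (auto intro: Ck_on_Suc_derivative)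
    show "((\<lambda>x. f (g x)) has_derivative ?f' x) (at x)"
      using has_derivative_compose[OF g f]
      by (simp add: linear_eq_sum_Basis[OF has_derivative_linear[OF f], symmetric])
  next
    fix v
    show "Ck_on k (\<lambda>x. ?f' x v) S"
    proof (intro Ck_on_sum Ck_on_bilinear[OF bounded_bilinear_scaleR])
      fix b :: 'b
      show "Ck_on k (\<lambda>x. frechet_derivative f (at (g x)) b) S"
        using Suc.prems by (intro Suc.IH) (auto intro: Ck_on_Suc_frechet Ck_on_SucD)
      show "Ck_on k (\<lambda>x. frechet_derivative g (at x) v \<bullet> b) S"
        using Suc.prems by (intro Ck_on_linear_compose[OF _ bounded_linear_inner_left] Ck_on_Suc_frechet)
    qed (use Suc.prems in auto)
  qed (use Suc.prems in auto)
qed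

section \<open>Infinitely differentiable functions on open sets\<close>

lemma smooth_on_Suc:
  "smooth_on S f \<longleftrightarrow> (\<forall>x\<in>S. f differentiable (at x)) \<and>
     (\<forall>v. smooth_on S (\<lambda>x. frechet_derivative f (at x) v))" (is "?L \<longleftrightarrow> ?R")
proof
  assume ?L
  then have "Ck_on (Suc k) f S" for k by (simp add: smooth_on_def)
  then show ?R by (simp add: Ck_on.simps(2)) (simp add: smooth_on_def)
next
  assume R: ?R
  have "Ck_on (Suc k) f S" for k using R by (simp add: smooth_on_def Ck_on.simps(2))
  then show ?L unfolding smooth_on_def by (blast intro: Ck_on_SucD)
qed

lemma smooth_on_has_derivative:
  "smooth_on S f \<Longrightarrow> x \<in> S \<Longrightarrow> (f has_derivative frechet_derivative f (at x)) (at x)"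
  by (auto simp: smooth_on_Suc[of S f] intro: differentiable_imp_has_frechet)

lemma smooth_on_frechet: "smooth_on S f \<Longrightarrow> smooth_on S (\<lambda>x. frechet_derivative f (at x) v)"
  by (auto simp: smooth_on_Suc[of S f])

lemma smooth_on_continuous_on: "smooth_on S f \<Longrightarrow> continuous_on S f"
  unfolding smooth_on_def using Ck_on.simps(1) by blast

lemma smooth_on_cong:
  "open S \<Longrightarrow> (\<And>x. x \<in> S \<Longrightarrow> f x = g x) \<Longrightarrow> smooth_on S f \<longleftrightarrow> smooth_on S g"
  unfolding smooth_on_def using Ck_on_cong by blast

lemma smooth_on_subset: "smooth_on S f \<Longrightarrow> T \<subseteq> S \<Longrightarrow> smooth_on T f"
  unfolding smooth_on_def using Ck_on_subset by blast

lemma smooth_on_const: "open S \<Longrightarrow> smooth_on S (\<lambda>x. c)"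
  unfolding smooth_on_def using Ck_on_const by blast

lemma smooth_on_sum:
  "open S \<Longrightarrow> (\<And>i. i \<in> I \<Longrightarrow> smooth_on S (f i)) \<Longrightarrow> smooth_on S (\<lambda>x. \<Sum>i\<in>I. f i x)"
  by (simp add: smooth_on_def Ck_on_sum)

lemma smooth_on_linear_compose:
  "open S \<Longrightarrow> bounded_linear L \<Longrightarrow> smooth_on S f \<Longrightarrow> smooth_on S (\<lambda>x. L (f x))"
  by (simp add: smooth_on_def Ck_on_linear_compose)

lemma smooth_on_bilinear:
  "bounded_bilinear B \<Longrightarrow> open S \<Longrightarrow> smooth_on S f \<Longrightarrow> smooth_on S g \<Longrightarrow> smooth_on S (\<lambda>x. B (f x) (g x))"
  by (simp add: smooth_on_def Ck_on_bilinear)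

lemma smooth_on_compose:
  fixes g :: "'a::euclidean_space \<Rightarrow> 'b::euclidean_space"
  shows "open S \<Longrightarrow> smooth_on T f \<Longrightarrow> smooth_on S g \<Longrightarrow> g ` S \<subseteq> T \<Longrightarrow> smooth_on S (\<lambda>x. f (g x))"
  unfolding smooth_on_def by (intro allI, rule Ck_on_compose) auto

lemma smooth_onI:
  assumes "open S" "\<And>x. x \<in> S \<Longrightarrow> (f has_derivative f' x) (at x)"
    "\<And>v. smooth_on S (\<lambda>x. f' x v)"
  shows "smooth_on S f"
  unfolding smooth_on_def
  by (intro allI Ck_on_SucD[OF Ck_on_SucI[OF assms(1,2)]]) (use assms(3) in \<open>auto simp: smooth_on_def\<close>)

lemma smooth_on_componentwise:
  fixes f :: "'a::euclidean_space \<Rightarrow> 'b::euclidean_space"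
  assumes "open S" "\<And>b. b \<in> Basis \<Longrightarrow> smooth_on S (\<lambda>x. f x \<bullet> b)"
  shows "smooth_on S f"
proof -
  have "smooth_on S (\<lambda>x. \<Sum>b\<in>Basis. (f x \<bullet> b) *\<^sub>R b)"
    using assms smooth_on_bilinear[OF bounded_bilinear_scaleR assms(1)]
    by (intro smooth_on_sum) (auto intro: smooth_on_const)
  then show ?thesis by (simp add: euclidean_representation)
qed

text \<open>Both mixed derivatives are limits of the same second difference quotient: the mean value
  theorem is applied to it once in each order.\<close>

lemma second_difference_mvt:
  fixes f :: "'a::euclidean_space \<Rightarrow> real"
  assumes S: "smooth_on (ball x r) f" and h: "0 < h" "h * (norm u + norm v) < r"
  shows "\<exists>s t. 0 < s \<and> s < h \<and> 0 < t \<and> t < h \<and>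
    f (x + h *\<^sub>R u + h *\<^sub>R v) - f (x + h *\<^sub>R u) - f (x + h *\<^sub>R v) + f x =
    h * h * frechet_derivative (\<lambda>y. frechet_derivative f (at y) u) (at (x + s *\<^sub>R u + t *\<^sub>R v)) v"
proof -
  have inb: "x + s *\<^sub>R u + t *\<^sub>R v \<in> ball x r" if "0 \<le> s" "s \<le> h" "0 \<le> t" "t \<le> h" for s t
  proof -
    have "norm (s *\<^sub>R u + t *\<^sub>R v) \<le> h * norm u + h * norm v"
      using that by (intro order.trans[OF norm_triangle_ineq] add_mono) (auto intro: mult_right_mono)
    moreover have "dist x (x + (s *\<^sub>R u + t *\<^sub>R v)) = norm (s *\<^sub>R u + t *\<^sub>R v)"
      by (metis add_diff_cancel_left' dist_commute dist_norm)
    ultimately have "dist x (x + (s *\<^sub>R u + t *\<^sub>R v)) < r" using h by (simp add: distrib_left)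
    then show ?thesis by (simp add: add.assoc)
  qed
  let ?fu = "\<lambda>y. frechet_derivative f (at y) u"
  \<comment> \<open>\<open>a h - a 0\<close> is the second difference, so the mean value theorem in
    \<open>s\<close> and then in \<open>t\<close> produces the mixed derivative.\<close>
  define a where "a = (\<lambda>s. f (x + s *\<^sub>R u + h *\<^sub>R v) - f (x + s *\<^sub>R u))"
  have da: "(a has_real_derivative ?fu (x + s *\<^sub>R u + h *\<^sub>R v) - ?fu (x + s *\<^sub>R u)) (at s)"
    if "0 \<le> s" "s \<le> h" for s
  proof -
    have 1: "(f has_derivative frechet_derivative f (at (x + s *\<^sub>R u + t *\<^sub>R v))) (at (x + s *\<^sub>R u + t *\<^sub>R v))"
      if "0 \<le> t" "t \<le> h" for t
      using smooth_on_has_derivative[OF S inb] \<open>0 \<le> s\<close> \<open>s \<le> h\<close> that by blast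
    have 2: "((\<lambda>s. f (x + s *\<^sub>R u + t *\<^sub>R v)) has_real_derivative ?fu (x + s *\<^sub>R u + t *\<^sub>R v)) (at s)"
      if "0 \<le> t" "t \<le> h" for t
    proof -
      have "((\<lambda>s. x + s *\<^sub>R u + t *\<^sub>R v) has_derivative (\<lambda>s. s *\<^sub>R u)) (at s)"
        by (auto intro!: derivative_eq_intros)
      from has_derivative_compose[OF this 1[OF that]] show ?thesis
        unfolding has_field_derivative_def linear_cmul[OF has_derivative_linear[OF 1[OF that]]]
        by (simp add: mult_commute_abs)
    qed
    show ?thesis unfolding a_def using DERIV_diff[OF 2[of h] 2[of 0]] h by simp
  qed
  obtain s where s: "0 < s" "s < h" and as: "a h - a 0 = h * (?fu (x + s *\<^sub>R u + h *\<^sub>R v) - ?fu (x + s *\<^sub>R u))"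
    using MVT2[OF h(1) da] by auto
  have db: "((\<lambda>t. ?fu (x + s *\<^sub>R u + t *\<^sub>R v)) has_real_derivative
      frechet_derivative ?fu (at (x + s *\<^sub>R u + t *\<^sub>R v)) v) (at t)" if "0 \<le> t" "t \<le> h" for t
  proof -
    have 1: "(?fu has_derivative frechet_derivative ?fu (at (x + s *\<^sub>R u + t *\<^sub>R v))) (at (x + s *\<^sub>R u + t *\<^sub>R v))"
      using smooth_on_has_derivative[OF smooth_on_frechet[OF S] inb] s that by auto
    have "((\<lambda>t. x + s *\<^sub>R u + t *\<^sub>R v) has_derivative (\<lambda>t. t *\<^sub>R v)) (at t)"
      by (auto intro!: derivative_eq_intros)
    from has_derivative_compose[OF this 1] show ?thesis
      unfolding has_field_derivative_def linear_cmul[OF has_derivative_linear[OF 1]]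
      by (simp add: mult_commute_abs)
  qed
  obtain t where t: "0 < t" "t < h" and "?fu (x + s *\<^sub>R u + h *\<^sub>R v) - ?fu (x + s *\<^sub>R u + 0 *\<^sub>R v) =
     h * frechet_derivative ?fu (at (x + s *\<^sub>R u + t *\<^sub>R v)) v"
    using MVT2[OF h(1) db] by auto
  with as s show ?thesis by (intro exI[of _ s] exI[of _ t]) (auto simp: a_def)
qed

lemma second_derivative_symmetric_real:
  fixes f :: "'a::euclidean_space \<Rightarrow> real"
  assumes "open S" "smooth_on S f" "x \<in> S"
  shows "frechet_derivative (\<lambda>y. frechet_derivative f (at y) u) (at x) v =
         frechet_derivative (\<lambda>y. frechet_derivative f (at y) v) (at x) u"
proof -
  obtain r where r: "r > 0" "ball x r \<subseteq> S" using assms openE by blast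
  have S: "smooth_on (ball x r) f" using assms(2) r(2) smooth_on_subset by blast
  define D where "D u v z = frechet_derivative (\<lambda>y. frechet_derivative f (at y) u) (at z) v" for u v z
  have cont: "isCont (D u v) x" for u v
    using smooth_on_continuous_on[OF smooth_on_frechet[OF smooth_on_frechet[OF S]]] r(1)
    by (auto simp: D_def[abs_def] continuous_on_eq_continuous_at)
  have close: "\<exists>d>0. \<forall>h. 0 < h \<and> h < d \<longrightarrow>
      \<bar>(f (x + h *\<^sub>R u + h *\<^sub>R v) - f (x + h *\<^sub>R u) - f (x + h *\<^sub>R v) + f x) / (h * h) - D u v x\<bar> < e"
    if e: "e > 0" for e u v
  proof -
    obtain d where d: "d > 0" "\<And>z. dist z x < d \<Longrightarrow> dist (D u v z) (D u v x) < e"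
      using cont e unfolding continuous_at_eps_delta by blast
    \<comment> \<open>The summand 1 keeps \<open>m\<close> positive when \<open>u\<close> and
      \<open>v\<close> both vanish; \<open>h * m\<close> bounds the distance of all points in
      question from \<open>x\<close>.\<close>
    define m where "m = norm u + norm v + 1"
    have m: "m > 0" by (simp add: m_def add_nonneg_pos)
    show ?thesis
    proof (intro exI[of _ "min (r / m) (d / m)"] conjI allI impI)
      fix h assume h: "0 < h \<and> h < min (r / m) (d / m)"
      then have hm: "h * m < r" "h * m < d" using m by (auto simp: field_simps)
      then have "h * (norm u + norm v) < r" using h by (simp add: m_def algebra_simps)
      then obtain s t where st: "0 < s" "s < h" "0 < t" "t < h" and eq:
         "f (x + h *\<^sub>R u + h *\<^sub>R v) - f (x + h *\<^sub>R u) - f (x + h *\<^sub>R v) + f x = h * h * D u v (x + s *\<^sub>R u + t *\<^sub>R v)"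
        using second_difference_mvt[OF S] h unfolding D_def by blast
      have "norm (s *\<^sub>R u + t *\<^sub>R v) \<le> h * norm u + h * norm v"
        using st by (intro order.trans[OF norm_triangle_ineq] add_mono) (auto intro: mult_right_mono)
      also have "\<dots> < d" using hm h by (simp add: m_def algebra_simps)
      finally have "dist (D u v (x + s *\<^sub>R u + t *\<^sub>R v)) (D u v x) < e"
        by (intro d) (simp add: dist_norm)
      then show "\<bar>(f (x + h *\<^sub>R u + h *\<^sub>R v) - f (x + h *\<^sub>R u) - f (x + h *\<^sub>R v) + f x) / (h * h) - D u v x\<bar> < e"
        using h by (simp add: eq dist_real_def)
    qed (use r d m in auto)
  qed
  have "\<bar>D u v x - D v u x\<bar> < e" if "e > 0" for e
  proof -
    have e2: "e / 2 > 0" using that by simp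
    obtain d1 where d1: "d1 > 0" "\<And>h. 0 < h \<and> h < d1 \<Longrightarrow>
      \<bar>(f (x + h *\<^sub>R u + h *\<^sub>R v) - f (x + h *\<^sub>R u) - f (x + h *\<^sub>R v) + f x) / (h * h) - D u v x\<bar> < e/2"
      using close[OF e2, of u v] by blast
    obtain d2 where d2: "d2 > 0" "\<And>h. 0 < h \<and> h < d2 \<Longrightarrow>
      \<bar>(f (x + h *\<^sub>R v + h *\<^sub>R u) - f (x + h *\<^sub>R v) - f (x + h *\<^sub>R u) + f x) / (h * h) - D v u x\<bar> < e/2"
      using close[OF e2, of v u] by blast
    define h where "h = min d1 d2 / 2"
    \<comment> \<open>Exchanging \<open>u\<close> and \<open>v\<close> does not change the second
      difference, so for this \<open>h\<close> one number is within \<open>e/2\<close> of both mixed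
      derivatives.\<close>
    have "0 < h \<and> h < d1" "0 < h \<and> h < d2" using d1(1) d2(1) by (auto simp: h_def)
    then have "\<bar>(f (x + h *\<^sub>R u + h *\<^sub>R v) - f (x + h *\<^sub>R u) - f (x + h *\<^sub>R v) + f x) / (h * h) - D u v x\<bar> < e/2"
      "\<bar>(f (x + h *\<^sub>R u + h *\<^sub>R v) - f (x + h *\<^sub>R u) - f (x + h *\<^sub>R v) + f x) / (h * h) - D v u x\<bar> < e/2"
      using d1(2)[of h] d2(2)[of h] by (simp_all add: algebra_simps)
    then show ?thesis by linarith
  qed
  then have "D u v x = D v u x" by (metis abs_le_zero_iff eq_iff_diff_eq_0 field_le_epsilon less_eq_real_def add_0)
  then show ?thesis by (simp add: D_def)
qed

lemma second_derivative_symmetric: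
  fixes f :: "'a::euclidean_space \<Rightarrow> 'b::euclidean_space"
  assumes "open S" "smooth_on S f" "x \<in> S"
  shows "frechet_derivative (\<lambda>y. frechet_derivative f (at y) u) (at x) v =
         frechet_derivative (\<lambda>y. frechet_derivative f (at y) v) (at x) u"
proof (rule euclidean_eqI)
  fix b :: 'b
  have fb: "smooth_on S (\<lambda>y. f y \<bullet> b)"
    using smooth_on_linear_compose[OF assms(1) bounded_linear_inner_left assms(2)] .
  have d1: "frechet_derivative (\<lambda>y. g y \<bullet> b) (at y) w = frechet_derivative g (at y) w \<bullet> b"
    if "smooth_on S g" "y \<in> S" for g :: "'a \<Rightarrow> 'b" and y w
    using frechet_derivative_eqI[OF bounded_linear.has_derivative[OF bounded_linear_inner_left
          smooth_on_has_derivative[OF that]]] by simp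
  have "frechet_derivative (\<lambda>y. frechet_derivative f (at y) u) (at x) v \<bullet> b =
      frechet_derivative (\<lambda>y. frechet_derivative (\<lambda>y. f y \<bullet> b) (at y) u) (at x) v" for u v
  proof -
    have "frechet_derivative (\<lambda>y. frechet_derivative (\<lambda>y. f y \<bullet> b) (at y) u) (at x)
        = frechet_derivative (\<lambda>y. frechet_derivative f (at y) u \<bullet> b) (at x)"
      by (rule frechet_derivative_cong_open[OF assms(1,3)]) (rule d1[OF assms(2)])
    then show ?thesis by (simp only: d1[OF smooth_on_frechet[OF assms(2)] assms(3)])
  qed
  then show "frechet_derivative (\<lambda>y. frechet_derivative f (at y) u) (at x) v \<bullet> b =
         frechet_derivative (\<lambda>y. frechet_derivative f (at y) v) (at x) u \<bullet> b"
    by (simp only: second_derivative_symmetric_real[OF assms(1) fb assms(3), of u v])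
qed

section \<open>Derivatives of parametrised linear maps, flows and the Poincare lemma\<close>

text \<open>Product rule when only the maps \<open>L z b\<close> with constant \<open>b\<close> are
  known to be differentiable, as is the case for tensors in coordinates. Linearity in the argument
  reduces it to the basis.\<close>

lemma slot_has_derivative:
  fixes L :: "'z::real_normed_vector \<Rightarrow> 'e::euclidean_space \<Rightarrow> 'f::real_normed_vector"
  assumes S: "open S" "z \<in> S" and lin: "\<And>z. z \<in> S \<Longrightarrow> linear (L z)"
    and L: "\<And>b. ((\<lambda>z. L z b) has_derivative L' b) (at z)"
    and U: "(U has_derivative U') (at z)"
  shows "((\<lambda>z. L z (U z)) has_derivative (\<lambda>h. L' (U z) h + L z (U' h))) (at z)"
proof -
  have expand: "((\<lambda>z. L z (W z)) has_derivative
      (\<lambda>h. \<Sum>b\<in>Basis. (W z \<bullet> b) *\<^sub>R L' b h + (W' h \<bullet> b) *\<^sub>R L z b)) (at z)"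
    if W: "(W has_derivative W') (at z)" for W W'
  proof (rule has_derivative_transform_within_open[OF _ S])
    show "((\<lambda>z. \<Sum>b\<in>Basis. (W z \<bullet> b) *\<^sub>R L z b) has_derivative
      (\<lambda>h. \<Sum>b\<in>Basis. (W z \<bullet> b) *\<^sub>R L' b h + (W' h \<bullet> b) *\<^sub>R L z b)) (at z)"
      by (rule has_derivative_sum, rule has_derivative_scaleR[OF _ L],
          rule bounded_linear.has_derivative[OF bounded_linear_inner_left W])
    show "(\<Sum>b\<in>Basis. (W z \<bullet> b) *\<^sub>R L z b) = L z (W z)" if "z \<in> S" for z
      by (rule linear_eq_sum_Basis[OF lin[OF that], symmetric])
  qed
  \<comment> \<open>Applied to a constant argument, the expansion shows that \<open>L' (U z)\<close>
    is the corresponding combination of the \<open>L' b\<close>; uniqueness of the derivative stands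
    in for linearity of \<open>L'\<close>.\<close>
  have "(\<lambda>h. \<Sum>b\<in>Basis. (U z \<bullet> b) *\<^sub>R L' b h + ((0::'e) \<bullet> b) *\<^sub>R L z b) = L' (U z)"
    by (rule has_derivative_unique[OF expand[OF has_derivative_const] L])
  then have "(\<Sum>b\<in>Basis. (U z \<bullet> b) *\<^sub>R L' b h) = L' (U z) h" for h
    by (auto dest: fun_cong[of _ _ h])
  moreover have "L z (U' h) = (\<Sum>b\<in>Basis. (U' h \<bullet> b) *\<^sub>R L z b)" for h
    by (rule linear_eq_sum_Basis[OF lin[OF S(2)]])
  ultimately have "(\<lambda>h. L' (U z) h + L z (U' h)) =
      (\<lambda>h. \<Sum>b\<in>Basis. (U z \<bullet> b) *\<^sub>R L' b h + (U' h \<bullet> b) *\<^sub>R L z b)"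
    by (simp only: sum.distrib)
  then show ?thesis using expand[OF U] by simp
qed

text \<open>Symmetry of the mixed derivatives in time and space turns the time derivative of the
  spatial derivative into the spatial derivative of the velocity \<open>v\<close>. This is how Lie
  derivatives arise from flows below.\<close>

lemma flow_derivative:
  fixes \<Theta> :: "real \<times> 'e::euclidean_space \<Rightarrow> 'e"
  assumes N: "open N" "smooth_on N \<Theta>" "(0, y0) \<in> N"
    and init: "\<And>y. (0, y) \<in> N \<Longrightarrow> \<Theta> (0, y) = y"
    and velocity: "\<And>y. (0, y) \<in> N \<Longrightarrow> frechet_derivative \<Theta> (at (0, y)) (1, 0) = v y"
    and v: "(v has_derivative v') (at y0)"
  shows "frechet_derivative \<Theta> (at (0, y0)) (0, u) = u"
    and "((\<lambda>t. \<Theta> (t, y0)) has_derivative (\<lambda>t. t *\<^sub>R v y0)) (at 0)"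
    and "((\<lambda>t. frechet_derivative \<Theta> (at (t, y0)) (0, u)) has_derivative (\<lambda>t. t *\<^sub>R v' u)) (at 0)"
proof -
  define N0 where "N0 = Pair 0 -` N"
  have N0: "open N0" "y0 \<in> N0"
    unfolding N0_def using N(1,3) by (auto intro!: open_vimage continuous_intros)
  have space: "((\<lambda>y. Q (0, y)) has_derivative (\<lambda>h. frechet_derivative Q (at (0, y0)) (0, h))) (at y0)"
    if "smooth_on N Q" for Q :: "real \<times> 'e \<Rightarrow> 'e"
    by (rule has_derivative_compose[of "Pair 0" "Pair 0", OF _ smooth_on_has_derivative[OF that N(3)]])
      (auto intro!: derivative_eq_intros)
  have time: "((\<lambda>t. Q (t, y0)) has_derivative (\<lambda>t. t *\<^sub>R frechet_derivative Q (at (0, y0)) (1, 0))) (at 0)"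
    if "smooth_on N Q" for Q :: "real \<times> 'e \<Rightarrow> 'e"
  proof -
    note Q = smooth_on_has_derivative[OF that N(3)]
    have "((\<lambda>t. Q (t, y0)) has_derivative (\<lambda>t. frechet_derivative Q (at (0, y0)) (t, 0))) (at 0)"
      by (rule has_derivative_compose[of "\<lambda>t. (t, y0)" "\<lambda>t. (t, 0)", OF _ Q])
        (auto intro!: derivative_eq_intros)
    moreover have "(\<lambda>t. frechet_derivative Q (at (0, y0)) (t, 0)) =
        (\<lambda>t. t *\<^sub>R frechet_derivative Q (at (0, y0)) (1, 0))"
    proof
      fix t
      show "frechet_derivative Q (at (0, y0)) (t, 0) = t *\<^sub>R frechet_derivative Q (at (0, y0)) (1, 0)"
        using linear_cmul[OF has_derivative_linear[OF Q], of t "(1, 0)"] by simp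
    qed
    ultimately show ?thesis by (simp only:)
  qed
  have "((\<lambda>y. \<Theta> (0, y)) has_derivative (\<lambda>h. h)) (at y0)"
    by (rule has_derivative_transform_within_open[OF has_derivative_ident N0]) (simp add: N0_def init)
  from has_derivative_unique[OF space[OF N(2)] this]
  show "frechet_derivative \<Theta> (at (0, y0)) (0, u) = u" by (rule fun_cong)
  show "((\<lambda>t. \<Theta> (t, y0)) has_derivative (\<lambda>t. t *\<^sub>R v y0)) (at 0)"
    using time[OF N(2)] velocity[OF N(3)] by simp
  let ?P = "\<lambda>z. frechet_derivative \<Theta> (at z) (0, u)" let ?Q = "\<lambda>z. frechet_derivative \<Theta> (at z) (1, 0)"
  have "((\<lambda>y. ?Q (0, y)) has_derivative v') (at y0)"
    by (rule has_derivative_transform_within_open[OF v N0]) (simp add: N0_def velocity)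
  from has_derivative_unique[OF space[OF smooth_on_frechet[OF N(2)]] this]
  have "frechet_derivative ?Q (at (0, y0)) (0, u) = v' u" by (rule fun_cong)
  then have "frechet_derivative ?P (at (0, y0)) (1, 0) = v' u"
    using second_derivative_symmetric[OF N(1,2,3)] by simp
  then show "((\<lambda>t. ?P (t, y0)) has_derivative (\<lambda>t. t *\<^sub>R v' u)) (at 0)"
    using time[OF smooth_on_frechet[OF N(2), of "(0, u)"]] by simp
qed

text \<open>The primitive is the integral of \<open>\<alpha>\<close> along the segments from the
  centre, differentiated under the integral sign.\<close>

lemma poincare_lemma:
  fixes \<alpha> :: "'e::euclidean_space \<Rightarrow> 'e \<Rightarrow> real"
  assumes smooth: "\<And>w. smooth_on (ball y0 r) (\<lambda>y. \<alpha> y w)"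
    and lin: "\<And>y. y \<in> ball y0 r \<Longrightarrow> linear (\<alpha> y)"
    and closed: "\<And>y u w. y \<in> ball y0 r \<Longrightarrow>
      frechet_derivative (\<lambda>y. \<alpha> y w) (at y) u = frechet_derivative (\<lambda>y. \<alpha> y u) (at y) w"
  shows "\<exists>F. \<forall>y\<in>ball y0 r. (F has_derivative \<alpha> y) (at y)"
proof -
  let ?B = "ball y0 r"
  define D where "D w y u = frechet_derivative (\<lambda>y. \<alpha> y w) (at y) u" for w y u
  define p where "p x t = y0 + t *\<^sub>R (x - y0)" for x t
  have pB: "p x t \<in> ?B" if "x \<in> ?B" "t \<in> {0..1}" for x t
  proof -
    have "norm (t *\<^sub>R (x - y0)) \<le> norm (x - y0)" using that(2) by (simp add: mult_left_le_one_le)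
    moreover have "norm (x - y0) < r" using that(1) by (simp add: dist_norm norm_minus_commute)
    ultimately show ?thesis by (simp add: p_def dist_norm)
  qed
  have D: "((\<lambda>y. \<alpha> y w) has_derivative D w y) (at y)" if "y \<in> ?B" for w y
  proof -
    have "D w y = frechet_derivative (\<lambda>y. \<alpha> y w) (at y)" by (simp add: D_def[abs_def])
    then show ?thesis using smooth_on_has_derivative[OF smooth that] by simp
  qed
  have Dlin: "D w y u = (\<Sum>b\<in>Basis. (u \<bullet> b) * D w y b)" if "y \<in> ?B" for w y u
    using linear_eq_sum_Basis[OF has_derivative_linear[OF D[OF that]], of w u] unfolding real_scaleR_def .
  \<comment> \<open>\<open>k x t h\<close> is the \<open>t\<close>-derivative of
    \<open>t * \<alpha> (p x t) h\<close>; closedness, which exchanges the two directions in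
    \<open>D\<close>, makes it the derivative of the integrand with respect to \<open>x\<close> as
    well.\<close>
  define k where "k x t h = t * D h (p x t) (x - y0) + \<alpha> (p x t) h" for x t h
  have k: "((\<lambda>x. \<alpha> (p x t) (x - y0)) has_derivative k x t) (at x)"
    if x: "x \<in> ?B" and t: "t \<in> {0..1}" for x t
  proof -
    have P: "((\<lambda>x. p x t) has_derivative (\<lambda>h. t *\<^sub>R h)) (at x)"
      unfolding p_def by (auto intro!: derivative_eq_intros)
    have "((\<lambda>x. \<alpha> (p x t) (x - y0)) has_derivative
       (\<lambda>h. D (x - y0) (p x t) (t *\<^sub>R h) + \<alpha> (p x t) h)) (at x)"
    proof (rule slot_has_derivative[where L = "\<lambda>x. \<alpha> (p x t)" and L' = "\<lambda>b h. D b (p x t) (t *\<^sub>R h)"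
          and U = "\<lambda>x. x - y0" and U' = "\<lambda>h. h", OF open_ball x])
      show "((\<lambda>x. \<alpha> (p x t) b) has_derivative (\<lambda>h. D b (p x t) (t *\<^sub>R h))) (at x)" for b
        by (rule has_derivative_compose[OF P D[OF pB[OF x t]]])
    qed (use lin pB t in \<open>auto intro!: derivative_eq_intros\<close>)
    moreover have "D (x - y0) (p x t) (t *\<^sub>R h) = t * D h (p x t) (x - y0)" for h
    proof -
      have "D (x - y0) (p x t) (t *\<^sub>R h) = t * D (x - y0) (p x t) h"
        using linear_cmul[OF has_derivative_linear[OF D[OF pB[OF x t]]], of "x - y0" t h] by simp
      also have "D (x - y0) (p x t) h = D h (p x t) (x - y0)"
        unfolding D_def by (rule closed[OF pB[OF x t]])
      finally show ?thesis .
    qed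
    ultimately show ?thesis by (simp only: k_def[abs_def])
  qed
  have contp: "continuous_on (?B \<times> {0..1}) (\<lambda>z. p (fst z) (snd z))"
    unfolding p_def by (intro continuous_intros)
  have along: "continuous_on (?B \<times> {0..1}) (\<lambda>z. f (p (fst z) (snd z)))" if "smooth_on ?B f" for f :: "'e \<Rightarrow> real"
    by (rule continuous_on_compose2[OF smooth_on_continuous_on[OF that] contp]) (auto intro: pB)
  \<comment> \<open>The direction \<open>x - y0\<close> moves with \<open>x\<close>, so
    \<open>D\<close> is expanded in the basis before continuity is read off.\<close>
  have contk: "continuous_on (?B \<times> {0..1}) (\<lambda>z. k (fst z) (snd z) h)" for h
  proof -
    have "continuous_on (?B \<times> {0..1}) (\<lambda>z. snd z * (\<Sum>b\<in>Basis. ((fst z - y0) \<bullet> b) * D h (p (fst z) (snd z)) b)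
        + \<alpha> (p (fst z) (snd z)) h)"
      by (intro continuous_intros along smooth) (simp add: D_def smooth_on_frechet smooth)
    then show ?thesis
    proof (rule continuous_on_eq)
      fix z assume "z \<in> ?B \<times> {0..1::real}"
      then have z: "fst z \<in> ?B" "snd z \<in> {0..1}" by auto
      show "snd z * (\<Sum>b\<in>Basis. ((fst z - y0) \<bullet> b) * D h (p (fst z) (snd z)) b)
        + \<alpha> (p (fst z) (snd z)) h = k (fst z) (snd z) h"
        unfolding k_def by (simp only: Dlin[OF pB[OF z], of h "fst z - y0"])
    qed
  qed
  \<comment> \<open>The Leibniz rule wants a continuous family of bounded linear maps;
    \<open>Blinfun\<close> is meaningful on the ball because \<open>k x t\<close> is a derivative
    there.\<close>
  define K where "K x t = Blinfun (k x t)" for x t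
  have K: "blinfun_apply (K x t) = k x t" if "x \<in> ?B" "t \<in> {0..1}" for x t
    unfolding K_def by (rule bounded_linear_Blinfun_apply[OF has_derivative_bounded_linear[OF k[OF that]]])
  have contK: "continuous_on (?B \<times> {0..1}) (\<lambda>z. K (fst z) (snd z))"
  proof (rule continuous_on_blinfun_componentwise)
    fix i :: 'e
    show "continuous_on (?B \<times> {0..1}) (\<lambda>z. blinfun_apply (K (fst z) (snd z)) i)"
      by (rule continuous_on_cong[THEN iffD1, OF refl _ contk[of i]]) (auto simp: K)
  qed
  define F where "F x = integral {0..1} (\<lambda>t. \<alpha> (p x t) (x - y0))" for x
  have "(F has_derivative \<alpha> x) (at x)" if x: "x \<in> ?B" for x
  proof -
    have "(F has_derivative blinfun_apply (integral (cbox 0 1) (K x))) (at x within ?B)"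
      unfolding F_def[abs_def] box_real(2)[symmetric]
    proof (rule leibniz_rule)
      show "((\<lambda>x. \<alpha> (p x t) (x - y0)) has_derivative blinfun_apply (K x t)) (at x within ?B)"
        if "x \<in> ?B" "t \<in> cbox 0 1" for x t
        using k[of x t] K[of x t] that by (simp add: has_derivative_at_withinI)
      show "(\<lambda>t. \<alpha> (p x t) (x - y0)) integrable_on cbox 0 1" if "x \<in> ?B" for x
        unfolding box_real(2)
        by (rule integrable_continuous_interval, rule continuous_on_compose2[OF smooth_on_continuous_on[OF smooth]])
          (use pB[OF that] in \<open>auto simp: p_def intro!: continuous_intros\<close>)
      show "continuous_on (?B \<times> cbox 0 1) (\<lambda>(x, t). K x t)"
        using contK by (simp add: case_prod_unfold)
    qed (use x in auto)
    moreover have "blinfun_apply (integral (cbox 0 1) (K x)) h = \<alpha> x h" for h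
    proof -
      have cK: "continuous_on {0..1} (K x)"
        by (rule continuous_on_compose2[OF contK, of _ "\<lambda>t. (x, t)", simplified])
          (use x in \<open>auto intro!: continuous_intros\<close>)
      have "blinfun_apply (integral (cbox 0 1) (K x)) h = integral {0..1} (\<lambda>t. blinfun_apply (K x t) h)"
        using integral_linear[OF integrable_continuous_interval[OF cK] blinfun.bounded_linear_left[of h]]
        by (simp add: o_def)
      also have "\<dots> = integral {0..1} (\<lambda>t. k x t h)"
        by (rule integral_cong) (simp add: K[OF x])
      also have "\<dots> = 1 * \<alpha> (p x 1) h - 0 * \<alpha> (p x 0) h"
      proof (rule integral_unique, rule fundamental_theorem_of_calculus)
        fix t :: real assume t: "t \<in> {0..1}"
        have "((\<lambda>t. p x t) has_derivative (\<lambda>s. s *\<^sub>R (x - y0))) (at t)"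
          unfolding p_def by (auto intro!: derivative_eq_intros)
        from has_derivative_compose[OF this D[OF pB[OF x t]]]
        have "((\<lambda>t. \<alpha> (p x t) h) has_derivative (\<lambda>s. s *\<^sub>R D h (p x t) (x - y0))) (at t)"
          by (simp add: linear_cmul[OF has_derivative_linear[OF D[OF pB[OF x t]]]])
        then have "((\<lambda>t. \<alpha> (p x t) h) has_vector_derivative D h (p x t) (x - y0)) (at t)"
          by (simp add: has_vector_derivative_def)
        then have "((\<lambda>t. t * \<alpha> (p x t) h) has_vector_derivative k x t h) (at t)"
          unfolding k_def by (auto intro!: derivative_eq_intros)
        then show "((\<lambda>t. t * \<alpha> (p x t) h) has_vector_derivative k x t h) (at t within {0..1})"
          by (rule has_vector_derivative_at_within)
      qed simp
      finally show ?thesis by (simp add: p_def)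
    qed
    then have "blinfun_apply (integral (cbox 0 1) (K x)) = \<alpha> x" by (rule ext)
    ultimately have "(F has_derivative \<alpha> x) (at x within ?B)" by (simp only:)
    then show ?thesis using at_within_open[OF x open_ball] by simp
  qed
  then show ?thesis by blast
qed

section \<open>Killing fields and parallel complex structures in a chart\<close>

lemma slot_smooth:
  fixes L :: "'z::euclidean_space \<Rightarrow> 'e::euclidean_space \<Rightarrow> 'f::real_normed_vector"
  assumes S: "open S" and lin: "\<And>z. z \<in> S \<Longrightarrow> linear (L z)"
    and L: "\<And>b. smooth_on S (\<lambda>z. L z b)" and U: "smooth_on S U"
  shows "smooth_on S (\<lambda>z. L z (U z))"
proof -
  have "smooth_on S (\<lambda>z. \<Sum>b\<in>Basis. (U z \<bullet> b) *\<^sub>R L z b)"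
  proof (rule smooth_on_sum[OF S], rule smooth_on_bilinear[OF bounded_bilinear_scaleR S _ L])
    show "smooth_on S (\<lambda>z. U z \<bullet> b)" for b
      by (rule smooth_on_linear_compose[OF S bounded_linear_inner_left U])
  qed
  moreover have "L z (U z) = (\<Sum>b\<in>Basis. (U z \<bullet> b) *\<^sub>R L z b)" if "z \<in> S" for z
    by (rule linear_eq_sum_Basis[OF lin[OF that]])
  ultimately show ?thesis using smooth_on_cong[OF S] by (metis (no_types, lifting))
qed

section \<open>Levi-Civita calculus of a metric on an open set\<close>

locale chart_metric =
  fixes D :: "'e::euclidean_space set" and G :: "'e \<Rightarrow> 'e \<Rightarrow> 'e \<Rightarrow> real"
  assumes open_D: "open D"
    and bilinear_G: "y \<in> D \<Longrightarrow> bilinear (G y)"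
    and G_sym: "y \<in> D \<Longrightarrow> G y u w = G y w u"
    and G_pos: "y \<in> D \<Longrightarrow> u \<noteq> 0 \<Longrightarrow> 0 < G y u u"
    and smooth_G: "smooth_on D (\<lambda>y. G y u w)"
begin

lemma linear_G_right: "y \<in> D \<Longrightarrow> linear (G y u)"
  and linear_G_left: "y \<in> D \<Longrightarrow> linear (\<lambda>u. G y u w)"
  using bilinear_G unfolding bilinear_def by auto

lemma G_linear:
  assumes "y \<in> D"
  shows "G y (u + u') w = G y u w + G y u' w" "G y u (w + w') = G y u w + G y u w'"
    "G y (u - u') w = G y u w - G y u' w" "G y u (w - w') = G y u w - G y u w'"
    "G y (- u) w = - G y u w" "G y u (- w) = - G y u w"
    "G y (r *\<^sub>R u) w = r * G y u w" "G y u (r *\<^sub>R w) = r * G y u w"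
    "G y 0 w = 0" "G y u 0 = 0"
  using linear_add[OF linear_G_right[OF assms]] linear_add[OF linear_G_left[OF assms]]
    linear_diff[OF linear_G_right[OF assms]] linear_diff[OF linear_G_left[OF assms]]
    linear_neg[OF linear_G_right[OF assms]] linear_neg[OF linear_G_left[OF assms]]
    linear_cmul[OF linear_G_right[OF assms]] linear_cmul[OF linear_G_left[OF assms]]
    linear_0[OF linear_G_right[OF assms]] linear_0[OF linear_G_left[OF assms]]
  by simp_all

lemma G_eqI:
  assumes "y \<in> D" "\<And>w. G y u w = G y v w" shows "u = v"
proof (rule ccontr)
  assume "u \<noteq> v"
  then have "0 < G y (u - v) (u - v)" using G_pos[OF assms(1)] by simp
  then show False using assms by (simp add: G_linear)
qed

text \<open>\<open>T\<close> lists the values of \<open>G y u\<close> on the basis. It is injective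
  because \<open>G\<close> is definite, hence surjective by dimension, so the vector described by
  \<open>sharp\<close> exists.\<close>

lemma G_sharp:
  assumes y: "y \<in> D" and \<alpha>: "linear \<alpha>"
  shows "G y (sharp (G y) \<alpha>) w = \<alpha> w"
proof -
  define T where "T u = (\<Sum>b\<in>Basis. G y u b *\<^sub>R b)" for u
  have Tb: "T u \<bullet> b = G y u b" if "b \<in> Basis" for u b
    using that by (simp add: T_def)
  have "linear T"
    unfolding T_def
    by (intro linearI) (simp_all add: G_linear[OF y] sum.distrib scaleR_add_left scaleR_sum_right)
  moreover have "inj T"
  proof (rule injI)
    fix u v assume "T u = T v"
    then have "G y u b = G y v b" if "b \<in> Basis" for b using Tb that by metis
    then have "G y u = G y v"
      using linear_eq_stdbasis[OF linear_G_right[OF y] linear_G_right[OF y]] by blast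
    then show "u = v" by (intro G_eqI[OF y]) simp
  qed
  ultimately have "surj T" using linear_injective_imp_surjective by blast
  then obtain v where v: "T v = (\<Sum>b\<in>Basis. \<alpha> b *\<^sub>R b)" by (metis surjD)
  have "G y v b = \<alpha> b" if "b \<in> Basis" for b
    using Tb[OF that, of v] that by (simp add: v)
  then have "G y v = \<alpha>"
    using linear_eq_stdbasis[OF linear_G_right[OF y] \<alpha>] by blast
  then have "\<forall>w. G y v w = \<alpha> w" by simp
  then have "\<forall>w. G y (THE v. \<forall>w. G y v w = \<alpha> w) w = \<alpha> w"
  proof (rule theI)
    fix v' assume "\<forall>w. G y v' w = \<alpha> w"
    with \<open>\<forall>w. G y v w = \<alpha> w\<close> show "v' = v" by (intro G_eqI[OF y]) simp
  qed
  then show ?thesis by (simp add: sharp_def)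
qed

lemma sharp_eqI:
  assumes y: "y \<in> D" and "\<And>w. G y v w = \<alpha> w" shows "sharp (G y) \<alpha> = v"
proof -
  have "\<alpha> = G y v" using assms(2) by (simp add: fun_eq_iff)
  then show ?thesis using G_sharp[OF y linear_G_right[OF y]] G_eqI[OF y] by metis
qed

definition dG :: "'e \<Rightarrow> 'e \<Rightarrow> 'e \<Rightarrow> 'e \<Rightarrow> real" where
  "dG y h u w = frechet_derivative (\<lambda>y. G y u w) (at y) h"

lemma G_has_derivative: "y \<in> D \<Longrightarrow> ((\<lambda>y. G y u w) has_derivative (\<lambda>h. dG y h u w)) (at y)"
  using smooth_on_has_derivative[OF smooth_G] by (simp add: dG_def[abs_def])

text \<open>Any function that agrees with \<open>G z u w\<close> on \<open>D\<close> may be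
  differentiated instead; symmetry and linearity of \<open>dG\<close> thus come from those of
  \<open>G\<close>.\<close>

lemma dG_unique:
  assumes "y \<in> D" "(f has_derivative f') (at y)" "\<And>z. z \<in> D \<Longrightarrow> f z = G z u w"
  shows "dG y h u w = f' h"
  using has_derivative_unique[OF G_has_derivative[OF assms(1)]
      has_derivative_transform_within_open[OF assms(2) open_D assms(1,3)]] by (rule fun_cong)

lemma dG_sym: "y \<in> D \<Longrightarrow> dG y h u w = dG y h w u"
  by (rule dG_unique[OF _ G_has_derivative]) (auto simp: G_sym)

lemma linear_dG_direction: "y \<in> D \<Longrightarrow> linear (\<lambda>h. dG y h u w)"
  by (rule has_derivative_linear[OF G_has_derivative])

lemma linear_dG_right:
  assumes "y \<in> D" shows "linear (dG y h u)"
proof (rule linearI)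
  show "dG y h u (w + w') = dG y h u w + dG y h u w'" for w w'
    by (rule dG_unique[OF assms has_derivative_add[OF G_has_derivative[OF assms] G_has_derivative[OF assms]]])
      (simp add: G_linear)
  show "dG y h u (r *\<^sub>R w) = r *\<^sub>R dG y h u w" for r w
    by (rule dG_unique[OF assms has_derivative_scaleR_right[OF G_has_derivative[OF assms]]])
      (simp add: G_linear)
qed

lemma linear_dG_left: "y \<in> D \<Longrightarrow> linear (\<lambda>u. dG y h u w)"
  using linear_dG_right[of y h w] dG_sym[of y h] by (simp add: linear_iff)

definition \<Gamma> :: "'e \<Rightarrow> 'e \<Rightarrow> 'e \<Rightarrow> 'e" where
  "\<Gamma> y u w = sharp (G y) (\<lambda>z. (dG y u w z + dG y w u z - dG y z u w) / 2)"

lemma G_\<Gamma>: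
  assumes "y \<in> D"
  shows "G y (\<Gamma> y u w) z = (dG y u w z + dG y w u z - dG y z u w) / 2"
  unfolding \<Gamma>_def
proof (rule G_sharp[OF assms])
  show "linear (\<lambda>z. (dG y u w z + dG y w u z - dG y z u w) / 2)"
    using linear_add[OF linear_dG_right[OF assms]] linear_cmul[OF linear_dG_right[OF assms]]
      linear_add[OF linear_dG_direction[OF assms]] linear_cmul[OF linear_dG_direction[OF assms]]
    by (intro linearI) (simp_all add: algebra_simps add_divide_distrib diff_divide_distrib)
qed

text \<open>The connection is torsion-free, because constant coordinate fields commute.\<close>

lemma \<Gamma>_sym: assumes "y \<in> D" shows "\<Gamma> y u w = \<Gamma> y w u"
  by (rule G_eqI[OF assms]) (simp add: G_\<Gamma>[OF assms] dG_sym[OF assms, of _ u w])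

text \<open>Compatibility with the metric: in the sum of the two Koszul expressions everything
  cancels except the derivative in direction \<open>h\<close>.\<close>

lemma dG_\<Gamma>: "y \<in> D \<Longrightarrow> dG y h u w = G y (\<Gamma> y h u) w + G y u (\<Gamma> y h w)"
  using G_sym[of y u "\<Gamma> y h w"] dG_sym[of y h u w] dG_sym[of y u h w] dG_sym[of y w h u]
  by (simp add: G_\<Gamma> field_simps)

lemma linear_\<Gamma>_left:
  assumes y: "y \<in> D" shows "linear (\<lambda>u. \<Gamma> y u w)"
proof (rule linearI; rule G_eqI[OF y])
  show "G y (\<Gamma> y (u + u') w) z = G y (\<Gamma> y u w + \<Gamma> y u' w) z" for u u' z
    by (simp add: G_linear[OF y] G_\<Gamma>[OF y] linear_add[OF linear_dG_left[OF y]]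
        linear_add[OF linear_dG_direction[OF y]] field_simps)
  show "G y (\<Gamma> y (r *\<^sub>R u) w) z = G y (r *\<^sub>R \<Gamma> y u w) z" for r u z
    by (simp add: G_linear[OF y] G_\<Gamma>[OF y] linear_cmul[OF linear_dG_left[OF y]]
        linear_cmul[OF linear_dG_direction[OF y]] algebra_simps)
qed

text \<open>Base point and both arguments may move: \<open>slot_has_derivative\<close> is applied
  once for each argument.\<close>

lemma metric_has_derivative:
  assumes S: "open S" "z0 \<in> S" and Y: "(Y has_derivative Y') (at z0)" "\<And>z. z \<in> S \<Longrightarrow> Y z \<in> D"
    and U: "(U has_derivative U') (at z0)" and W: "(W has_derivative W') (at z0)"
  shows "((\<lambda>z. G (Y z) (U z) (W z)) has_derivative
    (\<lambda>h. dG (Y z0) (Y' h) (U z0) (W z0) + G (Y z0) (U' h) (W z0) + G (Y z0) (U z0) (W' h))) (at z0)"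
proof (rule slot_has_derivative[where L = "\<lambda>z. G (Y z) (U z)" and
      L' = "\<lambda>w h. dG (Y z0) (Y' h) (U z0) w + G (Y z0) (U' h) w", OF S _ _ W])
  fix w
  show "((\<lambda>z. G (Y z) (U z) w) has_derivative (\<lambda>h. dG (Y z0) (Y' h) (U z0) w + G (Y z0) (U' h) w)) (at z0)"
  proof (rule slot_has_derivative[where L = "\<lambda>z u. G (Y z) u w" and L' = "\<lambda>u h. dG (Y z0) (Y' h) u w",
        OF S _ _ U])
    show "((\<lambda>z. G (Y z) u w) has_derivative (\<lambda>h. dG (Y z0) (Y' h) u w)) (at z0)" for u
      by (rule has_derivative_compose[OF Y(1) G_has_derivative[OF Y(2)[OF S(2)]]])
  qed (use Y(2) linear_G_left in auto)
qed (use Y(2) linear_G_right in auto)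

end

section \<open>Kaehler structures and Killing fields in coordinates\<close>

locale kaehler_chart = chart_metric D G for D :: "'e::euclidean_space set" and G +
  fixes J :: "'e \<Rightarrow> 'e \<Rightarrow> 'e"
  assumes linear_J: "y \<in> D \<Longrightarrow> linear (J y)"
    and J_J: "y \<in> D \<Longrightarrow> J y (J y u) = - u"
    and G_J_J: "y \<in> D \<Longrightarrow> G y (J y u) (J y w) = G y u w"
    and smooth_J: "smooth_on D (\<lambda>y. J y u)"
    and parallel_J: "y \<in> D \<Longrightarrow>
      frechet_derivative (\<lambda>y. J y w) (at y) u + \<Gamma> y u (J y w) - J y (\<Gamma> y u w) = 0"

text \<open>The assumption \<open>killing\<close> is the coordinate form of the vanishing of the Lie
  derivative of \<open>G\<close> along \<open>v\<close>.\<close>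

locale killing_chart = chart_metric D G for D :: "'e::euclidean_space set" and G +
  fixes v :: "'e \<Rightarrow> 'e"
  assumes smooth_v: "smooth_on D v"
    and killing: "y \<in> D \<Longrightarrow> dG y (v y) u w + G y (frechet_derivative v (at y) u) w
      + G y u (frechet_derivative v (at y) w) = 0"
begin

definition S :: "'e \<Rightarrow> 'e \<Rightarrow> 'e" where
  "S y u = frechet_derivative v (at y) u + \<Gamma> y u (v y)"

lemma linear_S: "y \<in> D \<Longrightarrow> linear (S y)"
  unfolding S_def
  using linear_compose_add[OF has_derivative_linear[OF smooth_on_has_derivative[OF smooth_v]] linear_\<Gamma>_left]
  by blast

text \<open>Metric compatibility replaces \<open>dG\<close> in the Killing equation;
  torsion-freeness lets the terms \<open>\<Gamma> y (v y) u\<close> combine with the derivative of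
  \<open>v\<close> to \<open>S\<close>.\<close>

lemma S_skew: "y \<in> D \<Longrightarrow> G y (S y u) w = - G y u (S y w)"
  using killing[of y u w] dG_\<Gamma>[of y "v y" u w] \<Gamma>_sym[of y "v y"]
  by (simp add: S_def G_linear)

end

text \<open>The assumption \<open>holomorphic\<close> is the coordinate form of the vanishing of the
  Lie derivative of \<open>J\<close> along \<open>v\<close>.\<close>

locale holomorphic_killing_chart = kaehler_chart D G J + killing_chart D G v
  for D :: "'e::euclidean_space set" and G J v +
  assumes holomorphic: "y \<in> D \<Longrightarrow> frechet_derivative v (at y) (J y u) =
    frechet_derivative (\<lambda>y. J y u) (at y) (v y) + J y (frechet_derivative v (at y) u)"
begin

text \<open>The derivative of \<open>J\<close> along \<open>v\<close> occurs both in
  \<open>holomorphic\<close> and in the parallelism of \<open>J\<close>; eliminating it leaves the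
  commutation.\<close>

lemma S_J: "y \<in> D \<Longrightarrow> S y (J y u) = J y (S y u)"
  using parallel_J[of y u "v y"] \<Gamma>_sym[of y "v y"]
  by (simp add: S_def holomorphic linear_add[OF linear_J] algebra_simps)

lemma G_J_swap: "y \<in> D \<Longrightarrow> G y (J y u) w = - G y u (J y w)"
  using G_J_J[of y "J y u" w] by (simp add: J_J G_linear)

text \<open>\<open>J\<close> and \<open>S\<close> are skew and commute, so their product is
  symmetric.\<close>

lemma G_J_S_sym: "y \<in> D \<Longrightarrow> G y (J y (S y u)) w = G y (J y (S y w)) u"
  using S_skew[of y u "J y w"] G_sym[of y u] by (simp add: G_J_swap S_J)

definition \<alpha> :: "'e \<Rightarrow> 'e \<Rightarrow> real" where "\<alpha> y w = G y (J y (v y)) w"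

lemma linear_\<alpha>: "y \<in> D \<Longrightarrow> linear (\<alpha> y)"
  unfolding \<alpha>_def[abs_def] by (rule linear_G_right)

lemma smooth_\<alpha>: "smooth_on D (\<lambda>y. \<alpha> y w)"
  unfolding \<alpha>_def
  by (rule slot_smooth[OF open_D linear_G_left smooth_G slot_smooth[OF open_D linear_J smooth_J smooth_v]])

text \<open>The first term is the covariant derivative of the form; the second, symmetric in
  \<open>u\<close> and \<open>w\<close>, is due to the coordinates. Both closedness and the Hessian
  of a Hamiltonian are read off from here.\<close>

lemma \<alpha>_has_derivative:
  assumes y: "y \<in> D"
  shows "((\<lambda>y. \<alpha> y w) has_derivative (\<lambda>u. G y (J y (S y u)) w + \<alpha> y (\<Gamma> y u w))) (at y)"
proof -
  let ?Dv = "frechet_derivative v (at y)"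
  let ?DJ = "\<lambda>u. frechet_derivative (\<lambda>y. J y u) (at y)"
  have Jv: "((\<lambda>y. J y (v y)) has_derivative (\<lambda>h. ?DJ (v y) h + J y (?Dv h))) (at y)"
    by (rule slot_has_derivative[OF open_D y linear_J smooth_on_has_derivative[OF smooth_J y]
          smooth_on_has_derivative[OF smooth_v y]])
  have "((\<lambda>y. \<alpha> y w) has_derivative
      (\<lambda>h. dG y h (J y (v y)) w + G y (?DJ (v y) h + J y (?Dv h)) w + G y (J y (v y)) 0)) (at y)"
    unfolding \<alpha>_def
    by (rule metric_has_derivative[OF open_D y has_derivative_ident _ Jv has_derivative_const])
  moreover have "dG y h (J y (v y)) w + G y (?DJ (v y) h + J y (?Dv h)) w + G y (J y (v y)) 0 =
      G y (J y (S y h)) w + \<alpha> y (\<Gamma> y h w)" for h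
  proof -
    have "?DJ (v y) h = J y (\<Gamma> y h (v y)) - \<Gamma> y h (J y (v y))"
      using parallel_J[OF y, of "v y" h] by (simp add: algebra_simps)
    then show ?thesis
      by (simp add: dG_\<Gamma>[OF y] S_def \<alpha>_def G_linear[OF y] linear_add[OF linear_J[OF y]])
  qed
  ultimately show ?thesis by simp
qed

lemma \<alpha>_closed:
  "y \<in> D \<Longrightarrow> frechet_derivative (\<lambda>y. \<alpha> y w) (at y) u = frechet_derivative (\<lambda>y. \<alpha> y u) (at y) w"
  using frechet_derivative_eqI[OF \<alpha>_has_derivative, of y w] frechet_derivative_eqI[OF \<alpha>_has_derivative, of y u]
    G_J_S_sym[of y u w] \<Gamma>_sym[of y u w] by simp

end

section \<open>Local potentials and the first homology group\<close>

text \<open>A closed one-form in purely topological terms: where two members of \<open>P\<close>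
  meet, their increments agree near each point.\<close>

locale local_potentials =
  fixes P :: "('m::topological_space set \<times> ('m \<Rightarrow> real)) set"
  assumes open_dom: "(U, F) \<in> P \<Longrightarrow> open U"
    and cover: "\<exists>U F. (U, F) \<in> P \<and> x \<in> U"
    and compatible: "(U, F) \<in> P \<Longrightarrow> (U', F') \<in> P \<Longrightarrow> x \<in> U \<Longrightarrow> x \<in> U' \<Longrightarrow>
      \<exists>W. open W \<and> x \<in> W \<and> (\<forall>y\<in>W. F y - F x = F' y - F' x)"
begin

text \<open>The pairs in \<open>P\<close> are local potentials of a closed form, and \<open>h\<close> is a potential on \<open>S\<close> of its
  pullback along \<open>q\<close>.\<close>

definition primitive :: "'a::topological_space set \<Rightarrow> ('a \<Rightarrow> 'm) \<Rightarrow> ('a \<Rightarrow> real) \<Rightarrow> bool" where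
  "primitive S q h \<longleftrightarrow> (\<forall>x\<in>S. \<forall>U F. (U, F) \<in> P \<longrightarrow> q x \<in> U \<longrightarrow>
     (\<exists>W. open W \<and> x \<in> W \<and> (\<forall>y\<in>W \<inter> S. h y - h x = F (q y) - F (q x))))"

lemma primitiveD:
  "primitive S q h \<Longrightarrow> x \<in> S \<Longrightarrow> (U, F) \<in> P \<Longrightarrow> q x \<in> U \<Longrightarrow>
   \<exists>W. open W \<and> x \<in> W \<and> (\<forall>y\<in>W \<inter> S. h y - h x = F (q y) - F (q x))"
  by (simp add: primitive_def)

lemma primitive_subset: "primitive S q h \<Longrightarrow> T \<subseteq> S \<Longrightarrow> primitive T q h"
  unfolding primitive_def
proof (intro ballI allI impI)
  fix x U F
  assume "T \<subseteq> S" "x \<in> T" "(U, F) \<in> P" "q x \<in> U"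
    and *: "\<forall>x\<in>S. \<forall>U F. (U, F) \<in> P \<longrightarrow> q x \<in> U \<longrightarrow>
     (\<exists>W. open W \<and> x \<in> W \<and> (\<forall>y\<in>W \<inter> S. h y - h x = F (q y) - F (q x)))"
  moreover from this obtain W where "open W" "x \<in> W" "\<forall>y\<in>W \<inter> S. h y - h x = F (q y) - F (q x)"
    by (metis subsetD)
  ultimately show "\<exists>W. open W \<and> x \<in> W \<and> (\<forall>y\<in>W \<inter> T. h y - h x = F (q y) - F (q x))"
    by (intro exI[of _ W]) auto
qed

lemma primitive_compose:
  assumes "primitive S q h" "continuous_on T c" "c ` T \<subseteq> S"
  shows "primitive T (\<lambda>x. q (c x)) (\<lambda>x. h (c x))"
  unfolding primitive_def
proof (intro ballI allI impI)
  fix x U F assume x: "x \<in> T" "(U, F) \<in> P" "q (c x) \<in> U"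
  then obtain W where W: "open W" "c x \<in> W" "\<forall>y\<in>W \<inter> S. h y - h (c x) = F (q y) - F (q (c x))"
    using primitiveD[OF assms(1), of "c x"] assms(3) by blast
  obtain V where V: "open V" "V \<inter> T = c -` W \<inter> T"
    using assms(2) W(1) unfolding continuous_on_open_invariant by blast
  show "\<exists>W. open W \<and> x \<in> W \<and> (\<forall>y\<in>W \<inter> T. h (c y) - h (c x) = F (q (c y)) - F (q (c x)))"
    using V W x assms(3) by (intro exI[of _ V]) auto
qed

text \<open>The difference of two primitives is locally constant, since both have the increments of
  the same local potential.\<close>

lemma primitive_unique:
  assumes "connected S" "primitive S q h" "primitive S q h'" "x \<in> S" "y \<in> S"
  shows "h y - h x = h' y - h' x"
proof -
  have "(\<lambda>x. h x - h' x) constant_on S"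
  proof (rule locally_constant_imp_constant[OF assms(1)])
    fix a assume a: "a \<in> S"
    obtain U F where UF: "(U, F) \<in> P" "q a \<in> U" using cover by blast
    obtain W where W: "open W" "a \<in> W" "\<forall>y\<in>W \<inter> S. h y - h a = F (q y) - F (q a)"
      using primitiveD[OF assms(2) a UF] by blast
    obtain W' where W': "open W'" "a \<in> W'" "\<forall>y\<in>W' \<inter> S. h' y - h' a = F (q y) - F (q a)"
      using primitiveD[OF assms(3) a UF] by blast
    have lc: "h z - h' z = h a - h' a" if "z \<in> S \<inter> (W \<inter> W')" for z
    proof -
      have "h z - h a = F (q z) - F (q a)" "h' z - h' a = F (q z) - F (q a)" using W(3) W'(3) that by auto
      then show ?thesis by linarith
    qed
    then show "\<exists>T. openin (top_of_set S) T \<and> a \<in> T \<and> (\<forall>x\<in>T. h x - h' x = h a - h' a)"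
    proof (intro exI[of _ "S \<inter> (W \<inter> W')"] conjI ballI lc)
      show "openin (top_of_set S) (S \<inter> (W \<inter> W'))"
        using W(1) W'(1) by (intro openin_open_Int open_Int)
    qed (use a W(2) W'(2) in simp_all)
  qed
  then obtain c where "\<And>z. z \<in> S \<Longrightarrow> h z - h' z = c" unfolding constant_on_def by blast
  from this[OF assms(4)] this[OF assms(5)] show ?thesis by linarith
qed

text \<open>On the connected intersection the two primitives differ by one constant, which is
  absorbed into the second. As the sets are closed, each of them is invisible near the points
  outside it.\<close>

lemma primitive_glue:
  assumes "closed S" "closed T" "connected (S \<inter> T)" "S \<inter> T \<noteq> {}"
    and "primitive S q h1" "primitive T q h2"
  shows "\<exists>h. primitive (S \<union> T) q h"
proof -
  obtain p where p: "p \<in> S" "p \<in> T" using assms(4) by blast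
  define h3 where "h3 = (\<lambda>x. h2 x + (h1 p - h2 p))"
  define h where "h = (\<lambda>x. if x \<in> S then h1 x else h3 x)"
  have hT: "h x = h3 x" if "x \<in> T" for x
    using primitive_unique[OF assms(3) primitive_subset[OF assms(5)] primitive_subset[OF assms(6)], of p x]
      p that by (auto simp: h_def h3_def)
  have hS: "h x = h1 x" if "x \<in> S" for x using that by (simp add: h_def)
  have "primitive (S \<union> T) q h"
    unfolding primitive_def
  proof (intro ballI allI impI)
    fix x U F assume x: "x \<in> S \<union> T" "(U, F) \<in> P" "q x \<in> U"
    have "\<exists>W. open W \<and> x \<in> W \<and> (\<forall>y\<in>W \<inter> S. h y - h x = F (q y) - F (q x))"
    proof (cases "x \<in> S")
      case True
      then show ?thesis using primitiveD[OF assms(5) True x(2,3)] hS by auto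
    qed (use assms(1) in \<open>auto intro!: exI[of _ "- S"]\<close>)
    moreover have "\<exists>W. open W \<and> x \<in> W \<and> (\<forall>y\<in>W \<inter> T. h y - h x = F (q y) - F (q x))"
    proof (cases "x \<in> T")
      case True
      then show ?thesis using primitiveD[OF assms(6) True x(2,3)] hT by (auto simp: h3_def)
    qed (use assms(2) in \<open>auto intro!: exI[of _ "- T"]\<close>)
    ultimately obtain W1 W2 where "open W1" "x \<in> W1" "open W2" "x \<in> W2"
      "\<forall>y\<in>W1 \<inter> S. h y - h x = F (q y) - F (q x)" "\<forall>y\<in>W2 \<inter> T. h y - h x = F (q y) - F (q x)" by blast
    then show "\<exists>W. open W \<and> x \<in> W \<and> (\<forall>y\<in>W \<inter> (S \<union> T). h y - h x = F (q y) - F (q x))"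
      by (intro exI[of _ "W1 \<inter> W2"]) auto
  qed
  then show ?thesis by (rule exI[of "\<lambda>h. primitive (S \<union> T) q h" h])
qed

lemma primitive_dom:
  assumes "continuous_on UNIV q" "(U, F) \<in> P" "q ` S \<subseteq> U"
  shows "primitive S q (\<lambda>x. F (q x))"
  unfolding primitive_def
proof (intro ballI allI impI)
  fix x U' F' assume x: "x \<in> S" "(U', F') \<in> P" "q x \<in> U'"
  have "q x \<in> U" using x(1) assms(3) by auto
  from compatible[OF assms(2) x(2) this x(3)]
  obtain W where W: "open W" "q x \<in> W" "\<forall>y\<in>W. F y - F (q x) = F' y - F' (q x)"
    by blast
  have "open (q -` W)" using assms(1) W(1) by (simp add: continuous_on_open_vimage)
  then show "\<exists>W. open W \<and> x \<in> W \<and> (\<forall>y\<in>W \<inter> S. F (q y) - F (q x) = F' (q y) - F' (q x))"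
  proof (intro exI[of _ "q -` W"] conjI ballI)
    fix y assume "y \<in> q -` W \<inter> S"
    then show "F (q y) - F (q x) = F' (q y) - F' (q x)" by (intro W(3)[rule_format]) simp
  qed (use W(2) in simp_all)
qed

text \<open>Bisection is used twice in place of a Lebesgue number: horizontally, for a strip of some
  height about each level \<open>s\<close>, and then vertically, to stack such strips. Two
  neighbouring rectangles meet in a segment, which is connected, so their primitives glue.\<close>

lemma primitive_rectangle:
  fixes q :: "real \<times> real \<Rightarrow> 'm"
  assumes q: "continuous_on UNIV q" and "a \<le> b" "c \<le> d"
  shows "\<exists>h. primitive ({a..b} \<times> {c..d}) q h"
proof -
  have strip: "\<exists>\<delta>>0. \<exists>h. primitive ({a..b} \<times> {s-\<delta>..s+\<delta>}) q h" for s
    using \<open>a \<le> b\<close>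
  proof (induction rule: Bolzano)
    case (trans a b c)
    then obtain d1 h1 d2 h2 where d: "d1 > 0" "primitive ({a..b} \<times> {s-d1..s+d1}) q h1"
      "d2 > 0" "primitive ({b..c} \<times> {s-d2..s+d2}) q h2" by blast
    \<comment> \<open>The two halves come with strips of different heights; the smaller height
      serves both.\<close>
    let ?d = "min d1 d2"
    have int: "({a..b} \<times> {s-?d..s+?d}) \<inter> ({b..c} \<times> {s-?d..s+?d}) = {b} \<times> {s-?d..s+?d}"
      using trans(3,4) by auto
    have "\<exists>h. primitive (({a..b} \<times> {s-?d..s+?d}) \<union> ({b..c} \<times> {s-?d..s+?d})) q h"
    proof (rule primitive_glue)
      show "connected (({a..b} \<times> {s-?d..s+?d}) \<inter> ({b..c} \<times> {s-?d..s+?d}))"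
        unfolding int by (intro connected_Times) auto
      show "primitive ({a..b} \<times> {s-?d..s+?d}) q h1" by (rule primitive_subset[OF d(2)]) auto
      show "primitive ({b..c} \<times> {s-?d..s+?d}) q h2" by (rule primitive_subset[OF d(4)]) auto
    qed (use int d in \<open>auto intro!: closed_Times\<close>)
    moreover have "({a..b} \<times> {s-?d..s+?d}) \<union> ({b..c} \<times> {s-?d..s+?d}) = {a..c} \<times> {s-?d..s+?d}"
      using trans(3,4) by auto
    ultimately show ?case using d by (intro exI[of _ ?d]) auto
  next
    case (local x)
    obtain U F where UF: "(U, F) \<in> P" "q (x, s) \<in> U" using cover by blast
    have "open (q -` U)" using q open_dom[OF UF(1)] by (simp add: continuous_on_open_vimage)
    moreover have "(x, s) \<in> q -` U" using UF by simp
    ultimately obtain A B where AB: "open A" "open B" "x \<in> A" "s \<in> B" "A \<times> B \<subseteq> q -` U"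
      by (elim open_prod_elim) (auto simp: mem_Times_iff)
    obtain e where e: "e > 0" "cball x e \<subseteq> A" using AB open_contains_cball by blast
    obtain e' where e': "e' > 0" "cball s e' \<subseteq> B" using AB open_contains_cball by blast
    show ?case
    proof (rule exI[of _ e], intro conjI allI impI)
      fix a b assume ab: "a \<le> x \<and> x \<le> b \<and> b - a < e"
      have "{a..b} \<subseteq> cball x e" using ab by (auto simp: dist_real_def)
      moreover have "{s-e'..s+e'} \<subseteq> cball s e'" by (auto simp: dist_real_def)
      ultimately have "{a..b} \<times> {s-e'..s+e'} \<subseteq> A \<times> B" using e e' by (intro Sigma_mono) auto
      then have "q ` ({a..b} \<times> {s-e'..s+e'}) \<subseteq> U" using AB(5) by auto
      then show "\<exists>\<delta>>0. \<exists>h. primitive ({a..b} \<times> {s-\<delta>..s+\<delta>}) q h"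
        using primitive_dom[OF q UF(1)] e'(1) by blast
    qed (rule e)
  qed
  show ?thesis
    using \<open>c \<le> d\<close>
  proof (induction rule: Bolzano)
    case (trans c' d e)
    then obtain h1 h2 where h: "primitive ({a..b} \<times> {c'..d}) q h1"
      "primitive ({a..b} \<times> {d..e}) q h2" by blast
    have int: "({a..b} \<times> {c'..d}) \<inter> ({a..b} \<times> {d..e}) = {a..b} \<times> {d}"
      using trans(3,4) by auto
    have "\<exists>h. primitive (({a..b} \<times> {c'..d}) \<union> ({a..b} \<times> {d..e})) q h"
    proof (rule primitive_glue[OF _ _ _ _ h])
      show "connected (({a..b} \<times> {c'..d}) \<inter> ({a..b} \<times> {d..e}))"
        unfolding int by (intro connected_Times) auto
    qed (use int \<open>a \<le> b\<close> in \<open>auto intro!: closed_Times\<close>)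
    moreover have "({a..b} \<times> {c'..d}) \<union> ({a..b} \<times> {d..e}) = {a..b} \<times> {c'..e}"
      using trans(3,4) by auto
    ultimately show ?case by simp
  next
    case (local x)
    obtain \<delta> h where d: "\<delta> > 0" "primitive ({a..b} \<times> {x-\<delta>..x+\<delta>}) q h" using strip by blast
    show ?case
    proof (rule exI[of _ \<delta>], intro conjI allI impI)
      fix c d assume "c \<le> x \<and> x \<le> d \<and> d - c < \<delta>"
      then have "{a..b} \<times> {c..d} \<subseteq> {a..b} \<times> {x-\<delta>..x+\<delta>}" by auto
      then show "\<exists>h. primitive ({a..b} \<times> {c..d}) q h" using primitive_subset[OF d(2)] by blast
    qed (rule d)
  qed
qed

text \<open>The integral along \<open>q\<close> of the form that \<open>P\<close> describes. All
  primitives on the unit interval have the same increment, so the description is unique as soon as a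
  primitive exists.\<close>

definition variation :: "(real \<Rightarrow> 'm) \<Rightarrow> real" where
  "variation q = (THE r. \<forall>h. primitive {0..1} q h \<longrightarrow> r = h 1 - h 0)"

lemma variation_eq:
  assumes "primitive {0..1} q h" shows "variation q = h 1 - h 0"
  unfolding variation_def
proof (rule the_equality)
  show "\<forall>h'. primitive {0..1} q h' \<longrightarrow> h 1 - h 0 = h' 1 - h' 0"
    using primitive_unique[OF _ assms, of _ 0 1] by auto
qed (use assms in blast)

lemma variation_const: "variation (\<lambda>t. x) = 0"
proof -
  have "primitive {0..1} (\<lambda>t::real. x) (\<lambda>t. 0)" unfolding primitive_def by (auto intro: exI[of _ UNIV])
  from variation_eq[OF this] show ?thesis by simp
qed

end

section \<open>Parametrised edges and triangles\<close>

definition clip :: "real \<Rightarrow> real" where "clip t = max 0 (min 1 t)"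

lemma clip_bounds: "0 \<le> clip t" "clip t \<le> 1" by (auto simp: clip_def)

lemma clip_eq: "0 \<le> t \<Longrightarrow> t \<le> 1 \<Longrightarrow> clip t = t" by (auto simp: clip_def)

lemma continuous_on_clip [continuous_intros]: "continuous_on S f \<Longrightarrow> continuous_on S (\<lambda>x. clip (f x))"
  unfolding clip_def by (intro continuous_intros)

text \<open>Barycentric coordinates along the edge. Clipping extends the parametrisation to the
  whole line, because the primitives above are built for maps that are continuous
  everywhere.\<close>

definition edge_point :: "real \<Rightarrow> nat \<Rightarrow> real" where
  "edge_point t = (\<lambda>i. if i = 0 then 1 - clip t else if i = 1 then clip t else 0)"

text \<open>The unit square is mapped onto the triangle by collapsing its side
  \<open>fst z = 0\<close> to vertex 0. The other sides become the edges: \<open>fst z = 1\<close>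
  face 0, \<open>snd z = 1\<close> face 1, \<open>snd z = 0\<close> face 2.\<close>

definition triangle_point :: "real \<times> real \<Rightarrow> nat \<Rightarrow> real" where
  "triangle_point z = (\<lambda>i. if i = 0 then 1 - clip (fst z) else if i = 1 then clip (fst z) * (1 - clip (snd z))
     else if i = 2 then clip (fst z) * clip (snd z) else 0)"

lemma edge_in_simplex: "edge_point t \<in> standard_simplex 1"
  using clip_bounds[of t] by (auto simp: standard_simplex_def edge_point_def)

lemma triangle_in_simplex: "triangle_point z \<in> standard_simplex 2"
  using clip_bounds[of "fst z"] clip_bounds[of "snd z"]
  by (auto simp: standard_simplex_def triangle_point_def numeral_2_eq_2 algebra_simps mult_le_one
      intro: mult_left_le add_increasing2)

lemma continuous_triangle: "continuous_on UNIV triangle_point"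
proof (rule continuous_on_coordinatewise_then_product)
  show "continuous_on UNIV (\<lambda>z. triangle_point z i)" for i
    unfolding triangle_point_def by (cases "i = 0"; cases "i = 1"; cases "i = 2") (auto intro!: continuous_intros)
qed

lemma singular_simplex_euclidean:
  "singular_simplex p euclidean \<sigma> \<longleftrightarrow> continuous_on (standard_simplex p) \<sigma> \<and> \<sigma> \<in> extensional (standard_simplex p)"
  by (simp add: singular_simplex_def euclidean_product_topology)

lemma face_edge: "singular_face 2 k \<tau> (edge_point t) = \<tau> (simplical_face k (edge_point t))"
  using edge_in_simplex by (simp add: singular_face_def)

lemma simplical_face_edge:
  "simplical_face 0 (edge_point t) = triangle_point (1, t)"
  "simplical_face 1 (edge_point t) = triangle_point (t, 1)"
  "simplical_face 2 (edge_point t) = triangle_point (t, 0)"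
  by (rule ext, auto simp: simplical_face_def edge_point_def triangle_point_def clip_eq)+

context local_potentials
begin

definition period :: "((nat \<Rightarrow> real) \<Rightarrow> 'm) \<Rightarrow> real" where
  "period \<sigma> = variation (\<lambda>t. \<sigma> (edge_point t))"

text \<open>A primitive \<open>h\<close> exists on the square, and each period is a difference of
  its corner values. The alternating sum is the increment along the collapsed side, where the map is
  constant.\<close>

lemma period_boundary:
  assumes "singular_simplex 2 euclidean \<tau>"
  shows "period (singular_face 2 0 \<tau>) - period (singular_face 2 1 \<tau>) + period (singular_face 2 2 \<tau>) = 0"
proof -
  define q where "q = (\<lambda>z. \<tau> (triangle_point z))"
  have q: "\<tau> (triangle_point z) = q z" for z by (simp add: q_def)
  have "continuous_on UNIV q"
    unfolding q_def using assms triangle_in_simplex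
    by (intro continuous_on_compose2[OF _ continuous_triangle]) (auto simp: singular_simplex_euclidean)
  then obtain h where h: "primitive ({0..1} \<times> {0..1}) q h"
    using primitive_rectangle[of q 0 1 0 1] by auto
  have side: "variation (\<lambda>t. q (c t)) = h (c 1) - h (c 0)"
    if "continuous_on {0..1} c" "c ` {0..1} \<subseteq> {0..1} \<times> {0..1}" for c
    using variation_eq[OF primitive_compose[OF h that]] .
  have "period (singular_face 2 0 \<tau>) = h (1, 1) - h (1, 0)"
    unfolding period_def face_edge simplical_face_edge q
    by (rule side[of "\<lambda>t. (1, t)"]) (auto intro!: continuous_intros)
  moreover have "period (singular_face 2 1 \<tau>) = h (1, 1) - h (0, 1)"
    unfolding period_def face_edge simplical_face_edge q
    by (rule side[of "\<lambda>t. (t, 1)"]) (auto intro!: continuous_intros)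
  moreover have "period (singular_face 2 2 \<tau>) = h (1, 0) - h (0, 0)"
    unfolding period_def face_edge simplical_face_edge q
    by (rule side[of "\<lambda>t. (t, 0)"]) (auto intro!: continuous_intros)
  moreover have "h (0, 1) - h (0, 0) = 0"
  proof -
    have "triangle_point (0, t) = edge_point 0" for t
      by (rule ext) (auto simp: triangle_point_def edge_point_def clip_eq)
    then have "(\<lambda>t. q (0, t)) = (\<lambda>t. \<tau> (edge_point 0))" by (simp add: q_def)
    then have "variation (\<lambda>t. q (0, t)) = 0" by (simp only: variation_const)
    moreover have "variation (\<lambda>t. q (0, t)) = h (0, 1) - h (0, 0)"
      by (rule side[of "\<lambda>t. (0, t)"]) (auto intro!: continuous_intros)
    ultimately show ?thesis by simp
  qed
  ultimately show ?thesis by linarith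
qed

section \<open>Evaluation of the closed form on integral chains\<close>

definition evaluate :: "'m chain \<Rightarrow> real" where
  "evaluate c = (\<Sum>\<sigma>\<in>Poly_Mapping.keys c. of_int (Poly_Mapping.lookup c \<sigma>) * period \<sigma>)"

lemma evaluate_superset:
  assumes "finite S" "Poly_Mapping.keys c \<subseteq> S"
  shows "evaluate c = (\<Sum>\<sigma>\<in>S. of_int (Poly_Mapping.lookup c \<sigma>) * period \<sigma>)"
  unfolding evaluate_def using assms by (intro sum.mono_neutral_left) (auto simp: in_keys_iff)

lemma evaluate_frag_of [simp]: "evaluate (frag_of \<sigma>) = period \<sigma>"
  by (simp add: evaluate_def)

lemma evaluate_zero [simp]: "evaluate 0 = 0"
  by (simp add: evaluate_def)

lemma evaluate_diff: "evaluate (a - b) = evaluate a - evaluate b"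
proof -
  have k: "Poly_Mapping.keys (a - b) \<subseteq> Poly_Mapping.keys a \<union> Poly_Mapping.keys b" by (rule keys_diff)
  show ?thesis
    by (subst (1 2 3) evaluate_superset[of "Poly_Mapping.keys a \<union> Poly_Mapping.keys b"])
      (use k in \<open>auto simp: lookup_minus sum_subtractf algebra_simps\<close>)
qed

lemma evaluate_add: "evaluate (a + b) = evaluate a + evaluate b"
  using evaluate_diff[of "a + b" b] by simp

lemma evaluate_cmul: "evaluate (frag_cmul n c) = of_int n * evaluate c"
proof -
  have "evaluate (frag_cmul n c) =
      (\<Sum>\<sigma>\<in>Poly_Mapping.keys c. of_int (Poly_Mapping.lookup (frag_cmul n c) \<sigma>) * period \<sigma>)"
    by (rule evaluate_superset) (auto simp: keys_cmul)
  then show ?thesis by (simp add: evaluate_def sum_distrib_left mult.assoc)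
qed

text \<open>Stokes' theorem in this setting: by additivity only a single 2-simplex matters.\<close>

lemma evaluate_boundary:
  assumes "singular_relboundary 1 euclidean {} c"
  shows "evaluate c = 0"
proof -
  obtain d where d: "singular_chain 2 euclidean d" "chain_boundary 2 d = c"
    using assms by (auto simp: singular_boundary numeral_2_eq_2)
  have "evaluate (chain_boundary 2 d) = 0"
    using d(1) unfolding singular_chain_def
  proof (induction rule: frag_induction)
    case (one \<tau>)
    have "chain_boundary 2 (frag_of \<tau>) = frag_of (singular_face 2 0 \<tau>)
        + frag_cmul (-1) (frag_of (singular_face 2 1 \<tau>)) + frag_of (singular_face 2 2 \<tau>)"
      by (simp add: chain_boundary_of numeral_2_eq_2)
    then show ?case using period_boundary[of \<tau>] one
      by (simp only: evaluate_add evaluate_cmul evaluate_frag_of) auto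
  qed (simp_all add: chain_boundary_diff evaluate_diff)
  then show ?thesis using d by simp
qed

end

text \<open>With rank zero even the singleton of a homology class is dependent, which means that a
  nonzero multiple of the class vanishes.\<close>

lemma betti_number_zero_torsion:
  assumes "betti_number 1 X = 0" "singular_relcycle 1 X {} z"
  shows "\<exists>n. n \<noteq> 0 \<and> singular_relboundary 1 X {} (frag_cmul n z)"
proof -
  define H where "H = homology_group 1 X"
  define C where "C = relcycle_group 1 X {}"
  define h where "h = (\<lambda>c. homologous_rel_set 1 X {} c)"
  have H_eq: "H = homology_group (int 1) X" by (simp add: H_def)
  have h: "h \<in> hom C H"
    using normal.r_coset_hom_Mod[OF normal_subgroup_singular_relboundary_relcycle, of 1 X "{}"]
    unfolding H_def C_def h_def right_coset_singular_relboundary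
    by (simp add: relative_homology_group_def)
  have zC: "z \<in> carrier C" using assms(2) by (simp add: C_def)
  have hz: "h z \<in> carrier H" using h zC by (auto simp: hom_def)
  have "\<not> int_independent H {h z}"
  proof
    assume "int_independent H {h z}"
    then have "enat (card {h z}) \<le> abelian_rank H"
      unfolding abelian_rank_def by (intro SUP_upper) simp
    then show False using assms(1) by (simp add: betti_number_def H_def zero_enat_def)
  qed
  then obtain n where n: "finprod H (\<lambda>s. s [^]\<^bsub>H\<^esub> n s) {h z} = \<one>\<^bsub>H\<^esub>" "n (h z) \<noteq> (0::int)"
    using hz by (auto simp: int_independent_def)
  interpret H: comm_group H by (simp add: H_def)
  have "finprod H (\<lambda>s. s [^]\<^bsub>H\<^esub> n s) {h z} = h z [^]\<^bsub>H\<^esub> n (h z)"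
    using hz by simp
  also have "\<dots> = h (z [^]\<^bsub>C\<^esub> n (h z))"
    by (rule hom_int_pow[OF h zC, symmetric]) (simp_all add: C_def H.is_group)
  \<comment> \<open>Powers in the group of cycles are those of the chain group, which is free
    abelian, so they are multiples of chains.\<close>
  also have "z [^]\<^bsub>C\<^esub> n (h z) = frag_cmul (n (h z)) z"
  proof -
    have "z [^]\<^bsub>C\<^esub> n (h z) = z [^]\<^bsub>chain_group 1 X\<^esub> n (h z)"
      using group.int_pow_subgroup_generated[OF group_chain_group] zC
      unfolding C_def relcycle_group_def by blast
    also have "\<dots> = frag_cmul (n (h z)) z"
      unfolding chain_group_def using assms(2)
      by (intro int_pow_free_Abelian_group) (auto simp: singular_relcycle singular_chain_def)
    finally show ?thesis .
  qed
  finally have "homologous_rel_set 1 X {} (frag_cmul (n (h z)) z) = singular_relboundary_set 1 X {}"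
    using n(1) unfolding H_eq one_relative_homology_group h_def by simp
  then show ?thesis using n(2) homologous_rel_set_eq_relboundary by blast
qed

text \<open>The coordinate of vertex 1 serves as time; \<open>restrict\<close> is there because
  singular simplices are extensional.\<close>

definition path_simplex :: "(real \<Rightarrow> 'a) \<Rightarrow> (nat \<Rightarrow> real) \<Rightarrow> 'a" where
  "path_simplex \<gamma> = restrict (\<lambda>v. \<gamma> (v 1)) (standard_simplex 1)"

lemma path_simplex_edge: "path_simplex \<gamma> (edge_point t) = \<gamma> (clip t)"
  using edge_in_simplex[of t] by (simp add: path_simplex_def edge_point_def)

lemma singular_simplex_path_simplex:
  assumes "path \<gamma>" shows "singular_simplex 1 euclidean (path_simplex \<gamma>)"
proof -
  have "continuous_on (standard_simplex 1) (\<lambda>v::nat \<Rightarrow> real. v 1)"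
    by (rule continuous_on_subset[OF continuous_on_product_coordinates]) simp
  then have "continuous_on (standard_simplex 1) (\<lambda>v. \<gamma> (v 1))"
    using assms unfolding path_def
    by (elim continuous_on_compose2) (auto simp: standard_simplex_def)
  then show ?thesis by (auto simp: singular_simplex_euclidean path_simplex_def cong: continuous_on_cong)
qed

lemma chain_boundary_path_simplex:
  "chain_boundary 1 (frag_of (path_simplex \<gamma>)) =
     frag_of (restrict (\<lambda>_. \<gamma> 1) (standard_simplex 0)) - frag_of (restrict (\<lambda>_. \<gamma> 0) (standard_simplex 0))"
proof -
  have "(\<lambda>j::nat. if j = 0 then 1 else 0 :: real) = edge_point 0" by (auto simp: edge_point_def clip_def)
  moreover have f: "simplical_face 0 (edge_point 0) = edge_point 1" "simplical_face (Suc 0) (edge_point 0) = edge_point 0"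
    by (auto simp: simplical_face_def edge_point_def clip_def fun_eq_iff)
  ultimately have "singular_face 1 0 (path_simplex \<gamma>) = restrict (\<lambda>_. \<gamma> 1) (standard_simplex 0)"
    "singular_face 1 1 (path_simplex \<gamma>) = restrict (\<lambda>_. \<gamma> 0) (standard_simplex 0)"
    by (auto simp: singular_face_def standard_simplex_0 path_simplex_edge clip_def f intro!: restrict_ext)
  then show ?thesis by (simp add: chain_boundary_of)
qed

text \<open>Since evaluation vanishes on cycles, the period of a path depends on its endpoints only.
  So \<open>f x\<close> can be the period of any chosen path from a base point to \<open>x\<close>,
  and the choice may be discontinuous in \<open>x\<close>.\<close>

theorem (in local_potentials) global_potential:
  assumes lpc: "\<And>(U :: 'm set) x. open U \<Longrightarrow> x \<in> U \<Longrightarrow> \<exists>W. open W \<and> path_connected W \<and> x \<in> W \<and> W \<subseteq> U"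
    and "connected (UNIV :: 'm set)" and betti: "betti_number 1 (euclidean :: 'm topology) = 0"
  obtains f where "\<And>U F x. (U, F) \<in> P \<Longrightarrow> x \<in> U \<Longrightarrow>
    \<exists>W. open W \<and> x \<in> W \<and> W \<subseteq> U \<and> (\<forall>y\<in>W. f y - f x = F y - F x)"
proof -
  have cycle: "evaluate c = 0" if "singular_relcycle 1 euclidean {} c" for c
  proof -
    obtain n where "n \<noteq> 0" "singular_relboundary 1 euclidean {} (frag_cmul n c)"
      using betti_number_zero_torsion[OF betti \<open>singular_relcycle 1 euclidean {} c\<close>] by blast
    then show ?thesis using evaluate_boundary[of "frag_cmul n c"] by (simp add: evaluate_cmul)
  qed
  have "locally path_connected (UNIV :: 'm set)"
  proof (rule locally_path_connected_1)
    fix v :: "'m set" and x assume "openin (top_of_set UNIV) v" "x \<in> v"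
    then have "open v" by simp
    from lpc[OF this \<open>x \<in> v\<close>] show "\<exists>u. openin (top_of_set UNIV) u \<and> path_connected u \<and> x \<in> u \<and> u \<subseteq> v"
      by simp
  qed
  then have "path_connected (UNIV :: 'm set)"
    using assms(2)
    by (simp add: path_connected_component path_component_eq_connected_component connected_iff_connected_component)
  \<comment> \<open>\<open>undefined\<close> is merely some point of the type, used as base
    point.\<close>
  then have "\<forall>x. \<exists>\<gamma>. path \<gamma> \<and> pathstart \<gamma> = (undefined :: 'm) \<and> pathfinish \<gamma> = x"
    by (auto simp: path_connected_def)
  from choice[OF this] obtain p :: "'m \<Rightarrow> real \<Rightarrow> 'm"
    where p: "\<And>x. path (p x)" "\<And>x. pathstart (p x) = undefined" "\<And>x. pathfinish (p x) = x"
    by auto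
  define f where "f = (\<lambda>x. period (path_simplex (p x)))"
  show ?thesis
  proof (rule that[of f])
    fix U F x assume UF: "(U, F) \<in> P" "x \<in> U"
    obtain W where W: "open W" "path_connected W" "x \<in> W" "W \<subseteq> U"
      using lpc[OF open_dom[OF UF(1)] UF(2)] by blast
    have "f y - f x = F y - F x" if "y \<in> W" for y
    proof -
      obtain \<gamma> where \<gamma>: "path \<gamma>" "path_image \<gamma> \<subseteq> W" "pathstart \<gamma> = x" "pathfinish \<gamma> = y"
        using W(2,3) \<open>y \<in> W\<close> unfolding path_connected_def by blast
      \<comment> \<open>The chosen path to \<open>x\<close>, a path from \<open>x\<close> to
        \<open>y\<close> inside \<open>W\<close>, and the chosen path to \<open>y\<close> taken
        backwards form a cycle.\<close>
      let ?c = "frag_of (path_simplex (p x)) + frag_of (path_simplex \<gamma>) - frag_of (path_simplex (p y))"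
      have "singular_chain 1 euclidean ?c"
        by (intro singular_chain_add singular_chain_diff)
          (simp_all add: singular_chain_of singular_simplex_path_simplex p(1) \<gamma>(1) del: One_nat_def)
      moreover have "chain_boundary 1 ?c = 0"
        using p(2,3) \<gamma>(3,4) unfolding pathstart_def pathfinish_def
        by (simp add: chain_boundary_add chain_boundary_diff chain_boundary_path_simplex del: One_nat_def)
      ultimately have "singular_relcycle 1 euclidean {} ?c" by (simp add: singular_cycle)
      from cycle[OF this] have "f x + period (path_simplex \<gamma>) - f y = 0"
        by (simp add: evaluate_add evaluate_diff f_def)
      moreover have "period (path_simplex \<gamma>) = F y - F x"
      proof -
        have "primitive {0..1} (\<lambda>t. \<gamma> (clip t)) (\<lambda>t. F (\<gamma> (clip t)))"
        proof (rule primitive_dom[OF _ UF(1)])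
          show "continuous_on UNIV (\<lambda>t. \<gamma> (clip t))"
            using \<gamma>(1) clip_bounds unfolding path_def
            by (intro continuous_on_compose2[where f = clip and g = \<gamma>]) (auto intro: continuous_intros)
          show "(\<lambda>t. \<gamma> (clip t)) ` {0..1} \<subseteq> U"
            using \<gamma>(2) W(4) clip_bounds unfolding path_image_def by fastforce
        qed
        from variation_eq[OF this] show ?thesis
          using \<gamma>(3,4) by (simp add: period_def path_simplex_edge clip_eq pathstart_def pathfinish_def)
      qed
      ultimately show ?thesis by simp
    qed
    then show "\<exists>W. open W \<and> x \<in> W \<and> W \<subseteq> U \<and> (\<forall>y\<in>W. f y - f x = F y - F x)"
      using W by (intro exI[of _ W] conjI ballI)
  qed
qed

section \<open>Charts of a manifold\<close>

lemma chart_at_euclid_atlas [simp]: "chart_at euclid_atlas x = (UNIV, id)"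
  unfolding chart_at_def euclid_atlas_def by (rule some_equality) auto

lemma chart_inv_UNIV_id [simp]: "chart_inv (UNIV, id) = id"
  by (simp add: chart_inv_def inv_id[unfolded id_def] id_def)

locale atlas =
  fixes A :: "('m::topological_space, 'e::euclidean_space) chart set"
  assumes smooth_atlas: "smooth_atlas A"
begin

lemma open_chart: "c \<in> A \<Longrightarrow> open (fst c)"
  and open_chart_image: "c \<in> A \<Longrightarrow> open (chart_image c)"
  and chart_homeomorphism: "c \<in> A \<Longrightarrow> homeomorphism (fst c) (chart_image c) (snd c) (chart_inv c)"
  and transition_smooth: "c \<in> A \<Longrightarrow> d \<in> A \<Longrightarrow> smooth_on (snd c ` (fst c \<inter> fst d)) (snd d \<circ> chart_inv c)"
  using smooth_atlas unfolding smooth_atlas_def by auto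

lemma chart_at: "chart_at A x \<in> A" "x \<in> fst (chart_at A x)"
proof -
  have "\<exists>c. c \<in> A \<and> x \<in> fst c" using smooth_atlas unfolding smooth_atlas_def by blast
  then have "chart_at A x \<in> A \<and> x \<in> fst (chart_at A x)" unfolding chart_at_def by (rule someI_ex)
  then show "chart_at A x \<in> A" "x \<in> fst (chart_at A x)" by auto
qed

lemma chart_inv_chart [simp]: "c \<in> A \<Longrightarrow> x \<in> fst c \<Longrightarrow> chart_inv c (snd c x) = x"
  using chart_homeomorphism by (auto simp: homeomorphism_def)

lemma chart_chart_inv [simp]: "c \<in> A \<Longrightarrow> y \<in> chart_image c \<Longrightarrow> snd c (chart_inv c y) = y"
  using chart_homeomorphism by (auto simp: homeomorphism_def)

lemma chart_inv_in: "c \<in> A \<Longrightarrow> y \<in> chart_image c \<Longrightarrow> chart_inv c y \<in> fst c"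
  using homeomorphism_image2[OF chart_homeomorphism] by blast

lemma chart_in_image: "x \<in> fst c \<Longrightarrow> snd c x \<in> chart_image c"
  by (auto simp: chart_image_def)

lemma continuous_chart_inv: "c \<in> A \<Longrightarrow> continuous_on (chart_image c) (chart_inv c)"
  using homeomorphism_cont2[OF chart_homeomorphism] .

lemma continuous_chart: "c \<in> A \<Longrightarrow> continuous_on (fst c) (snd c)"
  using homeomorphism_cont1[OF chart_homeomorphism] .

lemma open_chart_preimage: "c \<in> A \<Longrightarrow> open W \<Longrightarrow> open {y \<in> chart_image c. chart_inv c y \<in> W}"
  using continuous_open_preimage[OF continuous_chart_inv open_chart_image]
  by (simp add: vimage_def Int_def)

lemma open_chart_vimage: "c \<in> A \<Longrightarrow> open B \<Longrightarrow> open {x \<in> fst c. snd c x \<in> B}"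
  using continuous_open_preimage[OF continuous_chart open_chart]
  by (simp add: vimage_def Int_def)

section \<open>Transition maps and changes of coordinates\<close>

definition overlap :: "('m, 'e) chart \<Rightarrow> ('m, 'e) chart \<Rightarrow> 'e set" where
  "overlap c d = {y \<in> chart_image c. chart_inv c y \<in> fst d}"

lemma open_overlap: "c \<in> A \<Longrightarrow> d \<in> A \<Longrightarrow> open (overlap c d)"
  unfolding overlap_def by (intro open_chart_preimage open_chart)

definition jac :: "('m, 'e) chart \<Rightarrow> ('m, 'e) chart \<Rightarrow> 'e \<Rightarrow> 'e \<Rightarrow> 'e" where
  "jac c d y = frechet_derivative (snd d \<circ> chart_inv c) (at y)"

lemma transition_has_derivative:
  assumes "c \<in> A" "d \<in> A" "y \<in> overlap c d"
  shows "((\<lambda>y. snd d (chart_inv c y)) has_derivative jac c d y) (at y)"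
proof -
  have "y \<in> snd c ` (fst c \<inter> fst d)"
    using assms chart_inv_in[of c y] by (auto simp: overlap_def image_iff intro!: bexI[of _ "chart_inv c y"])
  from smooth_on_has_derivative[OF transition_smooth[OF assms(1,2)] this]
  show ?thesis by (simp add: jac_def o_def)
qed

lemma transition_in_overlap:
  assumes "c \<in> A" "d \<in> A" "y \<in> overlap c d"
  shows "snd d (chart_inv c y) \<in> overlap d c" "chart_inv d (snd d (chart_inv c y)) = chart_inv c y"
  using assms chart_inv_in[of c y] by (auto simp: overlap_def chart_in_image)

lemma linear_jac: "c \<in> A \<Longrightarrow> d \<in> A \<Longrightarrow> y \<in> overlap c d \<Longrightarrow> linear (jac c d y)"
  using transition_has_derivative has_derivative_linear by blast

lemma jac_jac:
  assumes "c \<in> A" "d \<in> A" "e \<in> A" "y \<in> overlap c d" "chart_inv c y \<in> fst e"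
  shows "jac d e (snd d (chart_inv c y)) (jac c d y u) = jac c e y u"
proof -
  let ?S = "overlap c d"
  have e: "y \<in> overlap c e" "snd d (chart_inv c y) \<in> overlap d e"
    using assms transition_in_overlap[OF assms(1,2,4)] by (auto simp: overlap_def)
  have 1: "((\<lambda>y. snd e (chart_inv d (snd d (chart_inv c y)))) has_derivative
      (\<lambda>u. jac d e (snd d (chart_inv c y)) (jac c d y u))) (at y)"
    by (rule has_derivative_compose[OF transition_has_derivative[OF assms(1,2,4)]
          transition_has_derivative[OF assms(2,3) e(2)]])
  have 2: "snd e (chart_inv d (snd d (chart_inv c y))) = snd e (chart_inv c y)" if "y \<in> ?S" for y
    using transition_in_overlap(2)[OF assms(1,2) that] by simp
  have "((\<lambda>y. snd e (chart_inv c y)) has_derivative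
      (\<lambda>u. jac d e (snd d (chart_inv c y)) (jac c d y u))) (at y)"
    by (rule has_derivative_transform_within_open[OF 1 open_overlap[OF assms(1,2)] assms(4) 2])
  from has_derivative_unique[OF this transition_has_derivative[OF assms(1,3) e(1)]]
  show ?thesis by (rule fun_cong)
qed

lemma jac_self:
  assumes "c \<in> A" "y \<in> chart_image c" shows "jac c c y u = u"
proof -
  have y: "y \<in> overlap c c" using assms chart_inv_in by (auto simp: overlap_def)
  have "((\<lambda>y. snd c (chart_inv c y)) has_derivative (\<lambda>u. u)) (at y)"
    by (rule has_derivative_transform_within_open[OF has_derivative_ident open_chart_image[OF assms(1)] assms(2)])
      (simp add: assms(1))
  from has_derivative_unique[OF this transition_has_derivative[OF assms(1,1) y]] show ?thesis
    by (metis)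
qed

lemma coord_vec_jac: "coord_vec A c y = jac c (chart_at A (chart_inv c y)) y"
  by (simp add: coord_vec_def[abs_def] differential_def jac_def)

definition to_coord :: "('m, 'e) chart \<Rightarrow> 'e \<Rightarrow> 'e \<Rightarrow> 'e" where
  "to_coord c y = differential A euclid_atlas (snd c) (chart_inv c y)"

lemma to_coord_jac:
  "to_coord c y = jac (chart_at A (chart_inv c y)) c (snd (chart_at A (chart_inv c y)) (chart_inv c y))"
  by (simp add: to_coord_def[abs_def] differential_def[abs_def] jac_def)

context
  fixes c y assumes c: "c \<in> A" and y: "y \<in> chart_image c"
begin

lemma in_overlap_chart_at: "y \<in> overlap c (chart_at A (chart_inv c y))"
  using y chart_at by (simp add: overlap_def)

lemma linear_coord_vec: "linear (coord_vec A c y)"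
  unfolding coord_vec_jac by (rule linear_jac[OF c chart_at(1) in_overlap_chart_at])

lemma linear_to_coord: "linear (to_coord c y)"
  unfolding to_coord_jac
  by (rule linear_jac[OF chart_at(1) c transition_in_overlap(1)[OF c chart_at(1) in_overlap_chart_at]])

lemma to_coord_coord_vec [simp]: "to_coord c y (coord_vec A c y u) = u"
  unfolding to_coord_jac coord_vec_jac
  using jac_jac[OF c chart_at(1) c in_overlap_chart_at chart_inv_in[OF c y]] jac_self[OF c y] by simp

text \<open>In finite dimension a left inverse of an endomorphism is also a right inverse.\<close>

lemma coord_vec_to_coord [simp]: "coord_vec A c y (to_coord c y w) = w"
proof -
  have "surj (coord_vec A c y)"
  proof (rule linear_injective_imp_surjective[OF linear_coord_vec])
    show "inj (coord_vec A c y)" by (metis injI to_coord_coord_vec)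
  qed simp
  then obtain u where "w = coord_vec A c y u" by (metis surjD)
  then show ?thesis by simp
qed

lemma coord_vec_field_in: "coord_vec A c y (field_in A V c y) = V (chart_inv c y)"
  unfolding field_in_def to_coord_def[symmetric] by simp

lemma endo_in_eq: "endo_in A J c y u = to_coord c y (J (chart_inv c y) (coord_vec A c y u))"
  by (simp add: endo_in_def to_coord_def)

lemma coord_vec_endo_in: "coord_vec A c y (endo_in A J c y u) = J (chart_inv c y) (coord_vec A c y u)"
  by (simp add: endo_in_eq)

lemma coord_vec_eq_0_iff: "coord_vec A c y u = 0 \<longleftrightarrow> u = 0"
  by (metis linear_0 linear_coord_vec to_coord_coord_vec linear_to_coord)

lemma coord_vec_transition:
  assumes d: "d \<in> A" and "chart_inv c y \<in> fst d"
  shows "coord_vec A d (snd d (chart_inv c y)) (jac c d y u) = coord_vec A c y u"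
proof -
  have o: "y \<in> overlap c d" using y assms by (simp add: overlap_def)
  show ?thesis
    unfolding coord_vec_jac transition_in_overlap(2)[OF c d o]
    by (rule jac_jac[OF c d chart_at(1) o chart_at(2)])
qed

text \<open>\<open>differential\<close> is defined with the charts chosen at \<open>x\<close> and at
  \<open>F x\<close>. Two changes of coordinates bring in arbitrary charts \<open>c\<close> and
  \<open>e\<close>, which can be kept fixed while the point moves.\<close>

lemma differential_map_coord_vec:
  assumes e: "e \<in> A" and N: "open N" "y \<in> N" "N \<subseteq> chart_image c"
    and into: "\<And>z. z \<in> N \<Longrightarrow> F (chart_inv c z) \<in> fst e"
    and F: "((\<lambda>z. snd e (F (chart_inv c z))) has_derivative F') (at y)"
  shows "differential A A F (chart_inv c y) (coord_vec A c y u) =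
    coord_vec A e (snd e (F (chart_inv c y))) (F' u)"
proof -
  let ?x = "chart_inv c y" let ?d = "chart_at A ?x" let ?f = "chart_at A (F ?x)"
  let ?q = "snd ?d ?x" let ?p = "snd e (F ?x)"
  have d: "?d \<in> A" and f: "?f \<in> A" by (rule chart_at)+
  have q: "?q \<in> overlap ?d c" by (rule transition_in_overlap(1)[OF c d in_overlap_chart_at])
  have Fx: "F ?x \<in> fst e" using into N(2) by blast
  have invp: "chart_inv e ?p = F ?x" by (simp add: e Fx)
  have p: "?p \<in> overlap e ?f" using Fx chart_at by (simp add: overlap_def chart_in_image e)
  have invq: "chart_inv ?d ?q = ?x" by (simp add: d chart_at)
  have qy: "snd c (chart_inv ?d ?q) = y" by (simp only: invq chart_chart_inv[OF c y])
  have T: "((\<lambda>z. snd c (chart_inv ?d z)) has_derivative jac ?d c ?q) (at ?q)"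
    by (rule transition_has_derivative[OF d c q])
  have 1: "((\<lambda>z. snd e (F (chart_inv c (snd c (chart_inv ?d z))))) has_derivative
      (\<lambda>u. F' (jac ?d c ?q u))) (at ?q)"
    by (rule has_derivative_compose[OF T]) (simp only: qy F)
  have 2: "((\<lambda>z. snd ?f (chart_inv e (snd e (F (chart_inv c (snd c (chart_inv ?d z))))))) has_derivative
      (\<lambda>u. jac e ?f ?p (F' (jac ?d c ?q u)))) (at ?q)"
    by (rule has_derivative_compose[OF 1]) (simp only: qy transition_has_derivative[OF e f p])
  \<comment> \<open>On this open set the expression routed through \<open>c\<close> and
    \<open>e\<close> agrees with the one that defines the differential.\<close>
  define S where "S = overlap ?d c \<inter> (\<lambda>z. snd c (chart_inv ?d z)) -` N"
  have S: "open S"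
    unfolding S_def
  proof (rule continuous_open_preimage[OF _ open_overlap[OF d c] N(1)])
    show "continuous_on (overlap ?d c) (\<lambda>z. snd c (chart_inv ?d z))"
      by (rule has_derivative_continuous_on[where f' = "\<lambda>z. jac ?d c z"])
        (rule has_derivative_at_withinI[OF transition_has_derivative[OF d c]])
  qed
  have qS: "?q \<in> S" using q qy N(2) by (simp add: S_def)
  have 3: "snd ?f (chart_inv e (snd e (F (chart_inv c (snd c (chart_inv ?d z)))))) =
      snd ?f (F (chart_inv ?d z))" if "z \<in> S" for z
  proof -
    have z: "z \<in> overlap ?d c" "snd c (chart_inv ?d z) \<in> N" using that by (auto simp: S_def)
    from into[OF z(2)] show ?thesis by (simp add: transition_in_overlap(2)[OF d c z(1)] e)
  qed
  have "((\<lambda>z. snd ?f (F (chart_inv ?d z))) has_derivative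
      (\<lambda>u. jac e ?f ?p (F' (jac ?d c ?q u)))) (at ?q)"
    by (rule has_derivative_transform_within_open[OF 2 S qS 3])
  from frechet_derivative_eqI[OF this]
  have "differential A A F ?x w = jac e ?f ?p (F' (jac ?d c ?q w))" for w
    by (simp add: differential_def o_def)
  moreover have "jac ?d c ?q (coord_vec A c y u) = u"
    using to_coord_coord_vec by (simp add: to_coord_jac)
  moreover have "coord_vec A e ?p = jac e ?f ?p"
    by (simp add: coord_vec_jac invp)
  ultimately show ?thesis by simp
qed

lemma differential_fun_coord_vec:
  fixes f :: "'m \<Rightarrow> real"
  assumes f: "((\<lambda>z. f (chart_inv c z)) has_derivative f') (at y)"
  shows "differential A euclid_atlas f (chart_inv c y) (coord_vec A c y u) = f' u"
proof -
  let ?x = "chart_inv c y" let ?d = "chart_at A ?x" let ?q = "snd ?d ?x"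
  have d: "?d \<in> A" by (rule chart_at)
  have q: "?q \<in> overlap ?d c" by (rule transition_in_overlap(1)[OF c d in_overlap_chart_at])
  have invq: "chart_inv ?d ?q = ?x" by (simp add: d chart_at)
  have qy: "snd c (chart_inv ?d ?q) = y" by (simp only: invq chart_chart_inv[OF c y])
  have 1: "((\<lambda>z. f (chart_inv c (snd c (chart_inv ?d z)))) has_derivative (\<lambda>u. f' (jac ?d c ?q u))) (at ?q)"
    by (rule has_derivative_compose[OF transition_has_derivative[OF d c q]]) (simp only: qy f)
  have 2: "f (chart_inv c (snd c (chart_inv ?d z))) = f (chart_inv ?d z)" if "z \<in> overlap ?d c" for z
    using transition_in_overlap(2)[OF d c that] by simp
  have "((\<lambda>z. f (chart_inv ?d z)) has_derivative (\<lambda>u. f' (jac ?d c ?q u))) (at ?q)"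
    by (rule has_derivative_transform_within_open[OF 1 open_overlap[OF d c] q 2])
  from frechet_derivative_eqI[OF this]
  have "differential A euclid_atlas f ?x w = f' (jac ?d c ?q w)" for w
    by (simp add: differential_def o_def)
  moreover have "jac ?d c ?q (coord_vec A c y u) = u"
    using to_coord_coord_vec by (simp add: to_coord_jac)
  ultimately show ?thesis by simp
qed

end

end

section \<open>Lie derivatives along a local flow\<close>

context atlas
begin

text \<open>The local flow seen in the single chart \<open>c\<close>. The velocity is recorded at
  time zero only, in the form that \<open>flow_derivative\<close> asks for.\<close>

definition flow_box ::
  "('m, 'e) chart \<Rightarrow> ('m \<Rightarrow> 'e) \<Rightarrow> real \<Rightarrow> 'm set \<Rightarrow> (real \<Rightarrow> 'm \<Rightarrow> 'm) \<Rightarrow> (real \<times> 'e) set \<Rightarrow>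
    (real \<times> 'e \<Rightarrow> 'e) \<Rightarrow> bool" where
  "flow_box c V \<epsilon> W \<theta> N \<Theta> \<longleftrightarrow>
     \<Theta> = (\<lambda>z. snd c (\<theta> (fst z) (chart_inv c (snd z)))) \<and> open N \<and> smooth_on N \<Theta> \<and>
     (\<forall>t z. (t, z) \<in> N \<longrightarrow>
        t \<in> {-\<epsilon><..<\<epsilon>} \<and> z \<in> chart_image c \<and> chart_inv c z \<in> W \<and> \<theta> t (chart_inv c z) \<in> fst c) \<and>
     (\<forall>z. (0, z) \<in> N \<longrightarrow> \<Theta> (0, z) = z \<and> frechet_derivative \<Theta> (at (0, z)) (1, 0) = field_in A V c z)"

text \<open>Two translations are needed: \<open>local_flow\<close> states smoothness in charts of
  the cylinder, and the velocity in the chart chosen at the moving point.\<close>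

lemma flow_box_exists:
  assumes c: "c \<in> A" and y: "y \<in> chart_image c" and flow: "local_flow A V \<epsilon> W \<theta>"
    and W: "chart_inv c y \<in> W"
  shows "\<exists>N \<Theta>. flow_box c V \<epsilon> W \<theta> N \<Theta> \<and> (0, y) \<in> N"
proof -
  define \<Theta> where "\<Theta> = (\<lambda>z. snd c (\<theta> (fst z) (chart_inv c (snd z))))"
  define C :: "(real \<times> 'm, real \<times> 'e) chart" where "C = (UNIV \<times> fst c, map_prod id (snd c))"
  let ?F = "\<lambda>(t, x). \<theta> t x" let ?I = "{-\<epsilon><..<\<epsilon>}"
  have C: "C \<in> cylinder_atlas A" using c by (force simp: C_def cylinder_atlas_def image_iff split_beta)
  \<comment> \<open>\<open>chart_inv\<close> is an \<open>inv_into\<close>, so the inverse of the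
    product chart has to be computed.\<close>
  have Cinv: "chart_inv C (t, z) = (t, chart_inv c z)" if "z \<in> chart_image c" for t z
    unfolding chart_inv_def[of C]
  proof (rule inv_into_f_eq)
    have "inj_on (snd c) (fst c)" using chart_inv_chart[OF c] by (rule inj_on_inverseI)
    then show "inj_on (snd C) (fst C)" by (auto simp: C_def inj_on_def)
  qed (use that c chart_inv_in[OF c that] in \<open>auto simp: C_def\<close>)
  have \<epsilon>: "0 < \<epsilon>" and smooth: "smooth_map_on (cylinder_atlas A) A (?I \<times> W) ?F"
    and init: "\<And>x. x \<in> W \<Longrightarrow> \<theta> 0 x = x"
    and vel: "\<forall>t\<in>?I. \<forall>x\<in>W.
      ((\<lambda>s. snd (chart_at A (\<theta> t x)) (\<theta> s x)) has_vector_derivative V (\<theta> t x)) (at t)"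
    using flow unfolding local_flow_def by auto
  have velocity: "((\<lambda>s. snd (chart_at A (\<theta> 0 x)) (\<theta> s x)) has_vector_derivative V (\<theta> 0 x)) (at 0)"
    if "x \<in> W" for x
  proof -
    have "0 \<in> ?I" using \<epsilon> by simp
    from vel[rule_format, OF this that] show ?thesis .
  qed
  have "(0, chart_inv c y) \<in> ?I \<times> W" "(0, chart_inv c y) \<in> fst C" "?F (0, chart_inv c y) \<in> fst c"
    using \<epsilon> W chart_inv_in[OF c y] init[OF W] by (auto simp: C_def)
  with smooth C c obtain N where N: "open N" "snd C (0, chart_inv c y) \<in> N"
      "N \<subseteq> snd C ` (fst C \<inter> (?I \<times> W))" "(?F \<circ> chart_inv C) ` N \<subseteq> fst c"
      "smooth_on N (snd c \<circ> ?F \<circ> chart_inv C)"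
    unfolding smooth_map_on_def by meson
  have N1: "t \<in> ?I \<and> z \<in> chart_image c \<and> chart_inv c z \<in> W \<and> \<theta> t (chart_inv c z) \<in> fst c" if "(t, z) \<in> N" for t z
  proof -
    have "(t, z) \<in> snd C ` (fst C \<inter> (?I \<times> W))" using N(3) that by blast
    then obtain x where x: "x \<in> fst c" "x \<in> W" "t \<in> ?I" "z = snd c x"
      by (auto simp: C_def)
    then have z: "z \<in> chart_image c" "chart_inv c z = x" using c by (auto simp: chart_in_image)
    moreover have "(?F \<circ> chart_inv C) (t, z) \<in> fst c" using N(4) that by blast
    ultimately show ?thesis using x Cinv[OF z(1)] by simp
  qed
  have N0: "(0, y) \<in> N" using N(2) c y by (simp add: C_def)
  have smooth\<Theta>: "smooth_on N \<Theta>"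
  proof (rule smooth_on_cong[OF N(1), THEN iffD1, OF _ N(5)])
    fix z assume "z \<in> N"
    then show "(snd c \<circ> ?F \<circ> chart_inv C) z = \<Theta> z"
      using N1[of "fst z" "snd z"] Cinv[of "snd z" "fst z"] by (simp add: \<Theta>_def)
  qed
  have init\<Theta>: "\<Theta> (0, z) = z" if "(0, z) \<in> N" for z
    using N1[OF that] init c by (simp add: \<Theta>_def)
  have vel\<Theta>: "frechet_derivative \<Theta> (at (0, z)) (1, 0) = field_in A V c z" if z: "(0, z) \<in> N" for z
  proof -
    let ?x = "chart_inv c z" let ?d = "chart_at A ?x" let ?q = "snd ?d ?x"
    have zc: "z \<in> chart_image c" "?x \<in> W" using N1[OF z] by auto
    have d: "?d \<in> A" by (rule chart_at)
    have o: "z \<in> overlap c ?d" by (rule in_overlap_chart_at[OF c zc(1)])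
    have q: "?q \<in> overlap ?d c" by (rule transition_in_overlap(1)[OF c d o])
    have "((\<lambda>s. snd ?d (\<theta> s ?x)) has_derivative (\<lambda>s. s *\<^sub>R V ?x)) (at 0)"
      using velocity[OF zc(2)] init[OF zc(2)] by (simp add: has_vector_derivative_def)
    then have 1: "((\<lambda>s. snd c (chart_inv ?d (snd ?d (\<theta> s ?x)))) has_derivative
        (\<lambda>s. jac ?d c ?q (s *\<^sub>R V ?x))) (at 0)"
      by (rule has_derivative_compose) (simp only: init[OF zc(2)] transition_has_derivative[OF d c q])
    \<comment> \<open>These are times at which the orbit of \<open>z\<close> lies in the domain of
      the chart chosen at \<open>?x\<close>, so that its velocity can be converted to
      \<open>c\<close>.\<close>
    define I' where "I' = (\<lambda>s. (s, z)) -` N \<inter> (\<lambda>s. \<Theta> (s, z)) -` overlap c ?d"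
    have I': "open I'"
      unfolding I'_def
    proof (rule continuous_open_preimage)
      show "open ((\<lambda>s. (s, z)) -` N)" using N(1) by (intro open_vimage) (auto intro!: continuous_intros)
      show "continuous_on ((\<lambda>s. (s, z)) -` N) (\<lambda>s. \<Theta> (s, z))"
        by (rule continuous_on_compose2[OF smooth_on_continuous_on[OF smooth\<Theta>]])
          (auto intro!: continuous_intros)
      show "open (overlap c ?d)" by (rule open_overlap[OF c d])
    qed
    have I'0: "0 \<in> I'" using z o init\<Theta>[OF z] by (simp add: I'_def)
    have eq: "snd c (chart_inv ?d (snd ?d (\<theta> s ?x))) = \<Theta> (s, z)" if "s \<in> I'" for s
    proof -
      have "\<theta> s ?x \<in> fst c" using N1[of s z] that by (simp add: I'_def)
      moreover have "chart_inv c (\<Theta> (s, z)) \<in> fst ?d" using that by (simp add: I'_def overlap_def)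
      ultimately have "\<theta> s ?x \<in> fst ?d" using c by (simp add: \<Theta>_def)
      then show ?thesis using d by (simp add: \<Theta>_def)
    qed
    have 2: "((\<lambda>s. \<Theta> (s, z)) has_derivative (\<lambda>s. jac ?d c ?q (s *\<^sub>R V ?x))) (at 0)"
      by (rule has_derivative_transform_within_open[OF 1 I' I'0 eq])
    have 3: "((\<lambda>s. \<Theta> (s, z)) has_derivative (\<lambda>s. frechet_derivative \<Theta> (at (0, z)) (s, 0))) (at 0)"
      by (rule has_derivative_compose[of "\<lambda>s. (s, z)" "\<lambda>s. (s, 0)", OF _ smooth_on_has_derivative[OF smooth\<Theta> z]])
        (auto intro!: derivative_eq_intros)
    have "frechet_derivative \<Theta> (at (0, z)) (1, 0) = jac ?d c ?q (1 *\<^sub>R V ?x)"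
      by (rule fun_cong[OF has_derivative_unique[OF 3 2]])
    also have "\<dots> = to_coord c z (V ?x)" by (simp add: to_coord_jac)
    finally show ?thesis by (simp add: to_coord_def field_in_def)
  qed
  have "flow_box c V \<epsilon> W \<theta> N \<Theta>"
    unfolding flow_box_def
  proof (intro conjI allI impI)
    show "\<Theta> = (\<lambda>z. snd c (\<theta> (fst z) (chart_inv c (snd z))))" by (rule \<Theta>_def)
    fix t z assume "(t, z) \<in> N"
    from N1[OF this] show "t \<in> ?I" "z \<in> chart_image c" "chart_inv c z \<in> W" "\<theta> t (chart_inv c z) \<in> fst c"
      by auto
  qed (rule N(1) smooth\<Theta> init\<Theta> vel\<Theta>; assumption?)+
  with N0 show ?thesis by blast
qed

lemma flow_boxD:
  assumes c: "c \<in> A" and box: "flow_box c V \<epsilon> W \<theta> N \<Theta>"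
  shows "open N" "smooth_on N \<Theta>"
    and "(0, z) \<in> N \<Longrightarrow> \<Theta> (0, z) = z"
    and "(0, z) \<in> N \<Longrightarrow> frechet_derivative \<Theta> (at (0, z)) (1, 0) = field_in A V c z"
    and "(t, z) \<in> N \<Longrightarrow> t \<in> {-\<epsilon><..<\<epsilon>}" "(t, z) \<in> N \<Longrightarrow> chart_inv c z \<in> W"
    and "(t, z) \<in> N \<Longrightarrow> \<Theta> (t, z) \<in> chart_image c"
    and "(t, z) \<in> N \<Longrightarrow> chart_inv c (\<Theta> (t, z)) = \<theta> t (chart_inv c z)"
proof -
  note b = box[unfolded flow_box_def]
  show "open N" "smooth_on N \<Theta>" using b by blast+
  show "\<Theta> (0, z) = z" "frechet_derivative \<Theta> (at (0, z)) (1, 0) = field_in A V c z" if "(0, z) \<in> N"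
    using b that by blast+
  show "t \<in> {-\<epsilon><..<\<epsilon>}" "chart_inv c z \<in> W" if "(t, z) \<in> N"
    using b that by blast+
  have *: "\<Theta> (t, z) = snd c (\<theta> t (chart_inv c z))" using b by simp
  show "\<Theta> (t, z) \<in> chart_image c" "chart_inv c (\<Theta> (t, z)) = \<theta> t (chart_inv c z)" if "(t, z) \<in> N"
  proof -
    have "\<theta> t (chart_inv c z) \<in> fst c" using b that by blast
    then show "\<Theta> (t, z) \<in> chart_image c" "chart_inv c (\<Theta> (t, z)) = \<theta> t (chart_inv c z)"
      unfolding * using c by (simp_all add: chart_in_image)
  qed
qed

lemma differential_flow_box:
  assumes c: "c \<in> A" and box: "flow_box c V \<epsilon> W \<theta> N \<Theta>" and z: "(t, z) \<in> N"
  shows "differential A A (\<theta> t) (chart_inv c z) (coord_vec A c z u) =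
    coord_vec A c (\<Theta> (t, z)) (frechet_derivative \<Theta> (at (t, z)) (0, u))"
proof -
  have \<Theta>: "\<Theta> (t, y) = snd c (\<theta> t (chart_inv c y))" for y using box by (simp add: flow_box_def)
  have into: "z \<in> chart_image c \<and> \<theta> t (chart_inv c z) \<in> fst c" if "(t, z) \<in> N" for z
    using box that unfolding flow_box_def by blast
  have "((\<lambda>y. \<Theta> (t, y)) has_derivative (\<lambda>u. frechet_derivative \<Theta> (at (t, z)) (0, u))) (at z)"
    by (rule has_derivative_compose[of "Pair t" "Pair 0", OF _ smooth_on_has_derivative[OF flow_boxD(2)[OF c box] z]])
      (auto intro!: derivative_eq_intros)
  then have 1: "((\<lambda>y. snd c (\<theta> t (chart_inv c y))) has_derivative
      (\<lambda>u. frechet_derivative \<Theta> (at (t, z)) (0, u))) (at z)" by (simp only: \<Theta>)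
  have 2: "open (Pair t -` N)"
    using flow_boxD(1)[OF c box] by (intro open_vimage) (auto intro!: continuous_intros)
  have zc: "z \<in> chart_image c" using into[OF z] by blast
  show ?thesis
    unfolding \<Theta> by (rule differential_map_coord_vec[OF c zc c 2 _ _ _ 1]) (use into z in auto)
qed

section \<open>From invariance under the flow to vanishing Lie derivatives\<close>

lemma chart_metric_metric_in:
  assumes g: "riemannian_metric A g" and c: "c \<in> A"
  shows "chart_metric (chart_image c) (metric_in A g c)"
proof
  show "open (chart_image c)" by (rule open_chart_image[OF c])
  show "smooth_on (chart_image c) (\<lambda>y. metric_in A g c y u w)" for u w
    using g c by (simp add: riemannian_metric_def)
  fix y assume y: "y \<in> chart_image c"
  let ?x = "chart_inv c y"
  have bil: "bilinear (g ?x)" using g by (simp add: riemannian_metric_def)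
  show "bilinear (metric_in A g c y)"
    using bil linear_compose[OF linear_coord_vec[OF c y]]
    unfolding bilinear_def metric_in_def[abs_def] o_def by blast
  show "metric_in A g c y u w = metric_in A g c y w u" for u w
    using g by (simp add: riemannian_metric_def metric_in_def)
  show "0 < metric_in A g c y u u" if "u \<noteq> 0" for u
    using g that coord_vec_eq_0_iff[OF c y] by (simp add: riemannian_metric_def metric_in_def)
qed

text \<open>The inner product of two transported vectors is constant along the flow; its derivative
  at time zero is the Lie derivative of the metric.\<close>

lemma killing_chart_field_in:
  assumes g: "riemannian_metric A g" and V: "killing_field A g V" and c: "c \<in> A"
  shows "killing_chart (chart_image c) (metric_in A g c) (field_in A V c)"
proof -
  interpret chart_metric "chart_image c" "metric_in A g c" by (rule chart_metric_metric_in[OF g c])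
  let ?v = "field_in A V c" let ?G = "metric_in A g c"
  have smooth_v: "smooth_on (chart_image c) ?v"
    using V c by (simp add: killing_field_def vector_field_def)
  show ?thesis
  proof
    show "smooth_on (chart_image c) ?v" by (rule smooth_v)
    fix y u w assume y: "y \<in> chart_image c"
    obtain \<epsilon> W \<theta> where flow: "chart_inv c y \<in> W" "local_flow A V \<epsilon> W \<theta>"
      and inv: "\<And>t x u w. t \<in> {-\<epsilon><..<\<epsilon>} \<Longrightarrow> x \<in> W \<Longrightarrow>
           g (\<theta> t x) (differential A A (\<theta> t) x u) (differential A A (\<theta> t) x w) = g x u w"
      using V unfolding killing_field_def flow_preserves_metric_def by meson
    obtain N \<Theta> where box: "flow_box c V \<epsilon> W \<theta> N \<Theta>" and N0: "(0, y) \<in> N"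
      using flow_box_exists[OF c y flow(2,1)] by blast
    note N = flow_boxD[OF c box] and diff = differential_flow_box[OF c box]
    note fd = flow_derivative[OF N(1,2) N0 N(3,4) smooth_on_has_derivative[OF smooth_v y]]
    define I' where "I' = (\<lambda>t. (t, y)) -` N"
    have I': "open I'" "0 \<in> I'"
      using N(1) N0 by (auto simp: I'_def intro!: open_vimage continuous_intros)
    have I'N: "(t, y) \<in> N" if "t \<in> I'" for t using that by (simp add: I'_def)
    have eq: "?G (\<Theta> (t, y)) (frechet_derivative \<Theta> (at (t, y)) (0, u)) (frechet_derivative \<Theta> (at (t, y)) (0, w))
        = ?G y u w" if "t \<in> I'" for t
    proof -
      note t = I'N[OF that]
      show ?thesis
        unfolding metric_in_def N(8)[OF t] diff[OF t, symmetric]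
        by (rule inv[OF N(5)[OF t] N(6)[OF t]])
    qed
    have "((\<lambda>t. ?G (\<Theta> (t, y)) (frechet_derivative \<Theta> (at (t, y)) (0, u)) (frechet_derivative \<Theta> (at (t, y)) (0, w)))
      has_derivative (\<lambda>h. dG (\<Theta> (0, y)) (h *\<^sub>R ?v y) (frechet_derivative \<Theta> (at (0, y)) (0, u)) (frechet_derivative \<Theta> (at (0, y)) (0, w))
         + ?G (\<Theta> (0, y)) (h *\<^sub>R frechet_derivative ?v (at y) u) (frechet_derivative \<Theta> (at (0, y)) (0, w))
         + ?G (\<Theta> (0, y)) (frechet_derivative \<Theta> (at (0, y)) (0, u)) (h *\<^sub>R frechet_derivative ?v (at y) w))) (at 0)"
    proof (rule metric_has_derivative[OF I' fd(2) _ fd(3) fd(3)])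
      show "\<Theta> (t, y) \<in> chart_image c" if "t \<in> I'" for t
        by (rule N(7)[OF I'N[OF that]])
    qed
    moreover have "((\<lambda>t. ?G (\<Theta> (t, y)) (frechet_derivative \<Theta> (at (t, y)) (0, u)) (frechet_derivative \<Theta> (at (t, y)) (0, w)))
      has_derivative (\<lambda>h. 0)) (at 0)"
      by (rule has_derivative_transform_within_open[OF has_derivative_const I']) (simp add: eq)
    ultimately have "dG (\<Theta> (0, y)) (1 *\<^sub>R ?v y) (frechet_derivative \<Theta> (at (0, y)) (0, u)) (frechet_derivative \<Theta> (at (0, y)) (0, w))
         + ?G (\<Theta> (0, y)) (1 *\<^sub>R frechet_derivative ?v (at y) u) (frechet_derivative \<Theta> (at (0, y)) (0, w))
         + ?G (\<Theta> (0, y)) (frechet_derivative \<Theta> (at (0, y)) (0, u)) (1 *\<^sub>R frechet_derivative ?v (at y) w) = 0"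
      by (rule fun_cong[OF has_derivative_unique])
    then show "dG y (?v y) u w + ?G y (frechet_derivative ?v (at y) u) w + ?G y u (frechet_derivative ?v (at y) w) = 0"
      by (simp add: fd(1) N(3)[OF N0])
  qed
qed

lemma linear_endo_in:
  assumes "endo_field A J" "c \<in> A" "y \<in> chart_image c" shows "linear (endo_in A J c y)"
proof -
  have "linear (J (chart_inv c y))" using assms by (simp add: endo_field_def)
  from linear_compose[OF linear_compose[OF linear_coord_vec[OF assms(2,3)] this] linear_to_coord[OF assms(2,3)]]
  show ?thesis by (simp only: endo_in_eq[OF assms(2,3), abs_def] o_def)
qed

text \<open>The commutation of \<open>J\<close> with the differential of the flow is written in the
  chart \<open>c\<close>, and both sides are differentiated at time zero.\<close>

lemma holomorphic_in_chart:
  assumes V: "vector_field A V" "flow_preserves_endo A V J" and J: "endo_field A J"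
    and c: "c \<in> A" and y: "y \<in> chart_image c"
  shows "frechet_derivative (field_in A V c) (at y) (endo_in A J c y u) =
    frechet_derivative (\<lambda>y. endo_in A J c y u) (at y) (field_in A V c y)
    + endo_in A J c y (frechet_derivative (field_in A V c) (at y) u)"
proof -
  let ?v = "field_in A V c" let ?J = "endo_in A J c"
  have smooth_v: "smooth_on (chart_image c) ?v"
    using V(1) c by (simp add: vector_field_def)
  have smooth_J: "smooth_on (chart_image c) (\<lambda>y. ?J y u)" for u
    using J c by (simp add: endo_field_def)
  obtain \<epsilon> W \<theta> where flow: "chart_inv c y \<in> W" "local_flow A V \<epsilon> W \<theta>"
    and inv: "\<And>t x u. t \<in> {-\<epsilon><..<\<epsilon>} \<Longrightarrow> x \<in> W \<Longrightarrow>
         differential A A (\<theta> t) x (J x u) = J (\<theta> t x) (differential A A (\<theta> t) x u)"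
    using V(2) unfolding flow_preserves_endo_def by meson
  obtain N \<Theta> where box: "flow_box c V \<epsilon> W \<theta> N \<Theta>" and N0: "(0, y) \<in> N"
    using flow_box_exists[OF c y flow(2,1)] by blast
  note N = flow_boxD[OF c box] and diff = differential_flow_box[OF c box]
  note fd = flow_derivative[OF N(1,2) N0 N(3,4) smooth_on_has_derivative[OF smooth_v y]]
  define I' where "I' = (\<lambda>t. (t, y)) -` N"
  have I': "open I'" "0 \<in> I'"
    using N(1) N0 by (auto simp: I'_def intro!: open_vimage continuous_intros)
  have I'N: "(t, y) \<in> N" if "t \<in> I'" for t using that by (simp add: I'_def)
  have eq: "frechet_derivative \<Theta> (at (t, y)) (0, ?J y u) = ?J (\<Theta> (t, y)) (frechet_derivative \<Theta> (at (t, y)) (0, u))"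
    if t: "t \<in> I'" for t
  proof -
    note tN = I'N[OF t]
    note \<Theta>_in = N(7)[OF tN]
    have "coord_vec A c (\<Theta> (t, y)) (frechet_derivative \<Theta> (at (t, y)) (0, ?J y u)) =
      differential A A (\<theta> t) (chart_inv c y) (J (chart_inv c y) (coord_vec A c y u))"
      by (simp only: diff[OF tN, symmetric] coord_vec_endo_in[OF c y])
    also have "\<dots> = J (\<theta> t (chart_inv c y)) (differential A A (\<theta> t) (chart_inv c y) (coord_vec A c y u))"
      by (rule inv[OF N(5)[OF tN] N(6)[OF tN]])
    also have "\<dots> = coord_vec A c (\<Theta> (t, y)) (?J (\<Theta> (t, y)) (frechet_derivative \<Theta> (at (t, y)) (0, u)))"
      by (simp only: diff[OF tN] coord_vec_endo_in[OF c \<Theta>_in] N(8)[OF tN])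
    finally show ?thesis by (metis to_coord_coord_vec[OF c \<Theta>_in])
  qed
  have \<Theta>0: "\<Theta> (0, y) = y" by (rule N(3)[OF N0])
  have "((\<lambda>t. ?J (\<Theta> (t, y)) (frechet_derivative \<Theta> (at (t, y)) (0, u))) has_derivative
     (\<lambda>h. frechet_derivative (\<lambda>z. ?J z (frechet_derivative \<Theta> (at (0, y)) (0, u))) (at y) (h *\<^sub>R ?v y)
        + ?J (\<Theta> (0, y)) (h *\<^sub>R frechet_derivative ?v (at y) u))) (at 0)"
  proof (rule slot_has_derivative[where L = "\<lambda>t. ?J (\<Theta> (t, y))" and
        L' = "\<lambda>w h. frechet_derivative (\<lambda>z. ?J z w) (at y) (h *\<^sub>R ?v y)", OF I' _ _ fd(3)])
    fix w
    have "((\<lambda>z. ?J z w) has_derivative frechet_derivative (\<lambda>z. ?J z w) (at y)) (at (\<Theta> (0, y)))"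
      unfolding \<Theta>0 by (rule smooth_on_has_derivative[OF smooth_J y])
    from has_derivative_compose[OF fd(2) this]
    show "((\<lambda>t. ?J (\<Theta> (t, y)) w) has_derivative
        (\<lambda>h. frechet_derivative (\<lambda>z. ?J z w) (at y) (h *\<^sub>R ?v y))) (at 0)" .
  qed (use linear_endo_in[OF J c N(7)[OF I'N]] in auto)
  \<comment> \<open>By \<open>eq\<close> the same curve is the transport of the fixed vector
    \<open>?J y u\<close>, to which \<open>flow_derivative\<close> applies directly.\<close>
  moreover have "((\<lambda>t. ?J (\<Theta> (t, y)) (frechet_derivative \<Theta> (at (t, y)) (0, u))) has_derivative
     (\<lambda>h. h *\<^sub>R frechet_derivative ?v (at y) (?J y u))) (at 0)"
    by (rule has_derivative_transform_within_open[OF fd(3) I' eq])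
  ultimately have "frechet_derivative (\<lambda>z. ?J z (frechet_derivative \<Theta> (at (0, y)) (0, u))) (at y) (1 *\<^sub>R ?v y)
        + ?J (\<Theta> (0, y)) (1 *\<^sub>R frechet_derivative ?v (at y) u) = 1 *\<^sub>R frechet_derivative ?v (at y) (?J y u)"
    by (rule fun_cong[OF has_derivative_unique])
  then show ?thesis by (simp add: fd(1) \<Theta>0)
qed

end

section \<open>Hamiltonians\<close>

context atlas
begin

lemma christoffel_eq:
  assumes "riemannian_metric A g" "c \<in> A"
  shows "chart_metric.\<Gamma> (metric_in A g c) y u w = christoffel A g c y u w"
proof -
  interpret chart_metric "chart_image c" "metric_in A g c" by (rule chart_metric_metric_in[OF assms])
  show ?thesis unfolding \<Gamma>_def christoffel_def dG_def ..
qed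

lemma open_nbhd_ball:
  assumes "open U" "x \<in> U"
  obtains r where "r > 0" "ball (snd (chart_at A x) x) r \<subseteq> chart_image (chart_at A x)"
    "\<And>y. y \<in> ball (snd (chart_at A x) x) r \<Longrightarrow> chart_inv (chart_at A x) y \<in> U"
proof -
  let ?c = "chart_at A x"
  have "open {y \<in> chart_image ?c. chart_inv ?c y \<in> U}"
    by (rule open_chart_preimage[OF chart_at(1) assms(1)])
  moreover have "snd ?c x \<in> {y \<in> chart_image ?c. chart_inv ?c y \<in> U}"
    using assms(2) chart_at[of x] by (simp add: chart_in_image)
  ultimately obtain r where "r > 0" "ball (snd ?c x) r \<subseteq> {y \<in> chart_image ?c. chart_inv ?c y \<in> U}"
    by (rule openE)
  then show ?thesis by (intro that[of r]) auto
qed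

text \<open>Coordinate balls serve, being continuous images of convex sets.\<close>

lemma locally_path_connected_nbhd:
  fixes U :: "'m set"
  assumes "open U" "x \<in> U"
  shows "\<exists>W. open W \<and> path_connected W \<and> x \<in> W \<and> W \<subseteq> U"
proof -
  let ?c = "chart_at A x" let ?y = "snd ?c x"
  obtain r where r: "r > 0" "ball ?y r \<subseteq> chart_image ?c"
      "\<And>y. y \<in> ball ?y r \<Longrightarrow> chart_inv ?c y \<in> U"
    using open_nbhd_ball[OF assms] by blast
  define W where "W = {z \<in> fst ?c. snd ?c z \<in> ball ?y r}"
  have "W = chart_inv ?c ` ball ?y r"
  proof
    show "W \<subseteq> chart_inv ?c ` ball ?y r"
    proof
      fix z assume "z \<in> W"
      then show "z \<in> chart_inv ?c ` ball ?y r"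
        using chart_inv_chart[OF chart_at(1), of z x] by (intro image_eqI[of _ _ "snd ?c z"]) (auto simp: W_def)
    qed
    show "chart_inv ?c ` ball ?y r \<subseteq> W"
    proof
      fix z assume "z \<in> chart_inv ?c ` ball ?y r"
      then obtain y where y: "y \<in> ball ?y r" "z = chart_inv ?c y" by blast
      then have "y \<in> chart_image ?c" using r(2) by blast
      then show "z \<in> W" using y chart_at(1) chart_inv_in[OF chart_at(1)] by (simp add: W_def)
    qed
  qed
  moreover have "path_connected (chart_inv ?c ` ball ?y r)"
    by (rule path_connected_continuous_image[OF continuous_on_subset[OF continuous_chart_inv[OF chart_at(1)] r(2)]])
      (simp add: convex_imp_path_connected)
  moreover have "open W" unfolding W_def by (rule open_chart_vimage[OF chart_at(1) open_ball])
  moreover have "x \<in> W" using r(1) chart_at by (simp add: W_def)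
  moreover have "chart_inv ?c ` ball ?y r \<subseteq> U" using r(3) by blast
  ultimately show ?thesis by (intro exI[of _ W]) auto
qed

end

section \<open>Hamiltonians with respect to one Kaehler structure\<close>

locale kaehler_killing = atlas A
  for A :: "('m::{t2_space,second_countable_topology}, 'e::euclidean_space) chart set" +
  fixes g J V
  assumes kaehler: "kaehler A g J" and killing_field: "killing_field A g V"
    and flow_preserves_J: "flow_preserves_endo A V J"
begin

lemma riemannian: "riemannian_metric A g" and endo_field_J: "endo_field A J"
  and JJ: "J x (J x u) = - u" and gJJ: "g x (J x u) (J x w) = g x u w" and parallel: "parallel_endo A g J"
  using kaehler by (auto simp: kaehler_def riemannian_manifold_def)

lemma holomorphic_killing_chart_in:
  assumes c: "c \<in> A"
  shows "holomorphic_killing_chart (chart_image c) (metric_in A g c) (endo_in A J c) (field_in A V c)"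
proof -
  interpret killing_chart "chart_image c" "metric_in A g c" "field_in A V c"
    by (rule killing_chart_field_in[OF riemannian killing_field c])
  show ?thesis
  proof (intro holomorphic_killing_chart.intro kaehler_chart.intro kaehler_chart_axioms.intro
      holomorphic_killing_chart_axioms.intro)
    show "chart_metric (chart_image c) (metric_in A g c)" by (rule chart_metric_axioms)
    show "killing_chart (chart_image c) (metric_in A g c) (field_in A V c)" by (rule killing_chart_axioms)
    show "smooth_on (chart_image c) (\<lambda>y. endo_in A J c y u)" for u
      using endo_field_J c by (simp add: endo_field_def)
    fix y assume y: "y \<in> chart_image c"
    show "linear (endo_in A J c y)" by (rule linear_endo_in[OF endo_field_J c y])
    show "endo_in A J c y (endo_in A J c y u) = - u" for u
      by (simp add: endo_in_eq[OF c y] coord_vec_to_coord[OF c y] JJ linear_neg[OF linear_to_coord[OF c y]]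
          to_coord_coord_vec[OF c y])
    show "metric_in A g c y (endo_in A J c y u) (endo_in A J c y w) = metric_in A g c y u w" for u w
      by (simp add: metric_in_def coord_vec_endo_in[OF c y] gJJ)
    show "frechet_derivative (\<lambda>y. endo_in A J c y w) (at y) u + \<Gamma> y u (endo_in A J c y w)
        - endo_in A J c y (\<Gamma> y u w) = 0" for u w
      using parallel c y unfolding christoffel_eq[OF riemannian c] parallel_endo_def by blast
    show "frechet_derivative (field_in A V c) (at y) (endo_in A J c y u) =
       frechet_derivative (\<lambda>y. endo_in A J c y u) (at y) (field_in A V c y)
       + endo_in A J c y (frechet_derivative (field_in A V c) (at y) u)" for u
      using killing_field
      by (intro holomorphic_in_chart[OF _ flow_preserves_J endo_field_J c y]) (simp add: killing_field_def)
  qed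
qed

definition form :: "('m, 'e) chart \<Rightarrow> 'e \<Rightarrow> 'e \<Rightarrow> real" where
  "form c y w = kaehler_form g J (chart_inv c y) (V (chart_inv c y)) (coord_vec A c y w)"

lemma form_eq:
  assumes "c \<in> A" "y \<in> chart_image c"
  shows "form c y w = metric_in A g c y (endo_in A J c y (field_in A V c y)) w"
  by (simp add: form_def kaehler_form_def metric_in_def coord_vec_endo_in[OF assms] coord_vec_field_in[OF assms])

lemma form_eq_\<alpha>:
  assumes "c \<in> A" "y \<in> chart_image c"
  shows "form c y w = holomorphic_killing_chart.\<alpha> (metric_in A g c) (endo_in A J c) (field_in A V c) y w"
  by (simp only: form_eq[OF assms] holomorphic_killing_chart.\<alpha>_def[OF holomorphic_killing_chart_in[OF assms(1)]])

lemma smooth_form: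
  assumes c: "c \<in> A" shows "smooth_on (chart_image c) (\<lambda>y. form c y w)"
proof -
  interpret holomorphic_killing_chart "chart_image c" "metric_in A g c" "endo_in A J c" "field_in A V c"
    by (rule holomorphic_killing_chart_in[OF c])
  have "form c y w = \<alpha> y w" if "y \<in> chart_image c" for y by (rule form_eq_\<alpha>[OF c that])
  from smooth_on_cong[OF open_chart_image[OF c] this] smooth_\<alpha>[of w] show ?thesis by simp
qed

text \<open>The derivative is prescribed in every chart, so that no choice of chart survives in the
  notion.\<close>

definition local_hamiltonian :: "'m set \<Rightarrow> ('m \<Rightarrow> real) \<Rightarrow> bool" where
  "local_hamiltonian U F \<longleftrightarrow> open U \<and> (\<forall>c\<in>A. \<forall>y\<in>chart_image c. chart_inv c y \<in> U \<longrightarrow>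
     ((\<lambda>z. F (chart_inv c z)) has_derivative form c y) (at y))"

text \<open>The Poincare lemma is applied in the chart at \<open>x\<close>; the other charts follow
  because the form transforms as a tensor.\<close>

lemma local_hamiltonian_exists: "\<exists>U F. local_hamiltonian U F \<and> x \<in> U"
proof -
  let ?c = "chart_at A x"
  have c: "?c \<in> A" by (rule chart_at)
  interpret holomorphic_killing_chart "chart_image ?c" "metric_in A g ?c" "endo_in A J ?c" "field_in A V ?c"
    by (rule holomorphic_killing_chart_in[OF c])
  obtain r where r: "r > 0" "ball (snd ?c x) r \<subseteq> chart_image ?c"
    using open_nbhd_ball[OF open_UNIV, of x] by blast
  let ?B = "ball (snd ?c x) r"
  have "\<exists>F. \<forall>y\<in>?B. (F has_derivative \<alpha> y) (at y)"
  proof (rule poincare_lemma)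
    show "smooth_on ?B (\<lambda>y. \<alpha> y w)" for w by (rule smooth_on_subset[OF smooth_\<alpha> r(2)])
    fix y assume "y \<in> ?B"
    then have y: "y \<in> chart_image ?c" using r(2) by blast
    show "linear (\<alpha> y)" by (rule linear_\<alpha>[OF y])
    show "frechet_derivative (\<lambda>y. \<alpha> y w) (at y) u = frechet_derivative (\<lambda>y. \<alpha> y u) (at y) w" for u w
      by (rule \<alpha>_closed[OF y])
  qed
  then obtain F where F: "\<And>y. y \<in> ?B \<Longrightarrow> (F has_derivative \<alpha> y) (at y)" by blast
  define U where "U = {z \<in> fst ?c. snd ?c z \<in> ?B}"
  have "local_hamiltonian U (\<lambda>z. F (snd ?c z))"
    unfolding local_hamiltonian_def
  proof (intro conjI ballI impI)
    show "open U" unfolding U_def by (rule open_chart_vimage[OF c open_ball])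
    fix d y assume d: "d \<in> A" and y: "y \<in> chart_image d" and yU: "chart_inv d y \<in> U"
    let ?z = "snd ?c (chart_inv d y)"
    have yc: "chart_inv d y \<in> fst ?c" and z: "?z \<in> ?B" using yU by (auto simp: U_def)
    have o: "y \<in> overlap d ?c" using y yc by (simp add: overlap_def)
    have zc: "?z \<in> chart_image ?c" using z r(2) by blast
    have "((\<lambda>z. F (snd ?c (chart_inv d z))) has_derivative (\<lambda>u. \<alpha> ?z (jac d ?c y u))) (at y)"
      by (rule has_derivative_compose[OF transition_has_derivative[OF d c o] F[OF z]])
    moreover have "\<alpha> ?z (jac d ?c y u) = form d y u" for u
      using coord_vec_transition[OF d y c yc, of u] chart_inv_chart[OF c yc]
      by (simp add: form_eq_\<alpha>[OF c zc, symmetric] form_def)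
    ultimately show "((\<lambda>z. F (snd ?c (chart_inv d z))) has_derivative form d y) (at y)" by simp
  qed
  moreover have "x \<in> U" using chart_at(2) r(1) by (simp add: U_def)
  ultimately show ?thesis by blast
qed

lemma local_hamiltonian_unique:
  assumes F: "local_hamiltonian U F" and F': "local_hamiltonian U' F'" and x: "x \<in> U" "x \<in> U'"
  shows "\<exists>W. open W \<and> x \<in> W \<and> (\<forall>y\<in>W. F y - F x = F' y - F' x)"
proof -
  let ?c = "chart_at A x" let ?y = "snd ?c x"
  have c: "?c \<in> A" by (rule chart_at)
  have "open (U \<inter> U')" "x \<in> U \<inter> U'" using F F' x by (auto simp: local_hamiltonian_def)
  then obtain r where r: "r > 0" "ball ?y r \<subseteq> chart_image ?c"
      "\<And>y. y \<in> ball ?y r \<Longrightarrow> chart_inv ?c y \<in> U \<inter> U'"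
    using open_nbhd_ball[of "U \<inter> U'" x] by blast
  have "((\<lambda>y. F (chart_inv ?c y) - F' (chart_inv ?c y)) has_derivative (\<lambda>h. 0)) (at y within ball ?y r)"
    if y: "y \<in> ball ?y r" for y
  proof -
    have yc: "y \<in> chart_image ?c" using r(2) y by blast
    have "((\<lambda>y. F (chart_inv ?c y)) has_derivative form ?c y) (at y)"
      "((\<lambda>y. F' (chart_inv ?c y)) has_derivative form ?c y) (at y)"
      using F F' c yc r(3)[OF y] unfolding local_hamiltonian_def by blast+
    from has_derivative_diff[OF this] show ?thesis by (simp add: has_derivative_at_withinI)
  qed
  from has_derivative_zero_constant[OF convex_ball this]
  obtain k where k: "\<And>y. y \<in> ball ?y r \<Longrightarrow> F (chart_inv ?c y) - F' (chart_inv ?c y) = k" by blast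
  have xk: "F x - F' x = k" using k[of ?y] r(1) c chart_at(2) by simp
  define W where "W = {z \<in> fst ?c. snd ?c z \<in> ball ?y r}"
  have "F z - F x = F' z - F' x" if "z \<in> W" for z
  proof -
    have "F z - F' z = k" using k[of "snd ?c z"] that c by (simp add: W_def)
    with xk show ?thesis by simp
  qed
  moreover have "open W" unfolding W_def by (rule open_chart_vimage[OF c open_ball])
  moreover have "x \<in> W" using chart_at(2) r(1) by (simp add: W_def)
  ultimately show ?thesis by blast
qed

text \<open>A function whose derivative is the smooth \<open>form\<close> is itself smooth, so the
  first-order condition already yields the smoothness that \<open>hamiltonian\<close>
  demands.\<close>

lemma hamiltonian_iff: "hamiltonian A (kaehler_form g J) V f \<longleftrightarrow> local_hamiltonian UNIV f"
proof
  assume f: "hamiltonian A (kaehler_form g J) V f"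
  show "local_hamiltonian UNIV f"
    unfolding local_hamiltonian_def
  proof (intro conjI ballI impI open_UNIV)
    fix c y assume c: "c \<in> A" and y: "y \<in> chart_image c"
    have "smooth_map_on A euclid_atlas UNIV f" using f by (simp add: hamiltonian_def)
    from this[unfolded smooth_map_on_def, rule_format, of "chart_inv c y" c "(UNIV, id)"]
    obtain N where N: "y \<in> N" "smooth_on N (id \<circ> f \<circ> chart_inv c)"
      using c y chart_inv_in[OF c y] by (auto simp: euclid_atlas_def)
    then have "smooth_on N (\<lambda>z. f (chart_inv c z))" by (simp add: o_def)
    note f' = smooth_on_has_derivative[OF this N(1)]
    have "frechet_derivative (\<lambda>z. f (chart_inv c z)) (at y) = form c y"
    proof
      fix u
      show "frechet_derivative (\<lambda>z. f (chart_inv c z)) (at y) u = form c y u"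
        using differential_fun_coord_vec[OF c y f', of u] f by (simp add: hamiltonian_def form_def)
    qed
    with f' show "((\<lambda>z. f (chart_inv c z)) has_derivative form c y) (at y)" by simp
  qed
next
  assume f: "local_hamiltonian UNIV f"
  then have f': "((\<lambda>z. f (chart_inv c z)) has_derivative form c y) (at y)"
    if "c \<in> A" "y \<in> chart_image c" for c y
    using that by (simp add: local_hamiltonian_def)
  have "smooth_map_on A euclid_atlas UNIV f"
    unfolding smooth_map_on_def
  proof (intro ballI impI)
    fix x c and d :: "(real, real) chart" assume c: "c \<in> A" and d: "d \<in> euclid_atlas" and x: "x \<in> fst c"
    have "smooth_on (chart_image c) (\<lambda>z. f (chart_inv c z))"
      by (rule smooth_onI[OF open_chart_image[OF c] f'[OF c] smooth_form[OF c]])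
    then show "\<exists>N. open N \<and> snd c x \<in> N \<and> N \<subseteq> snd c ` (fst c \<inter> UNIV) \<and>
             (f \<circ> chart_inv c) ` N \<subseteq> fst d \<and> smooth_on N (snd d \<circ> f \<circ> chart_inv c)"
      using open_chart_image[OF c] x d
      by (intro exI[of _ "chart_image c"]) (auto simp: euclid_atlas_def o_def chart_image_def)
  qed
  moreover have "differential A euclid_atlas f x w = kaehler_form g J x (V x) w" for x w
  proof -
    let ?c = "chart_at A x" let ?y = "snd ?c x"
    have c: "?c \<in> A" and y: "?y \<in> chart_image ?c" and x: "chart_inv ?c ?y = x"
      using chart_at by (auto simp: chart_in_image)
    from differential_fun_coord_vec[OF c y f'[OF c y], of "to_coord ?c ?y w"]
    show ?thesis by (simp add: form_def x coord_vec_to_coord[OF c y])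
  qed
  ultimately show "hamiltonian A (kaehler_form g J) V f" by (simp add: hamiltonian_def)
qed

sublocale local_potentials "{(U, F). local_hamiltonian U F}"
proof
  fix U F assume "(U, F) \<in> {(U, F). local_hamiltonian U F}"
  then show "open U" by (simp add: local_hamiltonian_def)
next
  fix x show "\<exists>U F. (U, F) \<in> {(U, F). local_hamiltonian U F} \<and> x \<in> U"
    using local_hamiltonian_exists[of x] by simp
next
  fix U F U' F' x
  assume "(U, F) \<in> {(U, F). local_hamiltonian U F}" "(U', F') \<in> {(U, F). local_hamiltonian U F}"
    "x \<in> U" "x \<in> U'"
  then show "\<exists>W. open W \<and> x \<in> W \<and> (\<forall>y\<in>W. F y - F x = F' y - F' x)"
    using local_hamiltonian_unique[of U F U' F' x] by simp
qed

text \<open>Near each point the global potential has the increments of a local Hamiltonian, hence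
  its derivative; the additive constant drops out.\<close>

theorem hamiltonian_exists:
  assumes "connected (UNIV :: 'm set)" "betti_number 1 (euclidean :: 'm topology) = 0"
  shows "\<exists>f. hamiltonian A (kaehler_form g J) V f"
proof (rule global_potential[OF locally_path_connected_nbhd assms])
  fix f assume f: "\<And>U F x. (U, F) \<in> {(U, F). local_hamiltonian U F} \<Longrightarrow> x \<in> U \<Longrightarrow>
    \<exists>W. open W \<and> x \<in> W \<and> W \<subseteq> U \<and> (\<forall>y\<in>W. f y - f x = F y - F x)"
  have "local_hamiltonian UNIV f"
    unfolding local_hamiltonian_def
  proof (intro conjI ballI impI open_UNIV)
    fix c y assume c: "c \<in> A" and y: "y \<in> chart_image c"
    let ?x = "chart_inv c y"
    obtain U F where F: "local_hamiltonian U F" "?x \<in> U" using local_hamiltonian_exists by blast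
    then obtain W where W: "open W" "?x \<in> W" "W \<subseteq> U" "\<forall>z\<in>W. f z - f ?x = F z - F ?x"
      using f[of U F ?x] by auto
    have 1: "((\<lambda>z. F (chart_inv c z)) has_derivative form c y) (at y)"
      using F c y by (simp add: local_hamiltonian_def)
    have 2: "((\<lambda>z. F (chart_inv c z) + (f ?x - F ?x)) has_derivative form c y) (at y)"
      using has_derivative_add[OF 1 has_derivative_const[of "f ?x - F ?x"]] by simp
    show "((\<lambda>z. f (chart_inv c z)) has_derivative form c y) (at y)"
    proof (rule has_derivative_transform_within_open[OF 2 open_chart_preimage[OF c W(1)]])
      show "y \<in> {y \<in> chart_image c. chart_inv c y \<in> W}" using y W(2) by simp
      fix z assume "z \<in> {y \<in> chart_image c. chart_inv c y \<in> W}"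
      then have "f (chart_inv c z) - f ?x = F (chart_inv c z) - F ?x" using W(4) by blast
      then show "F (chart_inv c z) + (f ?x - F ?x) = f (chart_inv c z)" by simp
    qed
  qed
  then show ?thesis unfolding hamiltonian_iff by blast
qed

end

section \<open>The Laplacian of a composite map\<close>

text \<open>The standard basis need not be orthonormal for the metric: this is the trace of an
  endomorphism, which \<open>laplacian_in\<close> takes after raising an index with
  \<open>sharp\<close>.\<close>

definition trace_of :: "('e::euclidean_space \<Rightarrow> 'e) \<Rightarrow> real" where
  "trace_of L = (\<Sum>i\<in>Basis. L i \<bullet> i)"

lemma trace_of_commute:
  fixes L M :: "'e::euclidean_space \<Rightarrow> 'e"
  assumes "linear L" "linear M"
  shows "trace_of (\<lambda>u. L (M u)) = trace_of (\<lambda>u. M (L u))"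
proof -
  have *: "trace_of (\<lambda>u. P (Q u)) = (\<Sum>i\<in>Basis. \<Sum>k\<in>Basis. (Q i \<bullet> k) * (P k \<bullet> i))"
    if "linear P" for P Q :: "'e \<Rightarrow> 'e"
    unfolding trace_of_def
    by (rule sum.cong[OF refl], subst linear_eq_sum_Basis[OF that]) (simp add: inner_sum_left)
  show ?thesis
    unfolding *[OF assms(1)] *[OF assms(2)]
    by (subst sum.swap) (simp add: mult.commute)
qed

text \<open>Conjugation by \<open>K\<close>, whose inverse is \<open>- K\<close>, preserves the
  trace but turns \<open>L\<close> into \<open>- L\<close>.\<close>

lemma trace_of_anticommuting:
  fixes L K :: "'e::euclidean_space \<Rightarrow> 'e"
  assumes L: "linear L" and K: "linear K" and KK: "\<And>u. K (K u) = - u" and anti: "\<And>u. K (L u) = - L (K u)"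
  shows "trace_of L = 0"
proof -
  have neg: "trace_of (\<lambda>u. - M u) = - trace_of M" for M :: "'e \<Rightarrow> 'e"
    by (simp add: trace_of_def sum_negf)
  have "- trace_of L = trace_of (\<lambda>u. L (K (K u)))"
    by (simp add: KK linear_neg[OF L] neg)
  also have "\<dots> = trace_of (\<lambda>u. K (L (K u)))"
    by (rule trace_of_commute[OF linear_compose[OF K L, unfolded o_def] K])
  also have "\<dots> = trace_of L" by (simp add: anti KK linear_neg[OF L])
  finally show ?thesis by simp
qed

section \<open>The chain rule for the Laplacian\<close>

context chart_metric
begin

text \<open>\<open>X b\<close> and \<open>T b\<close> are the gradient and the Hessian endomorphism
  of the component \<open>b\<close> of \<open>\<Phi>\<close>. The second derivatives of
  \<open>h\<close> meet the inner products of the gradients, which leave \<open>l\<close> times the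
  diagonal; the first derivatives meet the traces of the \<open>T b\<close>, which vanish.\<close>

lemma laplacian_compose:
  fixes \<Phi> :: "'e \<Rightarrow> 'f::euclidean_space" and h :: "'f \<Rightarrow> real"
  assumes y: "y \<in> D"
    and \<Phi>: "\<And>z b. z \<in> D \<Longrightarrow> b \<in> Basis \<Longrightarrow> ((\<lambda>z. \<Phi> z \<bullet> b) has_derivative G z (X b z)) (at z)"
    and X: "\<And>b w. b \<in> Basis \<Longrightarrow>
      ((\<lambda>z. G z (X b z) w) has_derivative (\<lambda>u. G y (T b u) w + G y (X b y) (\<Gamma> y u w))) (at y)"
    and conformal: "\<And>b b'. b \<in> Basis \<Longrightarrow> b' \<in> Basis \<Longrightarrow> G y (X b y) (X b' y) = (if b = b' then l else 0)"
    and trace: "\<And>b. b \<in> Basis \<Longrightarrow> trace_of (T b) = 0"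
    and N: "open N" "\<Phi> y \<in> N" and h: "smooth_on N h"
  shows "(\<Sum>i\<in>Basis. sharp (G y) (\<lambda>w. frechet_derivative (\<lambda>z. frechet_derivative (\<lambda>z. h (\<Phi> z)) (at z) w) (at y) i
      - frechet_derivative (\<lambda>z. h (\<Phi> z)) (at y) (\<Gamma> y i w)) \<bullet> i)
    = l * (\<Sum>b\<in>Basis. frechet_derivative (\<lambda>p. frechet_derivative h (at p) b) (at (\<Phi> y)) b)"
proof -
  let ?d = "\<lambda>p. frechet_derivative h (at p)"
  define H where "H b = frechet_derivative (\<lambda>p. ?d p b) (at (\<Phi> y))" for b
  have \<Phi>': "(\<Phi> has_derivative (\<lambda>u. \<Sum>b\<in>Basis. G z (X b z) u *\<^sub>R b)) (at z)" if "z \<in> D" for z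
  proof -
    have "((\<lambda>z. \<Sum>b\<in>Basis. (\<Phi> z \<bullet> b) *\<^sub>R b) has_derivative (\<lambda>u. \<Sum>b\<in>Basis. G z (X b z) u *\<^sub>R b)) (at z)"
      by (rule has_derivative_sum, rule has_derivative_scaleR_left[OF \<Phi>[OF that]])
    then show ?thesis by (simp add: euclidean_representation)
  qed
  define M where "M = D \<inter> \<Phi> -` N"
  have M: "open M" "y \<in> M"
  proof -
    have "continuous_on D \<Phi>"
      by (rule has_derivative_continuous_on[where f' = "\<lambda>z u. \<Sum>b\<in>Basis. G z (X b z) u *\<^sub>R b"])
        (rule has_derivative_at_withinI[OF \<Phi>'])
    then show "open M" unfolding M_def by (rule continuous_open_preimage[OF _ open_D N(1)])
    show "y \<in> M" using y N(2) by (simp add: M_def)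
  qed
  have first: "frechet_derivative (\<lambda>z. h (\<Phi> z)) (at z) w = (\<Sum>b\<in>Basis. G z (X b z) w * ?d (\<Phi> z) b)"
    if "z \<in> M" for z w
  proof -
    have z: "z \<in> D" "\<Phi> z \<in> N" using that by (auto simp: M_def)
    note hz = smooth_on_has_derivative[OF h z(2)]
    have "frechet_derivative (\<lambda>z. h (\<Phi> z)) (at z) w = ?d (\<Phi> z) (\<Sum>b\<in>Basis. G z (X b z) w *\<^sub>R b)"
      using frechet_derivative_eqI[OF has_derivative_compose[OF \<Phi>'[OF z(1)] hz]] by simp
    also have "\<dots> = (\<Sum>b\<in>Basis. G z (X b z) w * ?d (\<Phi> z) b)"
      using has_derivative_linear[OF hz] by (simp add: linear_sum linear_cmul)
    finally show ?thesis .
  qed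
  \<comment> \<open>The Hessian of the composite as an endomorphism: the product rule applied to
    \<open>first\<close>, after the Christoffel terms have cancelled.\<close>
  define Z where "Z u = (\<Sum>b\<in>Basis. (\<Sum>b'\<in>Basis. G y (X b' y) u * H b b') *\<^sub>R X b y + ?d (\<Phi> y) b *\<^sub>R T b u)" for u
  have hess: "frechet_derivative (\<lambda>z. frechet_derivative (\<lambda>z. h (\<Phi> z)) (at z) w) (at y) u
      - frechet_derivative (\<lambda>z. h (\<Phi> z)) (at y) (\<Gamma> y u w) = G y (Z u) w" for u w
  proof -
    have H: "((\<lambda>z. ?d (\<Phi> z) b) has_derivative (\<lambda>u. \<Sum>b'\<in>Basis. G y (X b' y) u * H b b')) (at y)"
      if "b \<in> Basis" for b
    proof -
      note Hb = smooth_on_has_derivative[OF smooth_on_frechet[OF h, of b] N(2)]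
      have "((\<lambda>z. ?d (\<Phi> z) b) has_derivative (\<lambda>u. H b (\<Sum>b'\<in>Basis. G y (X b' y) u *\<^sub>R b'))) (at y)"
        unfolding H_def by (rule has_derivative_compose[OF \<Phi>'[OF y] Hb])
      then show ?thesis
        using has_derivative_linear[OF Hb] by (simp add: linear_sum linear_cmul H_def)
    qed
    have "((\<lambda>z. \<Sum>b\<in>Basis. G z (X b z) w * ?d (\<Phi> z) b) has_derivative
      (\<lambda>u. \<Sum>b\<in>Basis. G y (X b y) w * (\<Sum>b'\<in>Basis. G y (X b' y) u * H b b')
         + (G y (T b u) w + G y (X b y) (\<Gamma> y u w)) * ?d (\<Phi> y) b)) (at y)"
      by (rule has_derivative_sum, rule has_derivative_mult[OF X H])
    then have "frechet_derivative (\<lambda>z. \<Sum>b\<in>Basis. G z (X b z) w * ?d (\<Phi> z) b) (at y) u =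
      (\<Sum>b\<in>Basis. G y (X b y) w * (\<Sum>b'\<in>Basis. G y (X b' y) u * H b b')
         + (G y (T b u) w + G y (X b y) (\<Gamma> y u w)) * ?d (\<Phi> y) b)"
      by (simp add: frechet_derivative_eqI)
    moreover have "frechet_derivative (\<lambda>z. frechet_derivative (\<lambda>z. h (\<Phi> z)) (at z) w) (at y) =
      frechet_derivative (\<lambda>z. \<Sum>b\<in>Basis. G z (X b z) w * ?d (\<Phi> z) b) (at y)"
      by (rule frechet_derivative_cong_open[OF M first])
    moreover have "G y (Z u) w = (\<Sum>b\<in>Basis. (\<Sum>b'\<in>Basis. G y (X b' y) u * H b b') * G y (X b y) w
        + ?d (\<Phi> y) b * G y (T b u) w)"
      unfolding Z_def linear_sum[OF linear_G_left[OF y]] by (simp add: G_linear[OF y])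
    ultimately show ?thesis
      unfolding first[OF M(2)] by (simp add: sum_subtractf[symmetric] algebra_simps)
  qed
  have "(\<Sum>i\<in>Basis. sharp (G y) (\<lambda>w. frechet_derivative (\<lambda>z. frechet_derivative (\<lambda>z. h (\<Phi> z)) (at z) w) (at y) i
      - frechet_derivative (\<lambda>z. h (\<Phi> z)) (at y) (\<Gamma> y i w)) \<bullet> i) = (\<Sum>i\<in>Basis. Z i \<bullet> i)"
    unfolding hess by (simp add: sharp_eqI[OF y])
  also have "\<dots> = (\<Sum>i\<in>Basis. \<Sum>b\<in>Basis. (\<Sum>b'\<in>Basis. G y (X b' y) i * H b b') * (X b y \<bullet> i)
       + ?d (\<Phi> y) b * (T b i \<bullet> i))"
    by (simp add: Z_def inner_sum_left inner_add_left)
  also have "\<dots> = (\<Sum>b\<in>Basis. \<Sum>i\<in>Basis. (\<Sum>b'\<in>Basis. G y (X b' y) i * H b b') * (X b y \<bullet> i)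
       + ?d (\<Phi> y) b * (T b i \<bullet> i))"
    by (rule sum.swap)
  also have "\<dots> = (\<Sum>b\<in>Basis. l * H b b)"
  proof (rule sum.cong[OF refl])
    fix b :: 'f assume b: "b \<in> Basis"
    have "(\<Sum>i\<in>Basis. ?d (\<Phi> y) b * (T b i \<bullet> i)) = 0"
      using trace[OF b] by (simp add: trace_of_def sum_distrib_left[symmetric])
    moreover have "(\<Sum>i\<in>Basis. (\<Sum>b'\<in>Basis. G y (X b' y) i * H b b') * (X b y \<bullet> i)) = l * H b b"
    proof -
      have "(\<Sum>i\<in>Basis. (\<Sum>b'\<in>Basis. G y (X b' y) i * H b b') * (X b y \<bullet> i)) =
        (\<Sum>b'\<in>Basis. \<Sum>i\<in>Basis. G y (X b' y) i * H b b' * (X b y \<bullet> i))"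
        unfolding sum_distrib_right by (rule sum.swap)
      \<comment> \<open>\<open>X b y\<close> is recognised by its expansion in the standard basis,
        so the sum over \<open>i\<close> is an inner product of two gradients with respect to
        \<open>G\<close>.\<close>
      also have "\<dots> = (\<Sum>b'\<in>Basis. H b b' * G y (X b' y) (X b y))"
        unfolding linear_eq_sum_Basis[OF linear_G_right[OF y], of _ "X b y"] sum_distrib_left
        by (simp add: mult_ac)
      also have "\<dots> = (\<Sum>b'\<in>Basis. if b' = b then l * H b b else 0)"
        by (rule sum.cong) (auto simp: conformal b)
      also have "\<dots> = l * H b b" using b by simp
      finally show ?thesis .
    qed
    ultimately show "(\<Sum>i\<in>Basis. (\<Sum>b'\<in>Basis. G y (X b' y) i * H b b') * (X b y \<bullet> i)
       + ?d (\<Phi> y) b * (T b i \<bullet> i)) = l * H b b"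
      by (simp add: sum.distrib)
  qed
  finally show ?thesis by (simp add: H_def sum_distrib_left)
qed

end

section \<open>The Laplacian of Euclidean space\<close>

lemma coord_vec_euclid [simp]: "coord_vec euclid_atlas (UNIV, id) y u = u"
  by (simp add: coord_vec_def differential_def frechet_derivative_id)

lemma metric_in_euclid: "metric_in euclid_atlas euclid_metric (UNIV, id) y u w = u \<bullet> w"
  by (simp add: metric_in_def euclid_metric_def)

lemma chart_metric_euclid: "chart_metric UNIV (metric_in euclid_atlas euclid_metric (UNIV, id))"
proof
  show "bilinear (metric_in euclid_atlas euclid_metric (UNIV, id) y)" for y :: 'a
    by (auto simp: bilinear_def metric_in_euclid intro!: linearI inner_add_left inner_add_right)
qed (auto simp: metric_in_euclid inner_commute intro: smooth_on_const)

lemma laplacian_in_euclid: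
  fixes h :: "'f::euclidean_space \<Rightarrow> real"
  assumes N: "open N" "p \<in> N" and h: "smooth_on N h"
  shows "laplacian_in euclid_atlas euclid_metric (UNIV, id) h p =
    (\<Sum>b\<in>Basis. frechet_derivative (\<lambda>p. frechet_derivative h (at p) b) (at p) b)"
proof -
  let ?m = "metric_in euclid_atlas euclid_metric (UNIV, id) :: 'f \<Rightarrow> 'f \<Rightarrow> 'f \<Rightarrow> real"
  interpret chart_metric UNIV ?m by (rule chart_metric_euclid)
  have chr: "christoffel euclid_atlas euclid_metric (UNIV, id) p u w = 0" for u w :: 'f
    unfolding christoffel_def
    by (rule sharp_eqI) (simp_all add: metric_in_euclid frechet_derivative_const)
  \<comment> \<open>The order of differentiation is exchanged so that the free argument
    \<open>w\<close> becomes the direction of a derivative; the Hessian is then visibly linear in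
    it, as \<open>G_sharp\<close> requires.\<close>
  have hess: "hessian_in euclid_atlas euclid_metric (UNIV, id) h p u w =
      frechet_derivative (\<lambda>p. frechet_derivative h (at p) u) (at p) w" for u w
    using linear_0[OF has_derivative_linear[OF smooth_on_has_derivative[OF h N(2)]]]
    by (simp add: hessian_in_def chr second_derivative_symmetric[OF N(1) h N(2), of u w])
  have "sharp (?m p) (frechet_derivative (\<lambda>p. frechet_derivative h (at p) u) (at p)) \<bullet> b =
      frechet_derivative (\<lambda>p. frechet_derivative h (at p) u) (at p) b" for u b
    using G_sharp[of p "frechet_derivative (\<lambda>p. frechet_derivative h (at p) u) (at p)" b]
      has_derivative_linear[OF smooth_on_has_derivative[OF smooth_on_frechet[OF h] N(2)]]
    by (simp add: metric_in_euclid)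
  then show ?thesis
    unfolding laplacian_in_def hess[abs_def] by simp
qed

section \<open>The harmonic morphism\<close>

text \<open>The structures are indexed by the basis of the target. Their anticommutation yields both
  conditions of the chain rule, orthogonality of the gradients and vanishing of the traces. The
  trace for \<open>b\<close> is killed by a structure other than \<open>J b\<close>, whence the
  bound on the dimension.\<close>

lemma harmonic_morphism_anticommuting:
  fixes A :: "('m::{t2_space,second_countable_topology}, 'e::euclidean_space) chart set"
    and \<phi> :: "'m \<Rightarrow> 'f::euclidean_space"
  assumes kk: "\<And>b. b \<in> Basis \<Longrightarrow> kaehler_killing A g (J b) V"
    and ham: "\<And>b. b \<in> Basis \<Longrightarrow> hamiltonian A (kaehler_form g (J b)) V (\<lambda>x. \<phi> x \<bullet> b)"
    and anti: "\<And>b b' x u. b \<in> Basis \<Longrightarrow> b' \<in> Basis \<Longrightarrow> b \<noteq> b' \<Longrightarrow> J b x (J b' x u) = - J b' x (J b x u)"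
    and dim: "2 \<le> DIM('f)"
  shows "harmonic_morphism A g euclid_atlas euclid_metric \<phi>"
proof -
  obtain b0 :: 'f where b0: "b0 \<in> Basis" using nonempty_Basis by blast
  interpret kaehler_killing A g "J b0" V by (rule kk[OF b0])
  have der: "((\<lambda>z. \<phi> (chart_inv c z) \<bullet> b) has_derivative
      metric_in A g c y (endo_in A (J b) c y (field_in A V c y))) (at y)"
    if "b \<in> Basis" "c \<in> A" "y \<in> chart_image c" for b c y
  proof -
    interpret b: kaehler_killing A g "J b" V by (rule kk[OF that(1)])
    have "((\<lambda>z. \<phi> (chart_inv c z) \<bullet> b) has_derivative b.form c y) (at y)"
      using ham[OF that(1)] that(2,3) unfolding b.hamiltonian_iff b.local_hamiltonian_def by blast
    then show ?thesis by (simp add: b.form_eq[OF that(2,3), abs_def])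
  qed
  have smooth_\<phi>: "smooth_on (chart_image c) (\<lambda>z. \<phi> (chart_inv c z))" if c: "c \<in> A" for c
  proof (rule smooth_on_componentwise[OF open_chart_image[OF c]])
    fix b :: 'f assume b: "b \<in> Basis"
    interpret b: kaehler_killing A g "J b" V by (rule kk[OF b])
    have "((\<lambda>z. \<phi> (chart_inv c z) \<bullet> b) has_derivative b.form c y) (at y)" if "y \<in> chart_image c" for y
      using ham[OF b] c that unfolding b.hamiltonian_iff b.local_hamiltonian_def by blast
    then show "smooth_on (chart_image c) (\<lambda>z. \<phi> (chart_inv c z) \<bullet> b)"
      by (rule smooth_onI[OF open_chart_image[OF c] _ b.smooth_form[OF c]])
  qed
  have smooth_map: "smooth_map_on A euclid_atlas UNIV \<phi>"
    unfolding smooth_map_on_def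
  proof (intro ballI impI)
    fix x c and d :: "('f, 'f) chart" assume c: "c \<in> A" and d: "d \<in> euclid_atlas" and x: "x \<in> fst c"
    show "\<exists>N. open N \<and> snd c x \<in> N \<and> N \<subseteq> snd c ` (fst c \<inter> UNIV) \<and>
             (\<phi> \<circ> chart_inv c) ` N \<subseteq> fst d \<and> smooth_on N (snd d \<circ> \<phi> \<circ> chart_inv c)"
      using open_chart_image[OF c] x d smooth_\<phi>[OF c]
      by (intro exI[of _ "chart_image c"]) (auto simp: euclid_atlas_def o_def chart_image_def)
  qed
  have harmonic: "harmonic_on A g (\<phi> -` U) (h \<circ> \<phi>)"
    if h: "harmonic_on euclid_atlas euclid_metric U h" for U h
  proof -
    have hN: "\<exists>N. open N \<and> p \<in> N \<and> N \<subseteq> U \<and> smooth_on N h" if "p \<in> U" for p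
    proof -
      have "smooth_map_on euclid_atlas euclid_atlas U h" using h by (simp add: harmonic_on_def)
      from this[unfolded smooth_map_on_def, rule_format, OF that, of "(UNIV, id)" "(UNIV, id)"]
      show ?thesis by (simp add: euclid_atlas_def o_def)
    qed
    show ?thesis
      unfolding harmonic_on_def smooth_map_on_def
    proof (intro conjI ballI impI)
      fix x c and d :: "(real, real) chart"
      assume x: "x \<in> \<phi> -` U" and c: "c \<in> A" and d: "d \<in> euclid_atlas" and xc: "x \<in> fst c"
      obtain N where N: "open N" "\<phi> x \<in> N" "N \<subseteq> U" "smooth_on N h" using hN[of "\<phi> x"] x by auto
      define M where "M = chart_image c \<inter> (\<lambda>z. \<phi> (chart_inv c z)) -` N"
      have M: "open M"
        unfolding M_def
        by (rule continuous_open_preimage[OF smooth_on_continuous_on[OF smooth_\<phi>[OF c]] open_chart_image[OF c] N(1)])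
      have "smooth_on M (\<lambda>z. h (\<phi> (chart_inv c z)))"
        by (rule smooth_on_compose[OF M N(4) smooth_on_subset[OF smooth_\<phi>[OF c]]]) (auto simp: M_def)
      moreover have "M \<subseteq> snd c ` (fst c \<inter> \<phi> -` U)"
      proof
        fix z assume "z \<in> M"
        then have z: "z \<in> chart_image c" "\<phi> (chart_inv c z) \<in> U" using N(3) by (auto simp: M_def)
        then show "z \<in> snd c ` (fst c \<inter> \<phi> -` U)"
          using c chart_inv_in[OF c z(1)] by (intro image_eqI[of _ _ "chart_inv c z"]) auto
      qed
      moreover have "snd c x \<in> M" using xc N(2) c by (simp add: M_def chart_in_image)
      ultimately show "\<exists>N. open N \<and> snd c x \<in> N \<and> N \<subseteq> snd c ` (fst c \<inter> \<phi> -` U) \<and>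
             (h \<circ> \<phi> \<circ> chart_inv c) ` N \<subseteq> fst d \<and> smooth_on N (snd d \<circ> (h \<circ> \<phi>) \<circ> chart_inv c)"
        using M d by (intro exI[of _ M]) (auto simp: euclid_atlas_def o_def)
    next
      fix c x assume c: "c \<in> A" and x: "x \<in> fst c \<inter> \<phi> -` U"
      let ?y = "snd c x" let ?G = "metric_in A g c" let ?v = "field_in A V c"
      have y: "?y \<in> chart_image c" and inv: "chart_inv c ?y = x" using x c by (auto simp: chart_in_image)
      interpret killing_chart "chart_image c" ?G ?v
        by (rule killing_chart_field_in[OF riemannian killing_field c])
      define X where "X b z = endo_in A (J b) c z (?v z)" for b z
      define T where "T b u = endo_in A (J b) c ?y (S ?y u)" for b u
      have hk: "holomorphic_killing_chart (chart_image c) ?G (endo_in A (J b) c) ?v" if "b \<in> Basis" for b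
        by (rule kaehler_killing.holomorphic_killing_chart_in[OF kk[OF that] c])
      have anti': "endo_in A (J b) c ?y (endo_in A (J b') c ?y u) = - endo_in A (J b') c ?y (endo_in A (J b) c ?y u)"
        if "b \<in> Basis" "b' \<in> Basis" "b \<noteq> b'" for b b' u
        using anti[OF that]
        by (simp add: endo_in_eq[OF c y] coord_vec_to_coord[OF c y] linear_neg[OF linear_to_coord[OF c y]])
      obtain N where N: "open N" "\<phi> (chart_inv c ?y) \<in> N" "N \<subseteq> U" "smooth_on N h"
        using hN[of "\<phi> x"] x inv by auto
      have "laplacian_in A g c (h \<circ> \<phi>) ?y = (\<Sum>i\<in>Basis. sharp (?G ?y) (\<lambda>w.
          frechet_derivative (\<lambda>z. frechet_derivative (\<lambda>z. h (\<phi> (chart_inv c z))) (at z) w) (at ?y) i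
          - frechet_derivative (\<lambda>z. h (\<phi> (chart_inv c z))) (at ?y) (\<Gamma> ?y i w)) \<bullet> i)"
        unfolding laplacian_in_def hessian_in_def[abs_def] o_def christoffel_eq[OF riemannian c] ..
      also have "\<dots> = ?G ?y (?v ?y) (?v ?y) *
          (\<Sum>b\<in>Basis. frechet_derivative (\<lambda>p. frechet_derivative h (at p) b) (at (\<phi> (chart_inv c ?y))) b)"
      proof (rule laplacian_compose[where X = X and T = T and
              \<Phi> = "\<lambda>z. \<phi> (chart_inv c z)" and h = h, OF y _ _ _ _ N(1,2,4)])
        show "((\<lambda>z. \<phi> (chart_inv c z) \<bullet> b) has_derivative ?G z (X b z)) (at z)"
          if "z \<in> chart_image c" "b \<in> Basis" for z b
          unfolding X_def by (rule der[OF that(2) c that(1)])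
        show "((\<lambda>z. ?G z (X b z) w) has_derivative (\<lambda>u. ?G ?y (T b u) w + ?G ?y (X b ?y) (\<Gamma> ?y u w))) (at ?y)"
          if b: "b \<in> Basis" for b w
        proof -
          interpret b: holomorphic_killing_chart "chart_image c" ?G "endo_in A (J b) c" ?v by (rule hk[OF b])
          show ?thesis using b.\<alpha>_has_derivative[OF y, of w] unfolding b.\<alpha>_def X_def T_def .
        qed
        show "?G ?y (X b ?y) (X b' ?y) = (if b = b' then ?G ?y (?v ?y) (?v ?y) else 0)"
          if b: "b \<in> Basis" and b': "b' \<in> Basis" for b b'
        proof (cases "b = b'")
          case True
          interpret b: holomorphic_killing_chart "chart_image c" ?G "endo_in A (J b) c" ?v by (rule hk[OF b])
          show ?thesis unfolding True[symmetric] X_def by (simp add: b.G_J_J[OF y])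
        next
          case False
          interpret b: holomorphic_killing_chart "chart_image c" ?G "endo_in A (J b) c" ?v by (rule hk[OF b])
          interpret b': holomorphic_killing_chart "chart_image c" ?G "endo_in A (J b') c" ?v by (rule hk[OF b'])
          \<comment> \<open>Moving \<open>J b\<close> across, or moving \<open>J b'\<close> across
            and then exchanging the two, gives the same inner product with opposite signs, so it is
            zero.\<close>
          let ?JJ = "endo_in A (J b) c ?y (endo_in A (J b') c ?y (?v ?y))"
          have "?G ?y (X b ?y) (X b' ?y) = - ?G ?y (?v ?y) ?JJ"
            unfolding X_def by (rule b.G_J_swap[OF y])
          moreover have "?G ?y (X b ?y) (X b' ?y) = ?G ?y ?JJ (?v ?y)"
          proof -
            have "?G ?y (X b' ?y) (X b ?y) = - ?G ?y (?v ?y) (endo_in A (J b') c ?y (endo_in A (J b) c ?y (?v ?y)))"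
              unfolding X_def by (rule b'.G_J_swap[OF y])
            then show ?thesis
              using G_sym[OF y] by (simp add: anti'[OF b' b not_sym[OF False]] G_linear[OF y])
          qed
          ultimately show ?thesis using False G_sym[OF y, of ?JJ "?v ?y"] by simp
        qed
        show "trace_of (T b) = 0" if b: "b \<in> Basis" for b
        proof -
          \<comment> \<open>A second basis vector \<open>k\<close> supplies a structure that
            commutes with \<open>S\<close> and anticommutes with \<open>J b\<close>, hence
            anticommutes with \<open>T b\<close>.\<close>
          have "(Basis :: 'f set) \<noteq> {b}"
          proof
            assume "(Basis :: 'f set) = {b}"
            then have "DIM('f) = card {b}" by (simp only:)
            then show False using dim by (simp only: card.insert card.empty) simp
          qed
          then obtain k where k: "k \<in> Basis" "k \<noteq> b" using b by blast
          interpret b: holomorphic_killing_chart "chart_image c" ?G "endo_in A (J b) c" ?v by (rule hk[OF b])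
          interpret k: holomorphic_killing_chart "chart_image c" ?G "endo_in A (J k) c" ?v by (rule hk[OF k(1)])
          show ?thesis
          proof (rule trace_of_anticommuting[OF _ k.linear_J[OF y] k.J_J[OF y]])
            show "linear (T b)"
              unfolding T_def[abs_def] using linear_compose[OF linear_S[OF y] b.linear_J[OF y]] by (simp add: o_def)
            show "endo_in A (J k) c ?y (T b u) = - T b (endo_in A (J k) c ?y u)" for u
              unfolding T_def k.S_J[OF y] by (rule anti'[OF k(1) b k(2)])
          qed
        qed
      qed
      also have "\<dots> = 0"
      proof -
        have "laplacian_in euclid_atlas euclid_metric (UNIV, id) h (\<phi> x) = 0"
          using h x unfolding harmonic_on_def by (auto simp: euclid_atlas_def)
        then show ?thesis using laplacian_in_euclid[OF N(1,2,4)] by (simp add: inv)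
      qed
      finally show "laplacian_in A g c (h \<circ> \<phi>) (snd c x) = 0" .
    qed
  qed
  show ?thesis
    unfolding harmonic_morphism_def using smooth_map harmonic by blast
qed

lemma Basis_vec_3: "(Basis :: (real ^ 3) set) = {axis 1 1, axis 2 1, axis 3 1}"
  by (auto simp: Basis_vec_def UNIV_3)

theorem corollary3p2:
  fixes A :: "('m::{t2_space,second_countable_topology}, 'e::euclidean_space) chart set"
    and g :: "'m \<Rightarrow> 'e \<Rightarrow> 'e \<Rightarrow> real"
    and J\<^sub>1 J\<^sub>2 J\<^sub>3 :: "'m \<Rightarrow> 'e \<Rightarrow> 'e"
    and V :: "'m \<Rightarrow> 'e"
  assumes "hyperkaehler A g J\<^sub>1 J\<^sub>2 J\<^sub>3"
    and "connected (UNIV :: 'm set)"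
    and "betti_number 1 (euclidean :: 'm topology) = 0"
    and "killing_field A g V"
    and "triholomorphic A J\<^sub>1 J\<^sub>2 J\<^sub>3 V"
  shows "(\<exists>f\<^sub>1. hamiltonian A (kaehler_form g J\<^sub>1) V f\<^sub>1) \<and>
    (\<exists>f\<^sub>2. hamiltonian A (kaehler_form g J\<^sub>2) V f\<^sub>2) \<and>
    (\<exists>f\<^sub>3. hamiltonian A (kaehler_form g J\<^sub>3) V f\<^sub>3) \<and>
    (\<forall>f\<^sub>1 f\<^sub>2 f\<^sub>3.
      hamiltonian A (kaehler_form g J\<^sub>1) V f\<^sub>1 \<longrightarrow>
      hamiltonian A (kaehler_form g J\<^sub>2) V f\<^sub>2 \<longrightarrow>
      hamiltonian A (kaehler_form g J\<^sub>3) V f\<^sub>3 \<longrightarrow>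
      harmonic_morphism A g euclid_atlas euclid_metric
        (\<lambda>x. vector [f\<^sub>1 x, f\<^sub>2 x, f\<^sub>3 x] :: real ^ 3))"
proof -
  have K: "kaehler A g J\<^sub>1" "kaehler A g J\<^sub>2" "kaehler A g J\<^sub>3"
    and J3: "J\<^sub>1 x (J\<^sub>2 x u) = J\<^sub>3 x u" "J\<^sub>3 x u = - J\<^sub>2 x (J\<^sub>1 x u)" for x u
    using assms(1) unfolding hyperkaehler_def by blast+
  have "smooth_atlas A" using K(1) by (simp add: kaehler_def riemannian_manifold_def)
  then have kk: "kaehler_killing A g J\<^sub>1 V" "kaehler_killing A g J\<^sub>2 V" "kaehler_killing A g J\<^sub>3 V"
    using K assms(4,5)
    by (auto simp: kaehler_killing_def kaehler_killing_axioms_def atlas_def triholomorphic_def)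
  have neg: "J x (- u) = - J x u" if "kaehler A g J" for J x u
    using that linear_neg[of "J x" u] by (simp add: kaehler_def endo_field_def)
  have sq: "J x (J x u) = - u" if "kaehler A g J" for J x u
    using that by (simp add: kaehler_def)
  have anti12: "J\<^sub>1 x (J\<^sub>2 x u) = - J\<^sub>2 x (J\<^sub>1 x u)" for x u
    using J3[of x u] by simp
  \<comment> \<open>\<open>J\<^sub>1 J\<^sub>3 = J\<^sub>1 J\<^sub>1 J\<^sub>2\<close> and
    \<open>J\<^sub>3 J\<^sub>1 = - J\<^sub>2 J\<^sub>1 J\<^sub>1\<close>; the squares do the
    rest.\<close>
  have 13: "J\<^sub>1 x (J\<^sub>3 x u) = - J\<^sub>2 x u" "J\<^sub>3 x (J\<^sub>1 x u) = J\<^sub>2 x u" for x u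
    using J3(1)[of x u] J3(2)[of x "J\<^sub>1 x u"] by (auto simp: sq[OF K(1)] neg[OF K(2)] simp flip: J3(1))
  have 23: "J\<^sub>2 x (J\<^sub>3 x u) = J\<^sub>1 x u" "J\<^sub>3 x (J\<^sub>2 x u) = - J\<^sub>1 x u" for x u
  proof -
    show "J\<^sub>2 x (J\<^sub>3 x u) = J\<^sub>1 x u" by (simp add: J3(2)[of x u] neg[OF K(2)] sq[OF K(2)])
    show "J\<^sub>3 x (J\<^sub>2 x u) = - J\<^sub>1 x u"
      using J3(1)[of x "J\<^sub>2 x u"] by (simp add: sq[OF K(2)] neg[OF K(1)])
  qed
  have "harmonic_morphism A g euclid_atlas euclid_metric (\<lambda>x. vector [f\<^sub>1 x, f\<^sub>2 x, f\<^sub>3 x] :: real ^ 3)"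
    if f: "hamiltonian A (kaehler_form g J\<^sub>1) V f\<^sub>1" "hamiltonian A (kaehler_form g J\<^sub>2) V f\<^sub>2"
      "hamiltonian A (kaehler_form g J\<^sub>3) V f\<^sub>3" for f\<^sub>1 f\<^sub>2 f\<^sub>3
  proof -
    \<comment> \<open>Indexed in this way, the component of the map along \<open>b\<close> is the
      Hamiltonian for \<open>J b\<close>.\<close>
    define J where "J b = (if b = axis 1 1 then J\<^sub>1 else if b = axis 2 1 then J\<^sub>2 else J\<^sub>3)" for b :: "real ^ 3"
    have J: "J (axis 1 1) = J\<^sub>1" "J (axis 2 1) = J\<^sub>2" "J (axis 3 1) = J\<^sub>3"
      by (simp_all add: J_def axis_eq_axis)
    show ?thesis
    proof (rule harmonic_morphism_anticommuting)
      show "kaehler_killing A g (J b) V" if "b \<in> Basis" for b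
        using that kk unfolding Basis_vec_3 by (auto simp: J)
      show "hamiltonian A (kaehler_form g (J b)) V (\<lambda>x. vector [f\<^sub>1 x, f\<^sub>2 x, f\<^sub>3 x] \<bullet> b)" if "b \<in> Basis" for b
        using that f unfolding Basis_vec_3 by (auto simp: J inner_axis vector_3)
      show "J b x (J b' x u) = - J b' x (J b x u)"
        if "b \<in> Basis" "b' \<in> Basis" "b \<noteq> b'" for b b' x u
        using that unfolding Basis_vec_3
        by (elim insertE emptyE) (simp_all add: J anti12 13 23)
    qed simp
  qed
  then show ?thesis
    using kaehler_killing.hamiltonian_exists[OF kk(1) assms(2,3)]
      kaehler_killing.hamiltonian_exists[OF kk(2) assms(2,3)]
      kaehler_killing.hamiltonian_exists[OF kk(3) assms(2,3)] by blast
qed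

end
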